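(* Let $f\in L^p(\mathbb{R}^n)$ with $\|f\|_p>0$, where $p\in[1,n)$ or $n=p=1$. Let $U\colon[0,\infty)\to[0,\infty)$ be a nondecreasing continuous function. Assume that there is a number $N>0$ such that $$ \int_N^{+\infty}\bigl[\sigma_p\bigl(f,t^{-p/n}\bigr)\bigr]^p\,dU(t)<\infty, $$ where the integral is understood in the Lebesgue--Stieltjes sense. Then $$ \int_{\mathbb{R}^n}|f(x)|^p\,U\bigl(|f(x)|\,\|f\|_p^{-1}\bigr)\,dx<\infty. $$
   Context: Functions are real-valued; $L^p$-norms $\|\cdot\|_p$ are with respect to Lebesgue measure on $\mathbb{R}^n$, $q=p/(p-1)$ ($q=\infty$ if $p=1$), and for a vector field $\Phi$, $\|\Phi\|_q$ is the $L^q$-norm of its Euclidean norm $|\Phi|$. For $f\in L^p(\mathbb{R}^n)$ and $\varepsilon>0$, $$\sigma_p(f,\varepsilon):=\sup\Bigl\{\int_{\mathbb{R}^n}\mathrm{div}\,\Phi(x) f(x)\,dx:\ \Phi\in C_0^\infty(\mathbb{R}^n,\mathbb{R}^n),\ \|\mathrm{div}\,\Phi\|_q\le 1,\ \|\Phi\|_q\le\varepsilon\Bigr\},$$ where $C_0^\infty(\mathbb{R}^n,\mathbb{R}^n)$ is the set of infinitely differentiable compactly supported vector fields. *)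

theory Defs
  imports "HOL-Analysis.Analysis" "HOL-Probability.Essential_Supremum"
begin

text \<open>
  The norm of \<open>L\<^sup>p(\<real>\<^sup>n)\<close>, \<open>1 \<le> p \<le> \<infinity>\<close>, with values in \<open>[0, \<infinity>]\<close>; a function taking values in a
  normed space enters through its pointwise norm. The case distinction on \<open>\<infinity>\<close> stands in for
  the missing real powers on \<^typ>\<open>ennreal\<close>.
\<close>

definition Lp_norm :: "ereal \<Rightarrow> ('a::euclidean_space \<Rightarrow> 'b::real_normed_vector) \<Rightarrow> ennreal" where
  "Lp_norm p f =
    (if p = \<infinity> then e2ennreal (esssup lebesgue (\<lambda>x. ereal (norm (f x))))
     else let I = (\<integral>\<^sup>+ x. ennreal (norm (f x) powr real_of_ereal p) \<partial>lebesgue)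
          in if I = \<infinity> then \<infinity> else ennreal (enn2real I powr (1 / real_of_ereal p)))"

definition Lp_space :: "ereal \<Rightarrow> ('a::euclidean_space \<Rightarrow> real) set" where
  "Lp_space p = {f. f \<in> borel_measurable lebesgue \<and> Lp_norm p f < \<infinity>}"

definition conjugate_exponent :: "real \<Rightarrow> ereal" where
  "conjugate_exponent p = (if p = 1 then \<infinity> else ereal (p / (p - 1)))"

definition partial_deriv :: "'n \<Rightarrow> (real ^ 'n \<Rightarrow> 'b) \<Rightarrow> real ^ 'n::finite \<Rightarrow> 'b::real_normed_vector" where
  "partial_deriv i f x = frechet_derivative f (at x) (axis i 1)"

primrec Ck :: "nat \<Rightarrow> (real ^ 'n::finite \<Rightarrow> 'b::real_normed_vector) \<Rightarrow> bool" where
  "Ck 0 f \<longleftrightarrow> continuous_on UNIV f"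
| "Ck (Suc k) f \<longleftrightarrow> (\<forall>x. f differentiable (at x)) \<and> (\<forall>i. Ck k (partial_deriv i f))"

definition test_fields :: "(real ^ 'n::finite \<Rightarrow> real ^ 'n) set" where
  "test_fields = {\<Phi>. (\<forall>k. Ck k \<Phi>) \<and> compact (closure {x. \<Phi> x \<noteq> 0})}"

definition divergence :: "(real ^ 'n::finite \<Rightarrow> real ^ 'n) \<Rightarrow> real ^ 'n \<Rightarrow> real" where
  "divergence \<Phi> x = (\<Sum>i\<in>UNIV. partial_deriv i \<Phi> x $ i)"

text \<open>
  For \<open>f\<close> in \<open>L\<^sup>p\<close> the set below contains \<open>0\<close> (take \<open>\<Phi> = 0\<close>) and is bounded above by the norm of \<open>f\<close>
  (Hoelder's inequality), so that the supremum in \<^typ>\<open>real\<close> is the true one.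
\<close>

definition sigma_p :: "real \<Rightarrow> (real ^ 'n::finite \<Rightarrow> real) \<Rightarrow> real \<Rightarrow> real" where
  "sigma_p p f \<epsilon> =
    Sup {(\<integral>x. divergence \<Phi> x * f x \<partial>lebesgue) | \<Phi>.
           \<Phi> \<in> test_fields \<and>
           Lp_norm (conjugate_exponent p) (divergence \<Phi>) \<le> 1 \<and>
           Lp_norm (conjugate_exponent p) \<Phi> \<le> ennreal \<epsilon>}"

text \<open>
  The Lebesgue--Stieltjes measure \<open>dU\<close> of a nondecreasing continuous function \<open>U\<close> on \<open>[0, \<infinity>)\<close>.
  Since \<^const>\<open>interval_measure\<close> expects a function on the whole line, \<open>U\<close> is extended by \<open>U 0\<close> to
  the negative half-line, which then has measure zero.
\<close>

definition stieltjes_measure :: "(real \<Rightarrow> real) \<Rightarrow> real measure" where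
  "stieltjes_measure U = interval_measure (\<lambda>t. U (max 0 t))"

end

theory Submission
  imports Defs
begin

text \<open>
  Write \<open>E\<^sub>t\<close> for the set where \<open>\<bar>f\<bar> \<ge> t \<parallel>f\<parallel>\<^sub>p\<close>. The heart of the matter is the tail estimate
  \<open>\<integral>\<^bsub>E\<^sub>t\<^esub> \<bar>f\<bar>\<^sup>p \<le> K \<sigma>\<^sub>p(f, t\<^sup>-\<^sup>p\<^sup>/\<^sup>n)\<^sup>p\<close> with a constant \<open>K\<close> independent of \<open>t > 0\<close> (lemma \<open>tail_le_sigma_p\<close>). Since
  \<open>U(s) = U(N) + dU([N, s])\<close> for \<open>s \<ge> N\<close>, Fubini's theorem turns the integral of \<open>\<bar>f\<bar>\<^sup>p U(\<bar>f\<bar> / \<parallel>f\<parallel>\<^sub>p)\<close> into at most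
  \<open>U(N) \<parallel>f\<parallel>\<^sub>p\<^sup>p\<close> plus the \<open>dU\<close>-integral of these tails over \<open>[N, \<infinity>)\<close>, and the theorem follows.

  The tail estimate comes from testing \<open>\<sigma>\<^sub>p\<close> with explicit fields. Given a continuous function \<open>h\<close> of compact
  support, the equation \<open>div \<Phi> = h\<close> is solved approximately by convolving \<open>h\<close> with \<open>V\<^sub>\<epsilon> - V\<^sub>M\<close>. Here \<open>V\<^sub>s\<close> is the field
  \<open>x \<bar>x\<bar>\<^sup>-\<^sup>n\<close> made smooth by a cutoff near the ball of radius \<open>s\<close>; its divergence \<open>\<phi>\<^sub>s\<close> is a nonnegative bump of
  mass \<open>m > 0\<close> at scale \<open>s\<close>. The difference \<open>V\<^sub>\<epsilon> - V\<^sub>M\<close> has compact support and is bounded by a multiple of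
  \<open>\<bar>z\<bar>\<^sup>1\<^sup>-\<^sup>n\<close> uniformly in \<open>\<epsilon> \<le> M\<close>. Splitting this kernel at \<open>\<bar>z\<bar> = \<delta>\<close> into a part in \<open>L\<^sup>1\<close> and a part in \<open>L\<^sup>q\<close>, Young's
  inequality for convolutions gives \<open>\<parallel>\<Phi>\<parallel>\<^sub>q \<le> C (\<delta> \<parallel>h\<parallel>\<^sub>q + \<delta>\<^sup>1\<^sup>-\<^sup>n\<^sup>/\<^sup>p \<parallel>h\<parallel>\<^sub>1)\<close>; the far part belongs to \<open>L\<^sup>q\<close> because
  \<open>p < n\<close> or \<open>p = 1\<close>. The divergence \<open>h * \<phi>\<^sub>\<epsilon> - h * \<phi>\<^sub>M\<close> has \<open>L\<^sup>q\<close>-norm at most a multiple of \<open>\<parallel>h\<parallel>\<^sub>q\<close>, and paired with \<open>f\<close> it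
  tends to \<open>m \<integral> h f\<close> as \<open>\<epsilon> \<rightarrow> 0\<close> and \<open>M \<rightarrow> \<infinity>\<close>. Hence (lemma \<open>pairing_le_sigma_p_Cc\<close>)
  \<open>\<integral> h f \<le> C \<sigma>\<^sub>p(f, \<delta>) (\<parallel>h\<parallel>\<^sub>q + \<delta>\<^sup>-\<^sup>n\<^sup>/\<^sup>p \<parallel>h\<parallel>\<^sub>1)\<close>, which extends to bounded measurable \<open>h\<close> of bounded support.

  With \<open>\<delta> = t\<^sup>-\<^sup>p\<^sup>/\<^sup>n\<close>, so that \<open>\<delta>\<^sup>-\<^sup>n\<^sup>/\<^sup>p = t\<close>, and \<open>h = sgn f \<bar>f\<bar>\<^sup>p\<^sup>-\<^sup>1\<close> on a truncation of \<open>E\<^sub>t\<close> this is the tail estimate.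
\<close>

section \<open>Smooth functions\<close>

text \<open>
  The functions \<open>t\<^sup>-\<^sup>m e\<^sup>-\<^sup>1\<^sup>/\<^sup>t\<close> on the positive half-line, extended by zero. The linear span of
  these is closed under differentiation, which makes the case \<open>m = 0\<close> smooth on all of \<open>\<real>\<close>.
\<close>

definition bump_aux :: "nat \<Rightarrow> real \<Rightarrow> real" where
  "bump_aux m t = (if t > 0 then (1 / t) ^ m * exp (- (1 / t)) else 0)"

lemma bump_aux_tendsto_0: "(bump_aux m \<longlongrightarrow> 0) (at_right 0)"
proof -
  have "((\<lambda>u::real. u ^ m / exp u) \<longlongrightarrow> 0) at_top"
    by (rule tendsto_power_div_exp_0)
  then have "((\<lambda>t::real. (inverse t) ^ m / exp (inverse t)) \<longlongrightarrow> 0) (at_right 0)"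
    by (rule filterlim_compose[OF _ filterlim_inverse_at_top_right])
  moreover have "\<forall>\<^sub>F t in at_right (0::real). (inverse t) ^ m / exp (inverse t) = bump_aux m t"
    by (auto simp: eventually_at_filter bump_aux_def exp_minus field_simps)
  ultimately show ?thesis
    by (rule Lim_transform_eventually)
qed

lemma bump_aux_deriv:
  "(bump_aux m has_real_derivative bump_aux (m + 2) t - m * bump_aux (m + 1) t) (at t)"
proof -
  consider "t < 0" | "t > 0" | "t = 0" by linarith
  then show ?thesis
  proof cases
    case 1
    have "((\<lambda>_. 0) has_real_derivative 0) (at t)" by simp
    then have "(bump_aux m has_real_derivative 0) (at t)"
      by (rule has_field_derivative_transform_within_open[of _ _ _ "{..<0}"])
         (use 1 in \<open>auto simp: bump_aux_def\<close>)
    with 1 show ?thesis by (simp add: bump_aux_def)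
  next
    case 2
    have e: "((\<lambda>t. exp (- (1 / t))) has_real_derivative exp (- (1 / t)) * (1 / (t * t))) (at t)"
    proof (rule DERIV_chain2[where g = "\<lambda>t. - (1 / t)"])
      show "((\<lambda>t. - (1 / t)) has_real_derivative 1 / (t * t)) (at t)"
        using 2 by (auto intro!: derivative_eq_intros)
    qed (rule DERIV_exp)
    have q: "((\<lambda>t. (1 / t) ^ m) has_real_derivative m * (1 / t) ^ (m - 1) * (- 1 / (t * t))) (at t)"
      using 2 by (auto intro!: derivative_eq_intros)
    have "m * (1 / t) ^ (m - 1) * (- 1 / (t * t)) = - (m * (1 / t) ^ (m + 1))"
      using 2 by (cases m) (auto simp: field_simps)
    then have "m * (1 / t) ^ (m - 1) * (- 1 / (t * t)) * exp (- (1 / t))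
        + exp (- (1 / t)) * (1 / (t * t)) * (1 / t) ^ m = bump_aux (m + 2) t - m * bump_aux (m + 1) t"
      using 2 by (simp add: bump_aux_def power2_eq_square mult_ac)
    then have "((\<lambda>t. (1 / t) ^ m * exp (- (1 / t))) has_real_derivative
        bump_aux (m + 2) t - m * bump_aux (m + 1) t) (at t)"
      using DERIV_mult[OF q e] by (simp only:)
    then show ?thesis
      by (rule has_field_derivative_transform_within_open[of _ _ _ "{0<..}"])
         (use 2 in \<open>auto simp: bump_aux_def\<close>)
  next
    case 3
    have "((\<lambda>y. (bump_aux m y - bump_aux m 0) / (y - 0)) \<longlongrightarrow> 0) (at_right 0)"
    proof (rule Lim_transform_eventually[OF bump_aux_tendsto_0[of "Suc m"]])
      show "\<forall>\<^sub>F x in at_right 0. bump_aux (Suc m) x = (bump_aux m x - bump_aux m 0) / (x - 0)"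
        by (auto simp: eventually_at_filter bump_aux_def)
    qed
    moreover have "((\<lambda>y. (bump_aux m y - bump_aux m 0) / (y - 0)) \<longlongrightarrow> 0) (at_left 0)"
      by (rule tendsto_eventually) (auto simp: eventually_at_filter bump_aux_def)
    ultimately have "((\<lambda>y. (bump_aux m y - bump_aux m 0) / (y - 0)) \<longlongrightarrow> 0) (at 0)"
      by (simp add: filterlim_split_at)
    with 3 show ?thesis
      by (simp add: has_field_derivative_iff bump_aux_def)
  qed
qed

lemma bump_aux_bounds: "0 \<le> bump_aux 0 t" "bump_aux 0 t \<le> 1" "t \<le> 0 \<Longrightarrow> bump_aux 0 t = 0"
  "t > 0 \<Longrightarrow> bump_aux 0 t > 0"
  by (auto simp: bump_aux_def)

text \<open>
  A class of \<open>C\<^sup>\<infinity>\<close> functions on the line, given by closure rules rich enough for the radial profiles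
  below. The rule \<open>powr\<close> asks the second factor to vanish left of some \<open>r > 0\<close>, away from
  the singularity of the power at the origin.
\<close>

inductive_set smooth_real :: "(real \<Rightarrow> real) set" where
  bump: "bump_aux m \<in> smooth_real"
| const: "(\<lambda>_. c) \<in> smooth_real"
| affine: "g \<in> smooth_real \<Longrightarrow> (\<lambda>t. g (a * t + b)) \<in> smooth_real"
| add: "g \<in> smooth_real \<Longrightarrow> h \<in> smooth_real \<Longrightarrow> (\<lambda>t. g t + h t) \<in> smooth_real"
| mult: "g \<in> smooth_real \<Longrightarrow> h \<in> smooth_real \<Longrightarrow> (\<lambda>t. g t * h t) \<in> smooth_real"
| antideriv: "g' \<in> smooth_real \<Longrightarrow> (\<And>t. (g has_real_derivative g' t) (at t)) \<Longrightarrow> g \<in> smooth_real"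
| powr: "g \<in> smooth_real \<Longrightarrow> r > 0 \<Longrightarrow> (\<And>t. t < r \<Longrightarrow> g t = 0) \<Longrightarrow>
    (\<lambda>t. t powr a * g t) \<in> smooth_real"

text \<open>
  The class is closed under differentiation, so its members are differentiable to every order.
\<close>

lemma smooth_real_deriv:
  "g \<in> smooth_real \<Longrightarrow> \<exists>g'\<in>smooth_real. \<forall>t. (g has_real_derivative g' t) (at t)"
proof (induction rule: smooth_real.induct)
  case (bump m)
  have "(\<lambda>t. bump_aux (m + 2) t + (- real m) * bump_aux (m + 1) t) \<in> smooth_real"
    by (intro smooth_real.add smooth_real.mult smooth_real.const smooth_real.bump)
  then show ?case
    using bump_aux_deriv[of m] by (intro bexI) auto
next
  case (const c)
  show ?case by (intro bexI[of _ "\<lambda>_. 0"] smooth_real.intros) auto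
next
  case (affine g a b)
  then obtain g' where g': "g' \<in> smooth_real" "\<And>t. (g has_real_derivative g' t) (at t)"
    by blast
  have "((\<lambda>t. g (a * t + b)) has_real_derivative a * g' (a * t + b)) (at t)" for t
  proof -
    have "((\<lambda>t. a * t + b) has_real_derivative a) (at t)"
      by (auto intro!: derivative_eq_intros)
    from DERIV_chain2[OF g'(2) this] show ?thesis by (simp add: mult.commute)
  qed
  moreover have "(\<lambda>t. a * g' (a * t + b)) \<in> smooth_real"
    using g' by (intro smooth_real.mult smooth_real.const smooth_real.affine)
  ultimately show ?case by (intro bexI[of _ "\<lambda>t. a * g' (a * t + b)"]) auto
next
  case (add g h)
  then obtain g' h' where g': "g' \<in> smooth_real" "\<And>t. (g has_real_derivative g' t) (at t)"
    "h' \<in> smooth_real" "\<And>t. (h has_real_derivative h' t) (at t)"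
    by blast
  have "((\<lambda>t. g t + h t) has_real_derivative g' t + h' t) (at t)" for t
    by (intro derivative_intros g')
  moreover have "(\<lambda>t. g' t + h' t) \<in> smooth_real"
    using g' by (intro smooth_real.add)
  ultimately show ?case by (intro bexI[of _ "\<lambda>t. g' t + h' t"]) auto
next
  case (mult g h)
  then obtain g' h' where g': "g' \<in> smooth_real" "\<And>t. (g has_real_derivative g' t) (at t)"
    "h' \<in> smooth_real" "\<And>t. (h has_real_derivative h' t) (at t)"
    by blast
  have "((\<lambda>t. g t * h t) has_real_derivative g' t * h t + h' t * g t) (at t)" for t
    by (intro DERIV_mult g')
  moreover have "(\<lambda>t. g' t * h t + h' t * g t) \<in> smooth_real"
    using g' mult by (intro smooth_real.add smooth_real.mult)
  ultimately show ?case by (intro bexI[of _ "\<lambda>t. g' t * h t + h' t * g t"]) auto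
next
  case (antideriv g' g)
  then show ?case by blast
next
  case (powr g r a)
  then obtain g' where g': "g' \<in> smooth_real" "\<And>t. (g has_real_derivative g' t) (at t)"
    by blast
  have g'0: "g' t = 0" if "t < r" for t
  proof -
    have "((\<lambda>_. 0) has_real_derivative 0) (at t)" by simp
    then have "(g has_real_derivative 0) (at t)"
      by (rule has_field_derivative_transform_within_open[of _ _ _ "{..<r}"])
         (use that powr in auto)
    then show ?thesis using g'(2) DERIV_unique by blast
  qed
  let ?d = "\<lambda>t. a * (t powr (a - 1) * g t) + t powr a * g' t"
  have "((\<lambda>t. t powr a * g t) has_real_derivative ?d t) (at t)" for t
  proof (cases "t < r")
    case True
    have "((\<lambda>_. 0) has_real_derivative 0) (at t)" by simp
    then have "((\<lambda>t. t powr a * g t) has_real_derivative 0) (at t)"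
      by (rule has_field_derivative_transform_within_open[of _ _ _ "{..<r}"])
         (use True powr in auto)
    then show ?thesis using True powr g'0 by auto
  next
    case False
    then have "t > 0" using powr by simp
    then show ?thesis
      by (auto intro!: derivative_eq_intros g')
  qed
  moreover have "?d \<in> smooth_real"
    using g' g'0 powr by (intro smooth_real.add smooth_real.mult[OF smooth_real.const] smooth_real.powr[of _ r]) auto
  ultimately show ?case by (intro bexI[of _ ?d]) auto
qed

lemma smooth_real_continuous: "g \<in> smooth_real \<Longrightarrow> continuous_on S g"
  using smooth_real_deriv[of g] by (auto intro!: continuous_at_imp_continuous_on DERIV_isCont)

lemma partial_deriv_eqI:
  assumes "(f has_derivative D) (at x)"
  shows "partial_deriv i f x = D (axis i 1)"
  using frechet_derivative_at[OF assms] by (simp add: partial_deriv_def)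

lemma has_derivative_partial_deriv:
  fixes f :: "real ^ 'n::finite \<Rightarrow> 'b::real_normed_vector"
  assumes "f differentiable (at x)"
  shows "(f has_derivative (\<lambda>v. \<Sum>i\<in>UNIV. v $ i *\<^sub>R partial_deriv i f x)) (at x)"
proof -
  have D: "(f has_derivative frechet_derivative f (at x)) (at x)"
    using assms by (simp add: frechet_derivative_works)
  then interpret D: bounded_linear "frechet_derivative f (at x)"
    by (rule has_derivative_bounded_linear)
  have "frechet_derivative f (at x) = (\<lambda>v. \<Sum>i\<in>UNIV. v $ i *\<^sub>R partial_deriv i f x)"
  proof
    fix v :: "real ^ 'n"
    have "v = (\<Sum>i\<in>UNIV. v $ i *\<^sub>R axis i 1)"
      by (simp add: basis_expansion flip: scalar_mult_eq_scaleR)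
    then have "frechet_derivative f (at x) v
        = frechet_derivative f (at x) (\<Sum>i\<in>UNIV. v $ i *\<^sub>R axis i 1)"
      by (rule arg_cong)
    also have "\<dots> = (\<Sum>i\<in>UNIV. v $ i *\<^sub>R partial_deriv i f x)"
      by (simp add: D.sum D.scaleR partial_deriv_def)
    finally show "frechet_derivative f (at x) v = (\<Sum>i\<in>UNIV. v $ i *\<^sub>R partial_deriv i f x)" .
  qed
  with D show ?thesis by simp
qed

lemma Ck_imp_continuous: "Ck k f \<Longrightarrow> continuous_on S f"
  by (cases k) (auto intro: continuous_on_subset continuous_at_imp_continuous_on
      differentiable_imp_continuous_within)

lemma Ck_Suc_imp: "Ck (Suc k) f \<Longrightarrow> Ck k f"
proof (induction k arbitrary: f)
  case 0
  then show ?case using Ck_imp_continuous[of "Suc 0"] by simp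
qed auto

lemma Ck_add: "Ck k f \<Longrightarrow> Ck k g \<Longrightarrow> Ck k (\<lambda>x. f x + g x)"
proof (induction k arbitrary: f g)
  case (Suc k)
  have "partial_deriv i (\<lambda>x. f x + g x) = (\<lambda>x. partial_deriv i f x + partial_deriv i g x)" for i
    using Suc.prems
    by (intro ext, subst partial_deriv_eqI[OF has_derivative_add])
       (auto simp: partial_deriv_def frechet_derivative_works)
  with Suc show ?case by auto
qed (auto intro: continuous_intros)

lemma Ck_const: "Ck k (\<lambda>_::real ^ 'n::finite. c)"
proof (induction k arbitrary: c)
  case (Suc k)
  have "partial_deriv i (\<lambda>_::real ^ 'n. c) = (\<lambda>_. 0)" for i
    by (auto simp: partial_deriv_def)
  with Suc show ?case by auto
qed auto

lemma Ck_mult: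
  fixes f g :: "real ^ 'n::finite \<Rightarrow> real"
  shows "Ck k f \<Longrightarrow> Ck k g \<Longrightarrow> Ck k (\<lambda>x. f x * g x)"
proof (induction k arbitrary: f g)
  case (Suc k)
  have "((\<lambda>x. f x * g x) has_derivative
     (\<lambda>v. f x * frechet_derivative g (at x) v + frechet_derivative f (at x) v * g x)) (at x)" for x
    using Suc.prems by (intro has_derivative_mult) (auto simp: frechet_derivative_works[symmetric])
  then have "partial_deriv i (\<lambda>x. f x * g x)
      = (\<lambda>x. f x * partial_deriv i g x + partial_deriv i f x * g x)" for i
    by (intro ext, subst partial_deriv_eqI) (auto simp: partial_deriv_def)
  moreover have "Ck k f" "Ck k g"
    using Suc.prems Ck_Suc_imp by blast+
  ultimately show ?case
    using Suc by (auto intro!: Ck_add)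
qed (auto intro: continuous_intros)

lemma Ck_component: "Ck k (\<lambda>x::real ^ 'n::finite. x $ j)"
proof (cases k)
  case (Suc k)
  have D: "((\<lambda>x. x $ j) has_derivative (\<lambda>v. v $ j)) (at x)" for x :: "real ^ 'n"
    by (intro bounded_linear.has_derivative[OF bounded_linear_vec_nth] derivative_intros)
  have "partial_deriv i (\<lambda>x::real ^ 'n. x $ j) = (\<lambda>_. axis i 1 $ j)" for i
    using partial_deriv_eqI[OF D] by auto
  with Suc D show ?thesis by (auto intro!: Ck_const simp: differentiable_def)
qed (auto intro: continuous_intros)

lemma has_derivative_radial:
  fixes x :: "real ^ 'n::finite"
  assumes "(u has_real_derivative u') (at (x \<bullet> x))"
  shows "((\<lambda>x. u (x \<bullet> x)) has_derivative (\<lambda>v. 2 * (x \<bullet> v) * u')) (at x)"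
proof -
  have "((\<lambda>x. x \<bullet> x) has_derivative (\<lambda>v. x \<bullet> v + v \<bullet> x)) (at x)"
    by (intro has_derivative_inner has_derivative_ident)
  from has_derivative_compose[OF this has_field_derivative_imp_has_derivative[OF assms]]
  show ?thesis
    by (rule has_derivative_eq_rhs) (auto simp: inner_commute)
qed

lemma Ck_radial:
  "u \<in> smooth_real \<Longrightarrow> Ck k (\<lambda>x::real ^ 'n::finite. u (x \<bullet> x))"
proof (induction k arbitrary: u)
  case 0
  have "continuous_on UNIV u" by (rule smooth_real_continuous[OF 0])
  then show ?case
    by (auto intro!: continuous_on_compose2[of UNIV u] continuous_intros)
next
  case (Suc k)
  obtain u' where u': "u' \<in> smooth_real" "\<And>t. (u has_real_derivative u' t) (at t)"
    using smooth_real_deriv[OF Suc.prems] by blast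
  note D = has_derivative_radial[OF u'(2)]
  have "partial_deriv i (\<lambda>x::real ^ 'n. u (x \<bullet> x)) = (\<lambda>x. 2 * (x $ i) * u' (x \<bullet> x))" for i
    using partial_deriv_eqI[OF D] by (auto simp: inner_axis)
  moreover have "Ck k (\<lambda>x::real ^ 'n. 2 * (x $ i) * u' (x \<bullet> x))" for i
    by (intro Ck_mult Ck_const Ck_component Suc.IH u')
  ultimately show ?case using D by (auto simp: differentiable_def)
qed

lemma partial_deriv_vec_nth:
  fixes \<Phi> :: "real ^ 'n::finite \<Rightarrow> real ^ 'm::finite"
  assumes "\<Phi> differentiable (at x)"
  shows "partial_deriv i \<Phi> x $ j = partial_deriv i (\<lambda>x. \<Phi> x $ j) x"
proof -
  have "((\<lambda>x. \<Phi> x $ j) has_derivative (\<lambda>v. frechet_derivative \<Phi> (at x) v $ j)) (at x)"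
    using assms by (intro bounded_linear.has_derivative[OF bounded_linear_vec_nth])
      (simp add: frechet_derivative_works)
  then show ?thesis by (simp add: partial_deriv_eqI) (simp add: partial_deriv_def)
qed

text \<open>
  Smoothness of a vector field can be checked on its components.
\<close>

lemma Ck_vec:
  fixes \<Phi> :: "real ^ 'n::finite \<Rightarrow> real ^ 'm::finite"
  assumes "\<And>j. Ck k (\<lambda>x. \<Phi> x $ j)"
  shows "Ck k \<Phi>"
  using assms
proof (induction k arbitrary: \<Phi>)
  case 0
  have "continuous_on UNIV (\<lambda>x. \<chi> j. \<Phi> x $ j)"
    using 0 by (intro continuous_on_vec_lambda) auto
  then show ?case by simp
next
  case (Suc k)
  have diff: "\<Phi> differentiable (at x)" for x
  proof -
    have "((\<lambda>x. \<Phi> x \<bullet> b) has_derivative (\<lambda>v. (\<chi> j. frechet_derivative (\<lambda>x. \<Phi> x $ j) (at x) v) \<bullet> b)) (at x)"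
      if "b \<in> Basis" for b
    proof -
      from that obtain j where b: "b = axis j 1" by (auto simp: Basis_vec_def)
      show ?thesis
        using Suc.prems[of j] by (simp add: b inner_axis frechet_derivative_works)
    qed
    then have "(\<Phi> has_derivative (\<lambda>v. \<chi> j. frechet_derivative (\<lambda>x. \<Phi> x $ j) (at x) v)) (at x)"
      by (subst has_derivative_componentwise_within) auto
    then show ?thesis by (auto simp: differentiable_def)
  qed
  have "Ck k (partial_deriv i \<Phi>)" for i
  proof (rule Suc.IH)
    fix j
    have "(\<lambda>x. partial_deriv i \<Phi> x $ j) = partial_deriv i (\<lambda>x. \<Phi> x $ j)"
      using partial_deriv_vec_nth[OF diff] by auto
    then show "Ck k (\<lambda>x. partial_deriv i \<Phi> x $ j)"
      using Suc.prems[of j] by simp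
  qed
  with diff show ?case by simp
qed

section \<open>Convolution with a continuous function of compact support\<close>

text \<open>
  The convolution \<open>h * g\<close>. It is used only for continuous \<open>h\<close> of compact support, so that the smoothness
  of \<open>g\<close> alone, which need not be compactly supported, passes to \<open>h * g\<close>.
\<close>

definition conv :: "('a::euclidean_space \<Rightarrow> real) \<Rightarrow> ('a \<Rightarrow> real) \<Rightarrow> 'a \<Rightarrow> real" where
  "conv h g x = (\<integral>y. h y * g (x - y) \<partial>lborel)"

text \<open>
  The continuous functions of compact support.
\<close>

definition Cc :: "('a::euclidean_space \<Rightarrow> real) set" where
  "Cc = {h. continuous_on UNIV h \<and> bounded {x. h x \<noteq> 0}}"

lemma Cc_obtain_cbox:
  assumes "h \<in> Cc"
  obtains a b :: "'a::euclidean_space" where "\<And>x. x \<notin> cbox a b \<Longrightarrow> h x = 0"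
proof -
  from assms have "bounded {x. h x \<noteq> 0}" by (simp add: Cc_def)
  then obtain a where "{x. h x \<noteq> 0} \<subseteq> cbox (-a) a" using bounded_subset_cbox_symmetric by blast
  then show ?thesis by (intro that[of "-a" a]) auto
qed

lemma continuous_compact_support_integral:
  fixes v :: "'a::euclidean_space \<Rightarrow> real"
  assumes "continuous_on UNIV v" and "\<And>x. x \<notin> cbox a b \<Longrightarrow> v x = 0"
  shows "integrable lborel v" "integral\<^sup>L lborel v = integral (cbox a b) v"
proof -
  have "integrable lborel (\<lambda>x. indicator (cbox a b) x *\<^sub>R v x)"
    by (intro borel_integrable_compact) (auto intro: continuous_on_subset assms)
  moreover have *: "(\<lambda>x. indicator (cbox a b) x *\<^sub>R v x) = v"
    using assms(2) by (fastforce simp: indicator_def)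
  ultimately show int: "integrable lborel v" by simp
  have "set_integrable lborel (cbox a b) v"
    using int by (simp only: set_integrable_def *)
  from set_borel_integral_eq_integral(2)[OF this] show "integral\<^sup>L lborel v = integral (cbox a b) v"
    by (simp only: set_lebesgue_integral_def *)
qed

lemma Cc_integrable: "h \<in> Cc \<Longrightarrow> integrable lborel h"
  using Cc_obtain_cbox[of h] continuous_compact_support_integral(1)[of h] by (auto simp: Cc_def)

lemma conv_eq_integral:
  fixes h g :: "'a::euclidean_space \<Rightarrow> real"
  assumes "continuous_on UNIV h" "\<And>x. x \<notin> cbox a b \<Longrightarrow> h x = 0" "continuous_on UNIV g"
  shows "conv h g x = integral (cbox a b) (\<lambda>y. h y * g (x - y))"
    and "integrable lborel (\<lambda>y. h y * g (x - y))"
proof -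
  have c: "continuous_on UNIV (\<lambda>y. h y * g (x - y))"
    by (intro continuous_intros assms(1) continuous_on_compose2[OF assms(3)]) auto
  show "conv h g x = integral (cbox a b) (\<lambda>y. h y * g (x - y))"
    unfolding conv_def
    by (rule continuous_compact_support_integral(2)[OF c]) (auto simp: assms(2))
  show "integrable lborel (\<lambda>y. h y * g (x - y))"
    by (rule continuous_compact_support_integral(1)[OF c, of a b]) (auto simp: assms(2))
qed

lemma conv_integrable:
  assumes "h \<in> Cc" "continuous_on UNIV g"
  shows "integrable lborel (\<lambda>y. h y * g (x - y))"
proof -
  obtain a b where "\<And>x. x \<notin> cbox a b \<Longrightarrow> h x = 0" using Cc_obtain_cbox[OF assms(1)] by blast
  with conv_eq_integral(2)[of h a b g] assms show ?thesis by (auto simp: Cc_def)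
qed

lemma conv_continuous:
  fixes h g :: "'a::euclidean_space \<Rightarrow> real"
  assumes h: "h \<in> Cc" and g: "continuous_on UNIV g"
  shows "continuous_on UNIV (conv h g)"
proof -
  obtain a b where ab: "\<And>x. x \<notin> cbox a b \<Longrightarrow> h x = 0" using Cc_obtain_cbox[OF h] by blast
  have hc: "continuous_on UNIV h" using h by (simp add: Cc_def)
  have "continuous_on UNIV (\<lambda>x. integral (cbox a b) (\<lambda>y. h y * g (x - y)))"
    by (intro integral_continuous_on_param) (auto simp: split_beta intro!: continuous_intros
       continuous_on_compose2[OF hc] continuous_on_compose2[OF g])
  then show ?thesis
    using conv_eq_integral(1)[OF hc ab g] by (simp cong: continuous_on_cong)
qed

text \<open>
  Differentiation under the integral sign, carried out on a box that contains the support of \<open>h\<close>.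
\<close>

lemma conv_partial_deriv:
  fixes g :: "real ^ 'n::finite \<Rightarrow> real"
  assumes h: "h \<in> Cc" and g: "Ck (Suc k) g"
  shows "(conv h g) differentiable (at x)"
    and "partial_deriv i (conv h g) = conv h (partial_deriv i g)"
proof -
  obtain a b where ab: "\<And>x. x \<notin> cbox a b \<Longrightarrow> h x = 0" using Cc_obtain_cbox[OF h] by blast
  have hc: "continuous_on UNIV h" using h by (simp add: Cc_def)
  have gd: "g differentiable (at x)" for x using g by simp
  have gp: "continuous_on UNIV (partial_deriv i g)" for i
    using g by (intro Ck_imp_continuous[of k]) auto
  have gc: "continuous_on UNIV g" by (rule Ck_imp_continuous[OF g])
  define P where "P = (\<lambda>i. blinfun_inner_left (axis i 1 :: real ^ 'n))"
  define D where "D = (\<lambda>x y. (\<Sum>i\<in>UNIV. (h y * partial_deriv i g (x - y)) *\<^sub>R P i))"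
  have D: "blinfun_apply (D x y) = (\<lambda>v. h y * (\<Sum>i\<in>UNIV. v $ i *\<^sub>R partial_deriv i g (x - y)))" for x y
    by (auto simp: D_def P_def blinfun.sum_left blinfun.scaleR_left inner_axis sum_distrib_left mult_ac
        intro!: sum.cong)
  have d1: "((\<lambda>x. h y * g (x - y)) has_derivative blinfun_apply (D x y)) (at x)" for x y
  proof -
    have "((\<lambda>x. x - y) has_derivative (\<lambda>v. v)) (at x)"
      by (auto intro!: derivative_eq_intros)
    from has_derivative_compose[OF this has_derivative_partial_deriv[OF gd]]
    show ?thesis unfolding D by (intro has_derivative_mult_right)
  qed
  have cD: "continuous_on (UNIV \<times> cbox a b) (\<lambda>(x, y). D x y)"
    unfolding D_def split_beta
    by (intro continuous_intros continuous_on_compose2[OF hc] continuous_on_compose2[OF gp]) auto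
  have "((\<lambda>x. integral (cbox a b) (\<lambda>y. h y * g (x - y))) has_derivative
     blinfun_apply (integral (cbox a b) (D x))) (at x)" for x
  proof (rule leibniz_rule[OF _ _ cD])
    show "(\<lambda>y. h y * g (x - y)) integrable_on cbox a b" for x
      by (intro integrable_continuous continuous_intros continuous_on_compose2[OF hc]
          continuous_on_compose2[OF gc]) auto
  qed (use d1 in auto)
  moreover have "(\<lambda>x. integral (cbox a b) (\<lambda>y. h y * g (x - y))) = conv h g"
    using conv_eq_integral(1)[OF hc ab gc] by auto
  ultimately have d: "(conv h g has_derivative blinfun_apply (integral (cbox a b) (D x))) (at x)" for x
    by simp
  then show "(conv h g) differentiable (at x)" by (auto simp: differentiable_def)
  show "partial_deriv i (conv h g) = conv h (partial_deriv i g)"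
  proof
    fix x
    have cDx: "continuous_on (cbox a b) (D x)"
      unfolding D_def
      by (intro continuous_intros continuous_on_compose2[OF hc] continuous_on_compose2[OF gp]) auto
    have "partial_deriv i (conv h g) x = blinfun_apply (integral (cbox a b) (D x)) (axis i 1)"
      by (rule partial_deriv_eqI[OF d])
    also have "\<dots> = integral (cbox a b) (\<lambda>y. blinfun_apply (D x y) (axis i 1))"
      by (subst blinfun_apply_integral) (auto intro: integrable_continuous cDx)
    also have "(\<lambda>y. blinfun_apply (D x y) (axis i 1)) = (\<lambda>y. h y * partial_deriv i g (x - y))"
      by (auto simp: D axis_def if_distrib if_distribR cong: if_cong)
    also have "integral (cbox a b) \<dots> = conv h (partial_deriv i g) x"
      using conv_eq_integral(1)[OF hc ab gp] by simp
    finally show "partial_deriv i (conv h g) x = conv h (partial_deriv i g) x" .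
  qed
qed

lemma Ck_conv:
  fixes g :: "real ^ 'n::finite \<Rightarrow> real"
  assumes h: "h \<in> Cc"
  shows "Ck k g \<Longrightarrow> Ck k (conv h g)"
proof (induction k arbitrary: g)
  case 0
  then show ?case using conv_continuous[OF h] by simp
next
  case (Suc k)
  then show ?case using conv_partial_deriv[OF h Suc.prems] by simp
qed

section \<open>Norms with the conjugate exponent\<close>

text \<open>
  The bound \<open>\<parallel>g\<parallel>\<^sub>q \<le> B\<close> for the exponent \<open>q = p / (p - 1)\<close> conjugate to \<open>p\<close>, meant for \<open>B \<ge> 0\<close>. For \<open>p = 1\<close>
  the bound is required at every point and not only almost everywhere; this is enough for the functions
  that occur, and it lets the cases \<open>q = \<infinity>\<close> and \<open>q < \<infinity>\<close> be treated side by side.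
\<close>

definition qnorm_le :: "real \<Rightarrow> ('a::euclidean_space \<Rightarrow> real) \<Rightarrow> real \<Rightarrow> bool" where
  "qnorm_le p g B \<longleftrightarrow>
    (if p = 1 then \<forall>x. \<bar>g x\<bar> \<le> B
     else (\<integral>\<^sup>+ x. ennreal (\<bar>g x\<bar> powr (p / (p - 1))) \<partial>lborel) \<le> ennreal (B powr (p / (p - 1))))"

lemma conjugate_exponent_gt_1: "1 < p \<Longrightarrow> 1 < p / (p - 1)" for p :: real
  by (simp add: field_simps)

lemma qnorm_le_mono:
  assumes "p \<ge> 1" "qnorm_le p g B" "\<And>x. \<bar>g' x\<bar> \<le> \<bar>g x\<bar>" "0 \<le> B" "B \<le> B'"
  shows "qnorm_le p g' B'"
proof (cases "p = 1")
  case True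
  have "\<bar>g' x\<bar> \<le> B'" for x
  proof -
    have "\<bar>g x\<bar> \<le> B" using assms(2) True by (simp add: qnorm_le_def)
    with assms(3)[of x] assms(5) show ?thesis by linarith
  qed
  then show ?thesis using True by (simp add: qnorm_le_def)
next
  case False
  then have q: "p / (p - 1) \<ge> 0" using assms by auto
  have "(\<integral>\<^sup>+ x. ennreal (\<bar>g' x\<bar> powr (p / (p - 1))) \<partial>lborel)
      \<le> (\<integral>\<^sup>+ x. ennreal (\<bar>g x\<bar> powr (p / (p - 1))) \<partial>lborel)"
    by (intro nn_integral_mono ennreal_leI powr_mono2 assms q) auto
  also have "\<dots> \<le> ennreal (B powr (p / (p - 1)))"
    using assms False by (simp add: qnorm_le_def)
  also have "\<dots> \<le> ennreal (B' powr (p / (p - 1)))"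
    by (intro ennreal_leI powr_mono2 assms q)
  finally show ?thesis using False by (simp add: qnorm_le_def)
qed

lemma qnorm_le_scale:
  fixes g :: "'a::euclidean_space \<Rightarrow> real"
  assumes "p \<ge> 1" "qnorm_le p g B" "0 \<le> B" "g \<in> borel_measurable borel"
  shows "qnorm_le p (\<lambda>x. c * g x) (\<bar>c\<bar> * B)"
proof (cases "p = 1")
  case True
  then show ?thesis using assms by (auto simp: qnorm_le_def abs_mult intro: mult_left_mono)
next
  case False
  let ?q = "p / (p - 1)"
  have [measurable]: "g \<in> borel_measurable borel" by fact
  have "(\<integral>\<^sup>+ x. ennreal (\<bar>c * g x\<bar> powr ?q) \<partial>lborel)
      = (\<integral>\<^sup>+ x. ennreal (\<bar>c\<bar> powr ?q) * ennreal (\<bar>g x\<bar> powr ?q) \<partial>lborel)"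
    by (simp add: abs_mult powr_mult ennreal_mult)
  also have "\<dots> = ennreal (\<bar>c\<bar> powr ?q) * (\<integral>\<^sup>+ x. ennreal (\<bar>g x\<bar> powr ?q) \<partial>lborel)"
    by (rule nn_integral_cmult) measurable
  also have "\<dots> \<le> ennreal (\<bar>c\<bar> powr ?q) * ennreal (B powr ?q)"
    using assms False by (intro mult_left_mono) (auto simp: qnorm_le_def)
  also have "\<dots> = ennreal ((\<bar>c\<bar> * B) powr ?q)"
    using assms by (simp add: powr_mult ennreal_mult)
  finally show ?thesis using False by (simp add: qnorm_le_def)
qed

lemma powr_add_le:
  fixes a b q :: real
  assumes "0 \<le> a" "0 \<le> b" "0 \<le> q"
  shows "(a + b) powr q \<le> 2 powr q * (a powr q + b powr q)"
proof -
  have "(a + b) powr q \<le> (2 * max a b) powr q"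
    using assms by (intro powr_mono2) auto
  also have "\<dots> = 2 powr q * (max a b) powr q"
    using assms by (simp add: powr_mult)
  also have "\<dots> \<le> 2 powr q * (a powr q + b powr q)"
    by (intro mult_left_mono) (auto simp: max_def)
  finally show ?thesis .
qed

text \<open>A triangle inequality; the constant is immaterial.\<close>

lemma qnorm_le_add:
  fixes g g1 g2 :: "'a::euclidean_space \<Rightarrow> real"
  assumes p: "p \<ge> 1" and g1: "qnorm_le p g1 B1" and g2: "qnorm_le p g2 B2"
    and B: "0 \<le> B1" "0 \<le> B2"
    and [measurable]: "g1 \<in> borel_measurable borel" "g2 \<in> borel_measurable borel"
    and le: "\<And>x. \<bar>g x\<bar> \<le> \<bar>g1 x\<bar> + \<bar>g2 x\<bar>"
  shows "qnorm_le p g (4 * (B1 + B2))"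
proof (cases "p = 1")
  case True
  have "\<bar>g x\<bar> \<le> 4 * (B1 + B2)" for x
  proof -
    have "\<bar>g1 x\<bar> \<le> B1" "\<bar>g2 x\<bar> \<le> B2" using g1 g2 True by (simp_all add: qnorm_le_def)
    with le[of x] have "\<bar>g x\<bar> \<le> B1 + B2" by (meson add_mono order_trans)
    also have "\<dots> \<le> 4 * (B1 + B2)" using B by simp
    finally show ?thesis .
  qed
  then show ?thesis using True by (simp add: qnorm_le_def)
next
  case False
  define q where "q = p / (p - 1)"
  have q: "q > 1" using p False conjugate_exponent_gt_1[of p] by (simp add: q_def)
  have "(\<integral>\<^sup>+ x. ennreal (\<bar>g x\<bar> powr q) \<partial>lborel)
      \<le> (\<integral>\<^sup>+ x. ennreal (2 powr q) * (ennreal (\<bar>g1 x\<bar> powr q) + ennreal (\<bar>g2 x\<bar> powr q)) \<partial>lborel)"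
  proof (intro nn_integral_mono)
    fix x
    have "\<bar>g x\<bar> powr q \<le> (\<bar>g1 x\<bar> + \<bar>g2 x\<bar>) powr q"
      using q le by (intro powr_mono2) auto
    also have "\<dots> \<le> 2 powr q * (\<bar>g1 x\<bar> powr q + \<bar>g2 x\<bar> powr q)"
      using q by (intro powr_add_le) auto
    finally show "ennreal (\<bar>g x\<bar> powr q)
        \<le> ennreal (2 powr q) * (ennreal (\<bar>g1 x\<bar> powr q) + ennreal (\<bar>g2 x\<bar> powr q))"
      by (simp add: ennreal_leI flip: ennreal_mult ennreal_plus)
  qed
  also have "\<dots> = ennreal (2 powr q) * ((\<integral>\<^sup>+ x. ennreal (\<bar>g1 x\<bar> powr q) \<partial>lborel)
      + (\<integral>\<^sup>+ x. ennreal (\<bar>g2 x\<bar> powr q) \<partial>lborel))"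
    by (subst nn_integral_cmult, measurable, subst nn_integral_add) auto
  also have "\<dots> \<le> ennreal (2 powr q) * (ennreal (B1 powr q) + ennreal (B2 powr q))"
    using g1 g2 False by (intro mult_left_mono add_mono) (auto simp: qnorm_le_def q_def)
  also have "\<dots> \<le> ennreal ((4 * (B1 + B2)) powr q)"
  proof -
    have "B1 powr q \<le> (B1 + B2) powr q" "B2 powr q \<le> (B1 + B2) powr q"
      using B q by (auto intro!: powr_mono2)
    then have "2 powr q * (B1 powr q + B2 powr q) \<le> 2 powr q * (2 * (B1 + B2) powr q)"
      by (intro mult_left_mono) auto
    also have "\<dots> \<le> 2 powr q * (2 powr q * (B1 + B2) powr q)"
    proof -
      have "(2::real) powr 1 \<le> 2 powr q" using q by (intro powr_mono) auto
      then show ?thesis by (intro mult_left_mono mult_right_mono) auto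
    qed
    also have "\<dots> = (4 * (B1 + B2)) powr q"
      using powr_mult[of 2 2 q] powr_mult[of 4 "B1 + B2" q] B by simp
    finally show ?thesis
      by (simp add: ennreal_leI flip: ennreal_mult ennreal_plus)
  qed
  finally show ?thesis using False by (simp add: qnorm_le_def q_def)
qed

text \<open>
  The graph of \<open>b \<mapsto> b\<^sup>q\<close> lies above its tangent at \<open>m\<close>.
\<close>

lemma powr_ge_tangent:
  fixes b m q :: real
  assumes "q > 1" "0 \<le> b" "0 \<le> m"
  shows "q * m powr (q - 1) * b \<le> b powr q + (q - 1) * m powr q"
proof -
  define r where "r = q / (q - 1)"
  have r: "r > 1" "1 / q + 1 / r = 1" "(q - 1) * r = q"
    using assms(1) by (auto simp: r_def field_simps)
  have "b * m powr (q - 1) \<le> b powr q / q + (m powr (q - 1)) powr r / r"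
    using assms r by (intro Youngs_inequality) auto
  also have "(m powr (q - 1)) powr r = m powr q"
    by (simp add: powr_powr r)
  finally have "q * (b * m powr (q - 1)) \<le> q * (b powr q / q + m powr q / r)"
    using assms by (intro mult_left_mono) auto
  also have "\<dots> = b powr q + (q - 1) * m powr q"
    using assms by (simp add: r_def field_simps)
  finally show ?thesis by (simp add: mult_ac)
qed

lemma nn_integral_lborel_affine:
  fixes u :: "'a::euclidean_space \<Rightarrow> ennreal"
  assumes "u \<in> borel_measurable borel" "c \<noteq> 0"
  shows "(\<integral>\<^sup>+ x. u x \<partial>lborel) = ennreal (\<bar>c\<bar> ^ DIM('a)) * (\<integral>\<^sup>+ x. u (t + c *\<^sub>R x) \<partial>lborel)"
  using assms
  by (subst lborel_affine[OF assms(2), of t])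
     (simp add: nn_integral_density nn_integral_distr nn_integral_cmult)

lemma nn_integral_lborel_reflect:
  fixes u :: "'a::euclidean_space \<Rightarrow> ennreal"
  assumes "u \<in> borel_measurable borel"
  shows "(\<integral>\<^sup>+ y. u (x - y) \<partial>lborel) = (\<integral>\<^sup>+ y. u y \<partial>lborel)"
  using nn_integral_lborel_affine[OF assms, of "-1" x] by simp

lemma nn_integral_lborel_translate:
  fixes u :: "'a::euclidean_space \<Rightarrow> ennreal"
  assumes "u \<in> borel_measurable borel"
  shows "(\<integral>\<^sup>+ x. u (x - y) \<partial>lborel) = (\<integral>\<^sup>+ x. u x \<partial>lborel)"
  using nn_integral_lborel_affine[OF assms, of 1 "-y"] by simp

text \<open>
  Young's inequality for convolutions, \<open>\<parallel>a * b\<parallel>\<^sub>q \<le> \<parallel>a\<parallel>\<^sub>1 \<parallel>b\<parallel>\<^sub>q\<close>: the tangent inequality plays the role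
  of Jensen's inequality for the measure with density \<open>y \<mapsto> a (x - y)\<close>.
\<close>

lemma qnorm_le_convolution:
  fixes a b g :: "'a::euclidean_space \<Rightarrow> real"
  assumes p: "p \<ge> 1" and b: "qnorm_le p b B" and B: "0 \<le> B"
    and A: "(\<integral>\<^sup>+ y. ennreal (a y) \<partial>lborel) \<le> ennreal A" "0 \<le> A"
    and a0: "\<And>y. 0 \<le> a y" and b0: "\<And>y. 0 \<le> b y"
    and [measurable]: "a \<in> borel_measurable borel" "b \<in> borel_measurable borel"
    and g: "\<And>x. ennreal \<bar>g x\<bar> \<le> (\<integral>\<^sup>+ y. ennreal (a (x - y)) * ennreal (b y) \<partial>lborel)"
  shows "qnorm_le p g (A * B)"
proof -
  have Ax: "(\<integral>\<^sup>+ y. ennreal (a (x - y)) \<partial>lborel) \<le> ennreal A" for x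
    using A(1) nn_integral_lborel_reflect[of "\<lambda>y. ennreal (a y)" x] by simp
  show ?thesis
  proof (cases "p = 1")
    case True
    have "\<bar>g x\<bar> \<le> A * B" for x
    proof -
      have "ennreal \<bar>g x\<bar> \<le> (\<integral>\<^sup>+ y. ennreal (a (x - y)) * ennreal B \<partial>lborel)"
        using b b0 True
        by (intro order_trans[OF g] nn_integral_mono mult_left_mono ennreal_leI) (auto simp: qnorm_le_def)
      also have "\<dots> = (\<integral>\<^sup>+ y. ennreal (a (x - y)) \<partial>lborel) * ennreal B"
        by (rule nn_integral_multc) measurable
      also have "\<dots> \<le> ennreal A * ennreal B"
        by (intro mult_right_mono Ax) simp
      also have "\<dots> = ennreal (A * B)" using A B by (simp add: ennreal_mult)
      finally show ?thesis using A B by (simp add: ennreal_le_iff)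
    qed
    then show ?thesis using True by (simp add: qnorm_le_def)
  next
    case False
    define q where "q = p / (p - 1)"
    have q: "q > 1" using p False conjugate_exponent_gt_1[of p] by (simp add: q_def)
    have pw: "ennreal (\<bar>g x\<bar> powr q)
        \<le> ennreal (A powr (q - 1)) * (\<integral>\<^sup>+ y. ennreal (a (x - y)) * ennreal (b y powr q) \<partial>lborel)" for x
    proof (cases "A = 0")
      case True
      have "(\<integral>\<^sup>+ y. ennreal (a (x - y)) \<partial>lborel) = 0"
        using Ax[of x] True by simp
      then have "AE y in lborel. ennreal (a (x - y)) = 0"
        by (subst (asm) nn_integral_0_iff_AE) auto
      then have "(\<integral>\<^sup>+ y. ennreal (a (x - y)) * ennreal (b y) \<partial>lborel) = 0"
        by (subst nn_integral_0_iff_AE) auto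
      with g[of x] have "\<bar>g x\<bar> = 0" by (simp add: ennreal_eq_0_iff)
      then show ?thesis by simp
    next
      case False
      with A have A0: "A > 0" by simp
      \<comment> \<open>The tangent is taken at the mean value that \<open>b\<close> would have if the bound for \<open>g x\<close> were attained.\<close>
      define m where "m = \<bar>g x\<bar> / A"
      have m0: "m \<ge> 0" using A0 by (simp add: m_def)
      let ?I = "\<integral>\<^sup>+ y. ennreal (a (x - y)) * ennreal (b y powr q) \<partial>lborel"
      have mq: "m powr (q - 1) * m = m powr q"
        using m0 by (cases "m = 0") (auto simp: powr_mult_base[of m "q - 1"] mult.commute)
      have "ennreal (A * m powr q) + ennreal ((q - 1) * m powr q * A) = ennreal (q * m powr (q - 1) * \<bar>g x\<bar>)"
      proof -
        have "q * m powr (q - 1) * \<bar>g x\<bar> = q * A * (m powr (q - 1) * m)"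
          using A0 by (simp add: m_def)
        also have "\<dots> = A * m powr q + (q - 1) * m powr q * A"
          unfolding mq by (simp add: algebra_simps)
        finally show ?thesis using A0 q by (simp flip: ennreal_plus)
      qed
      also have "\<dots> = ennreal (q * m powr (q - 1)) * ennreal \<bar>g x\<bar>"
        using q by (simp add: ennreal_mult)
      also have "\<dots> \<le> ennreal (q * m powr (q - 1)) * (\<integral>\<^sup>+ y. ennreal (a (x - y)) * ennreal (b y) \<partial>lborel)"
        by (intro mult_left_mono g) simp
      also have "\<dots> = (\<integral>\<^sup>+ y. ennreal (q * m powr (q - 1)) * (ennreal (a (x - y)) * ennreal (b y)) \<partial>lborel)"
        by (rule nn_integral_cmult[symmetric]) measurable
      also have "\<dots> \<le> (\<integral>\<^sup>+ y. ennreal (a (x - y)) * ennreal (b y powr q)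
          + ennreal ((q - 1) * m powr q) * ennreal (a (x - y)) \<partial>lborel)"
      proof (intro nn_integral_mono)
        fix y
        have "a (x - y) * (q * m powr (q - 1) * b y) \<le> a (x - y) * (b y powr q + (q - 1) * m powr q)"
          by (intro mult_left_mono powr_ge_tangent q b0 m0 a0)
        then have "q * m powr (q - 1) * (a (x - y) * b y)
            \<le> a (x - y) * b y powr q + (q - 1) * m powr q * a (x - y)"
          by (simp add: algebra_simps)
        then show "ennreal (q * m powr (q - 1)) * (ennreal (a (x - y)) * ennreal (b y))
            \<le> ennreal (a (x - y)) * ennreal (b y powr q) + ennreal ((q - 1) * m powr q) * ennreal (a (x - y))"
          using a0 b0 q by (simp add: ennreal_leI flip: ennreal_mult ennreal_plus)
      qed
      also have "\<dots> = ?I + ennreal ((q - 1) * m powr q) * (\<integral>\<^sup>+ y. ennreal (a (x - y)) \<partial>lborel)"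
        by (subst nn_integral_add) (auto simp: nn_integral_cmult)
      also have "\<dots> \<le> ?I + ennreal ((q - 1) * m powr q) * ennreal A"
        by (intro add_left_mono mult_left_mono Ax) simp
      also have "\<dots> = ?I + ennreal ((q - 1) * m powr q * A)"
        using q A0 by (simp add: ennreal_mult)
      finally have "ennreal (A * m powr q) \<le> ?I"
        by (simp add: add.commute ennreal_add_left_cancel_le)
      then have "ennreal (A powr (q - 1)) * ennreal (A * m powr q) \<le> ennreal (A powr (q - 1)) * ?I"
        by (intro mult_left_mono) auto
      moreover have "\<bar>g x\<bar> powr q = A powr (q - 1) * (A * m powr q)"
      proof -
        have "\<bar>g x\<bar> powr q = (A * m) powr q" using A0 by (simp add: m_def)
        also have "\<dots> = A powr (q - 1 + 1) * m powr q" using A0 m0 by (simp add: powr_mult)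
        also have "\<dots> = A powr (q - 1) * (A * m powr q)" using A0 by (subst powr_add) simp
        finally show ?thesis .
      qed
      ultimately show ?thesis using A0 by (simp add: ennreal_mult)
    qed
    have "(\<integral>\<^sup>+ x. ennreal (\<bar>g x\<bar> powr q) \<partial>lborel)
        \<le> (\<integral>\<^sup>+ x. ennreal (A powr (q - 1)) * (\<integral>\<^sup>+ y. ennreal (a (x - y)) * ennreal (b y powr q) \<partial>lborel) \<partial>lborel)"
      by (intro nn_integral_mono pw)
    also have "\<dots> = ennreal (A powr (q - 1)) * (\<integral>\<^sup>+ x. (\<integral>\<^sup>+ y. ennreal (a (x - y)) * ennreal (b y powr q) \<partial>lborel) \<partial>lborel)"
      by (rule nn_integral_cmult) measurable
    also have "(\<integral>\<^sup>+ x. (\<integral>\<^sup>+ y. ennreal (a (x - y)) * ennreal (b y powr q) \<partial>lborel) \<partial>lborel)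
        = (\<integral>\<^sup>+ y. (\<integral>\<^sup>+ x. ennreal (a (x - y)) * ennreal (b y powr q) \<partial>lborel) \<partial>lborel)"
      by (rule lborel_pair.Fubini') measurable
    also have "\<dots> = (\<integral>\<^sup>+ y. (\<integral>\<^sup>+ x. ennreal (a x) \<partial>lborel) * ennreal (b y powr q) \<partial>lborel)"
      by (intro nn_integral_cong, subst nn_integral_multc)
         (auto simp: nn_integral_lborel_translate[of "\<lambda>x. ennreal (a x)"])
    also have "\<dots> = (\<integral>\<^sup>+ x. ennreal (a x) \<partial>lborel) * (\<integral>\<^sup>+ y. ennreal (b y powr q) \<partial>lborel)"
      by (rule nn_integral_cmult) measurable
    also have "\<dots> \<le> ennreal A * ennreal (B powr q)"
      using b b0 False by (intro mult_mono A) (auto simp: qnorm_le_def q_def)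
    also have "ennreal (A powr (q - 1)) * (ennreal A * ennreal (B powr q)) = ennreal ((A * B) powr q)"
    proof -
      have "A powr (q - 1) * A = A powr q"
        using A(2) q powr_add[of A "q - 1" 1] by (cases "A = 0") auto
      then show ?thesis
        using A(2) B by (simp add: powr_mult flip: ennreal_mult mult.assoc)
    qed
    finally show ?thesis using False by (simp add: qnorm_le_def q_def mult_left_mono)
  qed
qed

lemma Lp_norm_conjugate_le:
  fixes \<Phi> :: "'a::euclidean_space \<Rightarrow> 'b::real_normed_vector"
  assumes p: "p \<ge> 1" and g: "qnorm_le p g B" and B: "0 \<le> B"
    and le: "\<And>x. norm (\<Phi> x) \<le> \<bar>g x\<bar>" and [measurable]: "\<Phi> \<in> borel_measurable borel"
  shows "Lp_norm (conjugate_exponent p) \<Phi> \<le> ennreal B"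
proof (cases "p = 1")
  case True
  have "esssup lebesgue (\<lambda>x. ereal (norm (\<Phi> x))) \<le> ereal B"
  proof (rule esssup_I)
    have "(\<lambda>x. ereal (norm (\<Phi> x))) \<in> borel_measurable lborel" by measurable
    then show "(\<lambda>x. ereal (norm (\<Phi> x))) \<in> borel_measurable lebesgue"
      by (rule measurable_completion)
    show "AE x in lebesgue. ereal (norm (\<Phi> x)) \<le> ereal B"
      using g le True by (intro AE_I2) (auto simp: qnorm_le_def intro: order_trans)
  qed
  from e2ennreal_mono[OF this] show ?thesis
    using True by (simp add: Lp_norm_def conjugate_exponent_def)
next
  case False
  define q where "q = p / (p - 1)"
  have q: "q > 1" using p False conjugate_exponent_gt_1[of p] by (simp add: q_def)
  define I where "I = (\<integral>\<^sup>+ x. ennreal (norm (\<Phi> x) powr q) \<partial>lebesgue)"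
  have "I = (\<integral>\<^sup>+ x. ennreal (norm (\<Phi> x) powr q) \<partial>lborel)"
    unfolding I_def by (rule nn_integral_completion)
  also have "\<dots> \<le> (\<integral>\<^sup>+ x. ennreal (\<bar>g x\<bar> powr q) \<partial>lborel)"
    using q le by (intro nn_integral_mono ennreal_leI powr_mono2) auto
  also have "\<dots> \<le> ennreal (B powr q)"
    using g False by (simp add: qnorm_le_def q_def)
  finally have I: "I \<le> ennreal (B powr q)" .
  then have "enn2real I \<le> B powr q" by (simp add: enn2real_leI)
  then have "enn2real I powr (1 / q) \<le> (B powr q) powr (1 / q)"
    using q by (intro powr_mono2) auto
  also have "\<dots> = B" using q B by (simp add: powr_powr)
  finally have "ennreal (enn2real I powr (1 / q)) \<le> ennreal B" by (rule ennreal_leI)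
  moreover have "I \<noteq> \<infinity>" using I by (auto simp: top_unique)
  ultimately show ?thesis
    using False by (simp add: Lp_norm_def conjugate_exponent_def q_def[symmetric] I_def[symmetric] Let_def)
qed

lemma Lp_space_iff:
  "f \<in> Lp_space (ereal p) \<longleftrightarrow>
     f \<in> borel_measurable lebesgue \<and> (\<integral>\<^sup>+ x. ennreal (\<bar>f x\<bar> powr p) \<partial>lebesgue) < \<infinity>"
  by (auto simp: Lp_space_def Lp_norm_def Let_def less_top)

lemma mult_le_powr_sum:
  fixes u v p :: real
  assumes "p > 1" "0 \<le> u" "0 \<le> v"
  shows "u * v \<le> u powr (p / (p - 1)) + v powr p"
proof -
  have "u * v \<le> u powr (p / (p - 1)) / (p / (p - 1)) + v powr p / p"
    using assms by (intro Youngs_inequality) (auto simp: field_simps)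
  also have "\<dots> \<le> u powr (p / (p - 1)) / 1 + v powr p / 1"
    using assms by (intro add_mono divide_left_mono) (auto simp: field_simps)
  finally show ?thesis by simp
qed

text \<open>The duality pairing of \<open>L\<^sup>q\<close> and \<open>L\<^sup>p\<close> is bounded, with a constant depending on \<open>f\<close>.\<close>

lemma nn_integral_pairing_le:
  fixes f g :: "'a::euclidean_space \<Rightarrow> real"
  assumes p: "p \<ge> 1" and f: "f \<in> Lp_space (ereal p)"
    and g: "g \<in> borel_measurable lebesgue"
    and le: "p = 1 \<Longrightarrow> AE x in lebesgue. \<bar>g x\<bar> \<le> 1"
      "p > 1 \<Longrightarrow> (\<integral>\<^sup>+ x. ennreal (\<bar>g x\<bar> powr (p / (p - 1))) \<partial>lebesgue) \<le> 1"
  shows "(\<integral>\<^sup>+ x. ennreal \<bar>g x * f x\<bar> \<partial>lebesgue) \<le> 1 + (\<integral>\<^sup>+ x. ennreal (\<bar>f x\<bar> powr p) \<partial>lebesgue)"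
proof (cases "p = 1")
  case True
  have "(\<integral>\<^sup>+ x. ennreal \<bar>g x * f x\<bar> \<partial>lebesgue) \<le> (\<integral>\<^sup>+ x. ennreal (\<bar>f x\<bar> powr p) \<partial>lebesgue)"
  proof (rule nn_integral_mono_AE, use le(1)[OF True] in \<open>rule AE_mp\<close>, intro AE_I2 impI ennreal_leI)
    fix x assume "\<bar>g x\<bar> \<le> 1"
    then have "\<bar>g x\<bar> * \<bar>f x\<bar> \<le> 1 * \<bar>f x\<bar>" by (intro mult_right_mono) auto
    then show "\<bar>g x * f x\<bar> \<le> \<bar>f x\<bar> powr p" using True by (simp add: abs_mult)
  qed
  then show ?thesis by (simp add: add_increasing)
next
  case False
  with p have p: "p > 1" by simp
  have [measurable]: "f \<in> borel_measurable lebesgue" "g \<in> borel_measurable lebesgue"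
    using f g by (auto simp: Lp_space_iff)
  have "(\<integral>\<^sup>+ x. ennreal \<bar>g x * f x\<bar> \<partial>lebesgue)
      \<le> (\<integral>\<^sup>+ x. ennreal (\<bar>g x\<bar> powr (p / (p - 1))) + ennreal (\<bar>f x\<bar> powr p) \<partial>lebesgue)"
    using mult_le_powr_sum[OF p, of "\<bar>g _\<bar>" "\<bar>f _\<bar>"]
    by (intro nn_integral_mono) (auto simp: abs_mult ennreal_leI simp flip: ennreal_plus)
  also have "\<dots> = (\<integral>\<^sup>+ x. ennreal (\<bar>g x\<bar> powr (p / (p - 1))) \<partial>lebesgue)
      + (\<integral>\<^sup>+ x. ennreal (\<bar>f x\<bar> powr p) \<partial>lebesgue)"
    by (rule nn_integral_add) measurable
  also have "\<dots> \<le> 1 + (\<integral>\<^sup>+ x. ennreal (\<bar>f x\<bar> powr p) \<partial>lebesgue)"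
    by (intro add_right_mono le p)
  finally show ?thesis .
qed

lemma abs_integral_le_of_nn_integral_le:
  fixes u :: "'a \<Rightarrow> real"
  assumes "(\<integral>\<^sup>+ x. ennreal \<bar>u x\<bar> \<partial>M) \<le> ennreal K" "0 \<le> K"
  shows "\<bar>integral\<^sup>L M u\<bar> \<le> K"
proof (cases "integrable M u")
  case True
  have "ennreal \<bar>integral\<^sup>L M u\<bar> \<le> ennreal K"
    using integral_norm_bound_ennreal[OF True] assms(1) by (auto intro: order_trans)
  then show ?thesis using assms(2) by (simp add: ennreal_le_iff)
qed (use assms in \<open>simp add: not_integrable_integral_eq\<close>)

text \<open>
  A bound for \<open>\<bar>\<integral> g f\<bar>\<close> over all \<open>g\<close> in the unit ball of \<open>L\<^sup>q\<close>. It is cruder than the norm of \<open>f\<close>, but it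
  only serves to show that certain suprema are finite and that certain terms tend to zero.
\<close>

definition pairing_bound :: "real \<Rightarrow> ('a::euclidean_space \<Rightarrow> real) \<Rightarrow> real" where
  "pairing_bound p f = 1 + enn2real (\<integral>\<^sup>+ x. ennreal (\<bar>f x\<bar> powr p) \<partial>lebesgue)"

lemma pairing_bound:
  assumes "f \<in> Lp_space (ereal p)"
  shows "1 + (\<integral>\<^sup>+ x. ennreal (\<bar>f x\<bar> powr p) \<partial>lebesgue) = ennreal (pairing_bound p f)"
    and "pairing_bound p f \<ge> 1"
proof -
  have "(\<integral>\<^sup>+ x. ennreal (\<bar>f x\<bar> powr p) \<partial>lebesgue) < \<infinity>"
    using assms by (simp add: Lp_space_iff)
  then show "1 + (\<integral>\<^sup>+ x. ennreal (\<bar>f x\<bar> powr p) \<partial>lebesgue) = ennreal (pairing_bound p f)"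
    by (simp add: pairing_bound_def ennreal_plus less_top)
qed (simp add: pairing_bound_def)

lemma qnorm_le_pairing:
  fixes f g :: "'a::euclidean_space \<Rightarrow> real"
  assumes p: "p \<ge> 1" and f: "f \<in> Lp_space (ereal p)"
    and g: "qnorm_le p g B" "B > 0" and gm: "g \<in> borel_measurable borel"
  shows "\<bar>\<integral>x. g x * f x \<partial>lebesgue\<bar> \<le> B * pairing_bound p f"
proof -
  have g': "qnorm_le p (\<lambda>x. (1 / B) * g x) 1"
    using qnorm_le_scale[OF p g(1) _ gm, of "1 / B"] g(2) by simp
  have gm': "(\<lambda>x. (1 / B) * g x) \<in> borel_measurable lebesgue"
    using gm by (intro measurable_completion) measurable
  have "(\<integral>\<^sup>+ x. ennreal \<bar>(1 / B) * g x * f x\<bar> \<partial>lebesgue) \<le> ennreal (pairing_bound p f)"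
    unfolding pairing_bound(1)[OF f, symmetric]
  proof (rule nn_integral_pairing_le[OF p f gm'])
    show "p = 1 \<Longrightarrow> AE x in lebesgue. \<bar>1 / B * g x\<bar> \<le> 1"
      using g' by (intro AE_I2) (simp add: qnorm_le_def)
    show "p > 1 \<Longrightarrow> (\<integral>\<^sup>+ x. ennreal (\<bar>1 / B * g x\<bar> powr (p / (p - 1))) \<partial>lebesgue) \<le> 1"
      unfolding nn_integral_completion using g' by (simp add: qnorm_le_def)
  qed
  then have "\<bar>\<integral>x. (1 / B) * (g x * f x) \<partial>lebesgue\<bar> \<le> pairing_bound p f"
    using pairing_bound(2)[OF f] by (intro abs_integral_le_of_nn_integral_le) (auto simp: mult.assoc)
  then show ?thesis using g(2) by (simp add: abs_mult field_simps)
qed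

lemma e2ennreal_le_1D: "e2ennreal e \<le> 1 \<Longrightarrow> e \<le> 1"
  by (cases e) (auto simp: one_ereal_def top_unique)

lemma Ck_imp_divergence_continuous:
  fixes \<Phi> :: "real ^ 'n::finite \<Rightarrow> real ^ 'n"
  assumes "Ck (Suc 0) \<Phi>"
  shows "continuous_on UNIV (divergence \<Phi>)"
  using assms unfolding divergence_def[abs_def] by (auto intro!: continuous_intros)

text \<open>
  A real supremum dominates the members of its set only when that set is bounded above, which is checked here.
\<close>

lemma sigma_p_ge:
  fixes f :: "real ^ 'n::finite \<Rightarrow> real"
  assumes p: "p \<ge> 1" and f: "f \<in> Lp_space (ereal p)"
    and \<Phi>: "\<Phi> \<in> test_fields" "Lp_norm (conjugate_exponent p) (divergence \<Phi>) \<le> 1"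
      "Lp_norm (conjugate_exponent p) \<Phi> \<le> ennreal \<epsilon>"
  shows "(\<integral>x. divergence \<Phi> x * f x \<partial>lebesgue) \<le> sigma_p p f \<epsilon>"
  unfolding sigma_p_def
proof (rule cSup_upper)
  let ?S = "{(\<integral>x. divergence \<Phi> x * f x \<partial>lebesgue) | \<Phi>.
           \<Phi> \<in> test_fields \<and>
           Lp_norm (conjugate_exponent p) (divergence \<Phi>) \<le> 1 \<and>
           Lp_norm (conjugate_exponent p) \<Phi> \<le> ennreal \<epsilon>}"
  show "(\<integral>x. divergence \<Phi> x * f x \<partial>lebesgue) \<in> ?S" using \<Phi> by blast
  show "bdd_above ?S"
  proof (rule bdd_aboveI)
    fix v assume "v \<in> ?S"
    then obtain \<Psi> where \<Psi>: "\<Psi> \<in> test_fields" "Lp_norm (conjugate_exponent p) (divergence \<Psi>) \<le> 1"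
      "v = (\<integral>x. divergence \<Psi> x * f x \<partial>lebesgue)" by blast
    have "continuous_on UNIV (divergence \<Psi>)"
      using \<Psi>(1) by (intro Ck_imp_divergence_continuous) (auto simp: test_fields_def)
    then have "divergence \<Psi> \<in> borel_measurable lborel"
      by (simp add: borel_measurable_continuous_onI)
    then have m: "divergence \<Psi> \<in> borel_measurable lebesgue" by (rule measurable_completion)
    have "(\<integral>\<^sup>+ x. ennreal \<bar>divergence \<Psi> x * f x\<bar> \<partial>lebesgue) \<le> ennreal (pairing_bound p f)"
      unfolding pairing_bound(1)[OF f, symmetric]
    proof (rule nn_integral_pairing_le[OF p f m])
      assume "p = 1"
      then have "e2ennreal (esssup lebesgue (\<lambda>x. ereal \<bar>divergence \<Psi> x\<bar>)) \<le> 1"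
        using \<Psi>(2) by (simp add: Lp_norm_def conjugate_exponent_def)
      then have "esssup lebesgue (\<lambda>x. ereal \<bar>divergence \<Psi> x\<bar>) \<le> 1"
        by (rule e2ennreal_le_1D)
      note ess = this
      have "AE x in lebesgue. ereal \<bar>divergence \<Psi> x\<bar> \<le> 1"
        by (rule eventually_mono[OF esssup_AE]) (rule order_trans[OF _ ess])
      then show "AE x in lebesgue. \<bar>divergence \<Psi> x\<bar> \<le> 1"
        by (simp add: one_ereal_def)
    next
      assume p: "p > 1"
      define q where "q = p / (p - 1)"
      have q: "q > 1" using p conjugate_exponent_gt_1[of p] by (simp add: q_def)
      define I where "I = (\<integral>\<^sup>+ x. ennreal (\<bar>divergence \<Psi> x\<bar> powr q) \<partial>lebesgue)"
      have "(if I = \<infinity> then \<infinity> else ennreal (enn2real I powr (1 / q))) \<le> 1"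
        using \<Psi>(2) p
        by (simp add: Lp_norm_def conjugate_exponent_def q_def[symmetric] I_def[symmetric] Let_def
            split: if_splits)
      then have I: "I \<noteq> \<infinity>" "ennreal (enn2real I powr (1 / q)) \<le> 1"
        by (auto split: if_splits simp: top_unique)
      then have "enn2real I powr (1 / q) \<le> 1" by simp
      then have "(enn2real I powr (1 / q)) powr q \<le> 1 powr q"
        using q by (intro powr_mono2) auto
      then have "enn2real I \<le> 1" using q by (simp add: powr_powr)
      then have "I \<le> 1" using I(1) by (cases I) auto
      then show "(\<integral>\<^sup>+ x. ennreal (\<bar>divergence \<Psi> x\<bar> powr (p / (p - 1))) \<partial>lebesgue) \<le> 1"
        by (simp add: I_def q_def)
    qed
    then show "v \<le> pairing_bound p f"
      unfolding \<Psi>(3) using abs_integral_le_of_nn_integral_le[of lebesgue "\<lambda>x. divergence \<Psi> x * f x" "pairing_bound p f"]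
        pairing_bound(2)[OF f] by auto
  qed
qed

section \<open>The kernel \<open>\<bar>z\<bar>\<^sup>1\<^sup>-\<^sup>n\<close>\<close>

text \<open>
  The part of \<open>\<bar>z\<bar>\<^sup>1\<^sup>-\<^sup>n\<close> inside the ball of radius \<open>R\<close>, which is integrable, and the part outside, which
  is in \<open>L\<^sup>q\<close> when \<open>p < n\<close> or \<open>p = 1\<close>. At the origin the near part has the value \<open>0\<close>, since \<open>0 powr a = 0\<close>.
\<close>

definition near_kernel :: "real \<Rightarrow> 'a::euclidean_space \<Rightarrow> real" where
  "near_kernel R z = (if norm z < R then norm z powr (1 - real DIM('a)) else 0)"

definition far_kernel :: "real \<Rightarrow> 'a::euclidean_space \<Rightarrow> real" where
  "far_kernel R z = (if norm z < R then 0 else norm z powr (1 - real DIM('a)))"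

lemma kernel_measurable [measurable]:
  "near_kernel R \<in> borel_measurable borel" "far_kernel R \<in> borel_measurable borel"
  unfolding near_kernel_def[abs_def] far_kernel_def[abs_def] by measurable

lemma kernel_nonneg: "near_kernel R z \<ge> 0" "far_kernel R z \<ge> 0"
  by (auto simp: near_kernel_def far_kernel_def)

text \<open>
  Integrability criterion for a function that is dominated by \<open>c\<^sub>j\<close> on balls of radius \<open>r\<^sub>j\<close>; for
  powers of \<open>\<bar>z\<bar>\<close> the radii are powers of two and the resulting series is geometric.
\<close>

lemma nn_integral_finite_dyadic:
  fixes u :: "'a::euclidean_space \<Rightarrow> real"
  assumes u: "\<And>z. u z > 0 \<Longrightarrow> \<exists>j. norm z \<le> r j \<and> u z \<le> c j"
    and c: "\<And>j. 0 \<le> c j" and r: "\<And>j. 0 \<le> r j"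
    and summable: "summable (\<lambda>j. c j * r j ^ DIM('a))"
  shows "(\<integral>\<^sup>+ z. ennreal (u z) \<partial>lborel) < \<infinity>"
proof -
  have "(\<integral>\<^sup>+ z. ennreal (u z) \<partial>lborel)
      \<le> (\<integral>\<^sup>+ z. (\<Sum>j. ennreal (c j) * indicator (cball (0::'a) (r j)) z) \<partial>lborel)"
  proof (intro nn_integral_mono)
    fix z :: 'a
    show "ennreal (u z) \<le> (\<Sum>j. ennreal (c j) * indicator (cball 0 (r j)) z)"
    proof (cases "u z > 0")
      case True
      then obtain j where j: "norm z \<le> r j" "u z \<le> c j" using u by blast
      then have "ennreal (u z) \<le> ennreal (c j) * indicator (cball 0 (r j)) z"
        by (auto simp: indicator_def intro: ennreal_leI)
      also have "\<dots> \<le> (\<Sum>j. ennreal (c j) * indicator (cball 0 (r j)) z)"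
      proof -
        define F where "F = (\<lambda>j. ennreal (c j) * indicator (cball 0 (r j)) z)"
        have "sum F {j} \<le> suminf F" by (intro sum_le_suminf) auto
        then have "F j \<le> suminf F" by simp
        then show ?thesis by (simp add: F_def)
      qed
      finally show ?thesis .
    qed (simp add: ennreal_neg)
  qed
  also have "\<dots> = (\<Sum>j. \<integral>\<^sup>+ z. ennreal (c j) * indicator (cball (0::'a) (r j)) z \<partial>lborel)"
  proof (rule nn_integral_suminf)
    fix j
    have [measurable]: "cball (0::'a) (r j) \<in> sets borel" by simp
    show "(\<lambda>z. ennreal (c j) * indicator (cball (0::'a) (r j)) z) \<in> borel_measurable lborel"
      by measurable
  qed
  also have "\<dots> = (\<Sum>j. ennreal (unit_ball_vol (real DIM('a)) * (c j * r j ^ DIM('a))))"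
  proof (intro suminf_cong)
    fix j
    have "(\<integral>\<^sup>+ z. ennreal (c j) * indicator (cball (0::'a) (r j)) z \<partial>lborel)
        = ennreal (c j) * emeasure lborel (cball (0::'a) (r j))"
      by (rule nn_integral_cmult_indicator) simp
    also have "\<dots> = ennreal (unit_ball_vol (real DIM('a)) * (c j * r j ^ DIM('a)))"
      using c r by (simp add: emeasure_cball mult_ac flip: ennreal_mult)
    finally show "(\<integral>\<^sup>+ z. ennreal (c j) * indicator (cball (0::'a) (r j)) z \<partial>lborel)
        = ennreal (unit_ball_vol (real DIM('a)) * (c j * r j ^ DIM('a)))" .
  qed
  also have "\<dots> < \<infinity>"
  proof -
    have "0 \<le> unit_ball_vol (real DIM('a)) * (c j * r j ^ DIM('a))" for j
      using c r by simp
    from ennreal_suminf_neq_top[OF summable_mult[OF summable] this] show ?thesis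
      by (simp only: less_top infinity_ennreal_def)
  qed
  finally show ?thesis .
qed

lemma near_kernel_1_finite:
  "(\<integral>\<^sup>+ z. ennreal (near_kernel 1 (z::'a::euclidean_space)) \<partial>lborel) < \<infinity>"
proof (rule nn_integral_finite_dyadic[where r = "\<lambda>j. (1 / 2) ^ j"
      and c = "\<lambda>j. ((1 / 2) ^ Suc j) powr (1 - real DIM('a))"])
  fix z :: 'a assume "near_kernel 1 z > 0"
  then have z: "norm z < 1" "norm z > 0" by (auto simp: near_kernel_def split: if_splits)
  define m where "m = (LEAST m. (1 / 2) ^ m < norm z)"
  obtain m0 where "(1 / 2) ^ m0 < norm z" using real_arch_pow_inv[of "norm z" "1 / 2"] z by auto
  then have m: "(1 / 2) ^ m < norm z" unfolding m_def by (rule LeastI)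
  then have "m \<noteq> 0" using z by (intro notI) simp
  then obtain j where j: "m = Suc j" by (cases m) auto
  then have "\<not> (1 / 2) ^ j < norm z"
    using not_less_Least[of j "\<lambda>m. (1 / 2) ^ m < norm z"] by (simp add: m_def)
  moreover have "norm z powr (1 - real DIM('a)) \<le> ((1 / 2) ^ Suc j) powr (1 - real DIM('a))"
    using m j by (intro powr_mono2') auto
  ultimately show "\<exists>j. norm z \<le> (1 / 2) ^ j \<and> near_kernel 1 z \<le> ((1 / 2) ^ Suc j) powr (1 - real DIM('a))"
    using z by (intro exI[of _ j]) (auto simp: near_kernel_def)
next
  have "((1 / 2) ^ Suc j) powr (1 - real DIM('a)) * ((1 / 2) ^ j) ^ DIM('a)
      = (1 / 2) powr (1 - real DIM('a)) * (1 / 2) ^ j" for j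
  proof -
    define s :: real where "s = (1 / 2) ^ j"
    have "((1 / 2) ^ Suc j) powr (1 - real DIM('a)) * s ^ DIM('a)
        = (1 / 2) powr (1 - real DIM('a)) * (s powr (1 - real DIM('a)) * s powr (real DIM('a)))"
      using powr_mult[of "1 / 2" s "1 - real DIM('a)"]
      by (subst powr_realpow) (auto simp: s_def)
    also have "s powr (1 - real DIM('a)) * s powr (real DIM('a)) = s"
      by (subst powr_add[symmetric]) (auto simp: s_def)
    finally show ?thesis by (simp add: s_def)
  qed
  then show "summable (\<lambda>j. ((1 / 2) ^ Suc j) powr (1 - real DIM('a)) * ((1 / 2) ^ j) ^ DIM('a))"
    by (simp add: summable_mult summable_geometric)
qed auto

text \<open>
  The hypothesis says that \<open>\<bar>z\<bar>\<^sup>1\<^sup>-\<^sup>n\<close> to the power \<open>q\<close> decays faster than \<open>\<bar>z\<bar>\<^sup>-\<^sup>n\<close>; for the exponent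
  conjugate to \<open>p > 1\<close> it amounts to \<open>p < n\<close>.
\<close>

lemma far_kernel_1_finite:
  assumes q: "q * (real DIM('a) - 1) > real DIM('a)" "q > 0"
  shows "(\<integral>\<^sup>+ z. ennreal (far_kernel 1 (z::'a::euclidean_space) powr q) \<partial>lborel) < \<infinity>"
proof (rule nn_integral_finite_dyadic[where r = "\<lambda>j. 2 ^ Suc j"
      and c = "\<lambda>j. (2 ^ j) powr (- (q * (real DIM('a) - 1)))"])
  fix z :: 'a assume "far_kernel 1 z powr q > 0"
  then have z: "norm z \<ge> 1" by (auto simp: far_kernel_def split: if_splits)
  define m where "m = (LEAST m. norm z < 2 ^ m)"
  obtain m0 where "norm z < 2 ^ m0" using real_arch_pow[of 2 "norm z"] by auto
  then have m: "norm z < 2 ^ m" unfolding m_def by (rule LeastI)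
  then have "m \<noteq> 0" using z by (intro notI) simp
  then obtain j where j: "m = Suc j" by (cases m) auto
  then have "\<not> norm z < 2 ^ j"
    using not_less_Least[of j "\<lambda>m. norm z < 2 ^ m"] by (simp add: m_def)
  then have "norm z powr (- (q * (real DIM('a) - 1))) \<le> (2 ^ j) powr (- (q * (real DIM('a) - 1)))"
    using q by (intro powr_mono2') auto
  moreover have "far_kernel 1 z powr q = norm z powr (- (q * (real DIM('a) - 1)))"
    using z by (simp add: far_kernel_def powr_powr algebra_simps)
  ultimately show "\<exists>j. norm z \<le> 2 ^ Suc j \<and>
      far_kernel 1 z powr q \<le> (2 ^ j) powr (- (q * (real DIM('a) - 1)))"
    using m j by (intro exI[of _ j]) auto
next
  define \<theta> :: real where "\<theta> = 2 powr (real DIM('a) - q * (real DIM('a) - 1))"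
  have \<theta>: "0 \<le> \<theta>" "\<theta> < 1"
    using q powr_less_mono[of "real DIM('a) - q * (real DIM('a) - 1)" 0 2] by (auto simp: \<theta>_def)
  have "(2 ^ j) powr (- (q * (real DIM('a) - 1))) * (2 ^ Suc j) ^ DIM('a)
      = 2 ^ DIM('a) * \<theta> ^ j" for j
  proof -
    have "(2 ^ j) powr (- (q * (real DIM('a) - 1))) * (2 ^ Suc j) ^ DIM('a)
        = 2 ^ DIM('a) * ((2 ^ j) powr (- (q * (real DIM('a) - 1))) * (2 ^ j) powr real DIM('a))"
      by (subst powr_realpow) (auto simp: power_mult_distrib)
    also have "(2 ^ j) powr (- (q * (real DIM('a) - 1))) * (2 ^ j) powr real DIM('a)
        = (2 powr real j) powr (real DIM('a) - q * (real DIM('a) - 1))"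
      by (subst powr_add[symmetric]) (simp add: powr_realpow)
    also have "\<dots> = \<theta> ^ j"
      by (simp add: \<theta>_def powr_powr mult.commute flip: powr_realpow)
    finally show ?thesis .
  qed
  then show "summable (\<lambda>j. (2 ^ j) powr (- (q * (real DIM('a) - 1))) * (2 ^ Suc j) ^ DIM('a))"
    using \<theta> by (simp only: summable_mult summable_geometric real_norm_def abs_of_nonneg)
qed auto

text \<open>
  The dependence on the radius in this and the next lemma follows by scaling from the case \<open>R = 1\<close>.
\<close>

lemma near_kernel_bound:
  "\<exists>C>0. \<forall>R>0. (\<integral>\<^sup>+ z. ennreal (near_kernel R (z::'a::euclidean_space)) \<partial>lborel) \<le> ennreal (C * R)"
proof -
  let ?I = "\<integral>\<^sup>+ z. ennreal (near_kernel 1 (z::'a)) \<partial>lborel"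
  define C where "C = enn2real ?I + 1"
  have C: "?I \<le> ennreal C" "C > 0"
    using near_kernel_1_finite[where 'a = 'a]
    by (simp_all add: C_def less_top ennreal_plus add_increasing2 add_nonneg_pos)
  have "(\<integral>\<^sup>+ z. ennreal (near_kernel R (z::'a)) \<partial>lborel) \<le> ennreal (C * R)" if R: "R > 0" for R
  proof -
    have scale: "near_kernel R (R *\<^sub>R z) = R powr (1 - real DIM('a)) * near_kernel 1 z" for z :: 'a
      using R by (auto simp: near_kernel_def powr_mult)
    have "(\<integral>\<^sup>+ z. ennreal (near_kernel R (z::'a)) \<partial>lborel)
        = ennreal (R ^ DIM('a)) * (\<integral>\<^sup>+ z. ennreal (near_kernel R (R *\<^sub>R (z::'a))) \<partial>lborel)"
      using R nn_integral_lborel_affine[of "\<lambda>z::'a. ennreal (near_kernel R z)" R 0] by simp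
    also have "\<dots> = ennreal (R ^ DIM('a)) * (ennreal (R powr (1 - real DIM('a))) * ?I)"
      unfolding scale using R by (simp add: ennreal_mult kernel_nonneg nn_integral_cmult)
    also have "\<dots> = ennreal R * ?I"
    proof -
      have "R ^ DIM('a) * R powr (1 - real DIM('a)) = R"
        using R by (simp flip: powr_realpow powr_add)
      then show ?thesis using R by (simp flip: mult.assoc ennreal_mult)
    qed
    also have "\<dots> \<le> ennreal R * ennreal C" by (intro mult_left_mono C) simp
    also have "\<dots> = ennreal (C * R)" using R C by (simp add: mult.commute flip: ennreal_mult)
    finally show ?thesis .
  qed
  with C show ?thesis by blast
qed

lemma far_kernel_bound:
  assumes p: "p = 1 \<or> (1 < p \<and> p < real DIM('a::euclidean_space))"
  shows "\<exists>C>0. \<forall>R>0. qnorm_le p (far_kernel R :: 'a \<Rightarrow> real) (C * R powr (1 - real DIM('a) / p))"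
  using p
proof
  assume p: "p = 1"
  have "\<bar>far_kernel R (z::'a)\<bar> \<le> 1 * R powr (1 - real DIM('a) / p)" if R: "R > 0" for R z
    using R p by (auto simp: far_kernel_def DIM_positive Suc_leI intro!: powr_mono2')
  then show ?thesis
    using p by (intro exI[of _ 1]) (auto simp: qnorm_le_def)
next
  assume p: "1 < p \<and> p < real DIM('a)"
  define q where "q = p / (p - 1)"
  have q: "q > 1" using p conjugate_exponent_gt_1[of p] by (simp add: q_def)
  have q1: "q * (real DIM('a) - 1) > real DIM('a)"
    using p by (simp add: q_def field_simps)
  let ?J = "\<integral>\<^sup>+ z. ennreal (far_kernel 1 (z::'a) powr q) \<partial>lborel"
  define C where "C = enn2real ?J + 1"
  have C: "?J \<le> ennreal C" "C \<ge> 1"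
    using far_kernel_1_finite[OF q1] q
    by (simp_all add: C_def less_top ennreal_plus add_increasing2)
  have "qnorm_le p (far_kernel R :: 'a \<Rightarrow> real) (C * R powr (1 - real DIM('a) / p))" if R: "R > 0" for R
  proof -
    have scale: "far_kernel R (R *\<^sub>R z) = R powr (1 - real DIM('a)) * far_kernel 1 z" for z :: 'a
      using R by (auto simp: far_kernel_def powr_mult)
    have "(\<integral>\<^sup>+ z. ennreal (\<bar>far_kernel R (z::'a)\<bar> powr q) \<partial>lborel)
        = ennreal (R ^ DIM('a)) * (\<integral>\<^sup>+ z. ennreal (\<bar>far_kernel R (R *\<^sub>R (z::'a))\<bar> powr q) \<partial>lborel)"
      using R nn_integral_lborel_affine[of "\<lambda>z::'a. ennreal (\<bar>far_kernel R z\<bar> powr q)" R 0] by simp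
    also have "\<dots> = ennreal (R ^ DIM('a)) * (ennreal (R powr ((1 - real DIM('a)) * q)) * ?J)"
      unfolding scale using R
      by (simp add: abs_mult powr_mult powr_powr ennreal_mult kernel_nonneg nn_integral_cmult)
    also have "\<dots> = ennreal (R powr ((1 - real DIM('a) / p) * q)) * ?J"
    proof -
      have "real DIM('a) + (1 - real DIM('a)) * q = (1 - real DIM('a) / p) * q"
        using p by (simp add: q_def field_simps)
      then have "R ^ DIM('a) * R powr ((1 - real DIM('a)) * q) = R powr ((1 - real DIM('a) / p) * q)"
        using R by (simp flip: powr_realpow powr_add)
      then show ?thesis using R by (simp flip: mult.assoc ennreal_mult)
    qed
    also have "\<dots> \<le> ennreal (R powr ((1 - real DIM('a) / p) * q)) * ennreal (C powr q)"
    proof (intro mult_left_mono order_trans[OF C(1)] ennreal_leI)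
      show "C \<le> C powr q" using powr_mono[of 1 q C] q C by simp
    qed simp
    also have "\<dots> = ennreal ((C * R powr (1 - real DIM('a) / p)) powr q)"
      using C by (simp add: powr_mult powr_powr mult.commute flip: ennreal_mult)
    finally show ?thesis using p by (simp add: qnorm_le_def q_def)
  qed
  moreover have "C > 0" using C by simp
  ultimately show ?thesis by blast
qed

section \<open>A mollified Newton kernel\<close>

text \<open>
  A smooth bump supported in \<open>[1, 2]\<close>, and its antiderivative vanishing at \<open>1\<close>: a smooth nondecreasing
  function which is \<open>0\<close> on the left of \<open>1\<close> and constant on the right of \<open>2\<close>.
\<close>

definition step_deriv :: "real \<Rightarrow> real" where
  "step_deriv t = bump_aux 0 (t - 1) * bump_aux 0 (2 - t)"

definition smooth_step :: "real \<Rightarrow> real" where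
  "smooth_step t = (let F = SOME F. \<forall>t. (F has_real_derivative step_deriv t) (at t) in F t - F 1)"

lemma step_deriv_smooth: "step_deriv \<in> smooth_real"
proof -
  have "(\<lambda>t. bump_aux 0 (1 * t + (- 1)) * bump_aux 0 ((- 1) * t + 2)) \<in> smooth_real"
    by (intro smooth_real.mult smooth_real.affine[of "bump_aux 0"] smooth_real.bump)
  then show ?thesis by (simp add: step_deriv_def[abs_def] add.commute)
qed

lemma step_deriv_bounds: "0 \<le> step_deriv t" "step_deriv t \<le> 1"
  using bump_aux_bounds(1,2) by (auto simp: step_deriv_def intro: mult_le_one)

lemma step_deriv_eq_0: "t \<le> 1 \<or> t \<ge> 2 \<Longrightarrow> step_deriv t = 0"
  by (auto simp: step_deriv_def bump_aux_bounds(3))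

lemma step_deriv_pos: "1 < t \<Longrightarrow> t < 2 \<Longrightarrow> step_deriv t > 0"
  by (simp add: step_deriv_def bump_aux_bounds(4))

lemma smooth_step_deriv: "(smooth_step has_real_derivative step_deriv t) (at t)"
proof -
  have "\<exists>F. \<forall>t. - \<infinity> < ereal t \<longrightarrow> ereal t < \<infinity> \<longrightarrow> (F has_vector_derivative step_deriv t) (at t)"
    using smooth_real_continuous[OF step_deriv_smooth, of UNIV]
    by (intro einterval_antiderivative) (auto simp: continuous_on_eq_continuous_at)
  then have "\<exists>F. \<forall>t. (F has_real_derivative step_deriv t) (at t)"
    by (simp add: has_real_derivative_iff_has_vector_derivative)
  then have F: "\<forall>t. ((SOME F. \<forall>t. (F has_real_derivative step_deriv t) (at t))
      has_real_derivative step_deriv t) (at t)"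
    by (rule someI_ex)
  show ?thesis unfolding smooth_step_def[abs_def] Let_def
    using F by (auto intro!: derivative_eq_intros)
qed

lemma smooth_step_continuous: "continuous_on S smooth_step"
  using smooth_step_deriv by (intro continuous_at_imp_continuous_on) (blast intro: DERIV_isCont)

lemma smooth_step_mono: "s \<le> t \<Longrightarrow> smooth_step s \<le> smooth_step t"
  using DERIV_nonneg_imp_nondecreasing[of s t smooth_step] smooth_step_deriv step_deriv_bounds(1) by blast

lemma smooth_step_eq_0: assumes "t \<le> 1" shows "smooth_step t = 0"
proof -
  have 1: "smooth_step 1 = 0" by (simp add: smooth_step_def Let_def)
  have "smooth_step 1 = smooth_step t" if "t < 1"
  proof (rule DERIV_isconst_end[OF that smooth_step_continuous])
    fix x :: real assume "x < 1"
    then show "(smooth_step has_real_derivative 0) (at x)"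
      using smooth_step_deriv[of x] by (simp add: step_deriv_eq_0)
  qed
  with 1 assms show ?thesis by fastforce
qed

lemma smooth_step_eq_2: assumes "t \<ge> 2" shows "smooth_step t = smooth_step 2"
proof -
  have "smooth_step t = smooth_step 2" if "2 < t"
  proof (rule DERIV_isconst_end[OF that smooth_step_continuous])
    fix x :: real assume "2 < x"
    then show "(smooth_step has_real_derivative 0) (at x)"
      using smooth_step_deriv[of x] by (simp add: step_deriv_eq_0)
  qed
  with assms show ?thesis by fastforce
qed

lemma smooth_step_bounds: "0 \<le> smooth_step t" "smooth_step t \<le> smooth_step 2"
proof -
  show "0 \<le> smooth_step t"
    using smooth_step_mono[of 1 t] smooth_step_eq_0[of t] smooth_step_eq_0[of 1] by linarith
  show "smooth_step t \<le> smooth_step 2"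
    using smooth_step_mono[of t 2] smooth_step_eq_2[of t] by linarith
qed

lemma smooth_step_smooth: "smooth_step \<in> smooth_real"
  by (rule smooth_real.antideriv[OF step_deriv_smooth smooth_step_deriv])

text \<open>
  The \<open>j\<close>-th component of the vector field \<open>x \<bar>x\<bar>\<^sup>-\<^sup>n G (\<bar>x\<bar>\<^sup>2 / s\<^sup>2)\<close> with \<open>G\<close> the smooth step. It is the gradient
  of the Newton potential, up to a constant factor, smoothed at scale \<open>s\<close>: it agrees with \<open>G 2\<close> times
  \<open>x \<bar>x\<bar>\<^sup>-\<^sup>n\<close>, independently of \<open>s\<close>, as soon as \<open>\<bar>x\<bar>\<^sup>2 \<ge> 2 s\<^sup>2\<close>.
\<close>

definition newton :: "real \<Rightarrow> 'n \<Rightarrow> real ^ 'n::finite \<Rightarrow> real" where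
  "newton s j x = x $ j * ((x \<bullet> x) powr (- (real CARD('n) / 2)) * smooth_step ((x \<bullet> x) / s\<^sup>2))"

text \<open>
  The divergence of the preceding field. It is a nonnegative bump at scale \<open>s\<close>, in fact the rescaling
  \<open>s\<^sup>-\<^sup>n source 1 (x / s)\<close>.
\<close>

definition source :: "real \<Rightarrow> real ^ 'n::finite \<Rightarrow> real" where
  "source s x = 2 * (x \<bullet> x) powr (1 - real CARD('n) / 2) * step_deriv ((x \<bullet> x) / s\<^sup>2) / s\<^sup>2"

lemma radial_profile_smooth:
  assumes "s > 0"
  shows "(\<lambda>t. t powr a * smooth_step (t / s\<^sup>2)) \<in> smooth_real"
proof (rule smooth_real.powr[of _ "s\<^sup>2"])
  have "(\<lambda>t. smooth_step ((1 / s\<^sup>2) * t + 0)) \<in> smooth_real"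
    by (rule smooth_real.affine[OF smooth_step_smooth])
  then show "(\<lambda>t. smooth_step (t / s\<^sup>2)) \<in> smooth_real" by simp
  show "smooth_step (t / s\<^sup>2) = 0" if "t < s\<^sup>2" for t
    using that assms by (intro smooth_step_eq_0) (simp add: field_simps)
qed (use assms in simp)

lemma inner_self_powr: "(x \<bullet> x) powr a = norm x powr (2 * a)"
proof (cases "x = 0")
  case False
  then have "(norm x)\<^sup>2 = norm x powr 2" by simp
  then show ?thesis by (simp only: power2_norm_eq_inner[symmetric] powr_powr)
qed simp

lemma Ck_newton: "s > 0 \<Longrightarrow> Ck k (newton s j)"
  unfolding newton_def[abs_def]
  by (intro Ck_mult Ck_component Ck_radial[where u = "\<lambda>t. t powr a * smooth_step (t / s\<^sup>2)" for a]
      radial_profile_smooth)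

lemma radial_profile_deriv:
  assumes s: "s > 0"
  shows "((\<lambda>t. t powr a * smooth_step (t / s\<^sup>2)) has_real_derivative
     a * t powr (a - 1) * smooth_step (t / s\<^sup>2) + t powr a * step_deriv (t / s\<^sup>2) / s\<^sup>2) (at t)"
proof (cases "t > 0")
  case True
  have "((\<lambda>t. smooth_step (t / s\<^sup>2)) has_real_derivative step_deriv (t / s\<^sup>2) * (1 / s\<^sup>2)) (at t)"
  proof (rule DERIV_chain2[OF smooth_step_deriv])
    show "((\<lambda>t. t / s\<^sup>2) has_real_derivative 1 / s\<^sup>2) (at t)"
      by (rule DERIV_cdivide) (rule DERIV_ident)
  qed
  with True show ?thesis
    by (auto intro!: derivative_eq_intros)
next
  case False
  then have "t \<le> 0" by simp
  also have "0 < s\<^sup>2" using s by simp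
  finally have t: "t < s\<^sup>2" .
  then have t': "t / s\<^sup>2 \<le> 1" using s by (simp add: divide_le_eq)
  have "((\<lambda>_. 0) has_real_derivative 0) (at t)" by simp
  then have "((\<lambda>t. t powr a * smooth_step (t / s\<^sup>2)) has_real_derivative 0) (at t)"
    by (rule has_field_derivative_transform_within_open[of _ _ _ "{..<s\<^sup>2}"])
       (use t s in \<open>auto simp: smooth_step_eq_0 field_simps\<close>)
  with t' show ?thesis by (simp add: smooth_step_eq_0 step_deriv_eq_0)
qed

lemma sum_partial_deriv_newton:
  fixes x :: "real ^ 'n::finite"
  assumes s: "s > 0"
  shows "(\<Sum>j\<in>UNIV. partial_deriv j (newton s j) x) = source s x"
proof -
  define a where "a = - (real CARD('n) / 2)"
  define w where "w = (\<lambda>t. t powr a * smooth_step (t / s\<^sup>2))"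
  define w' where "w' = a * (x \<bullet> x) powr (a - 1) * smooth_step ((x \<bullet> x) / s\<^sup>2)
      + (x \<bullet> x) powr a * step_deriv ((x \<bullet> x) / s\<^sup>2) / s\<^sup>2"
  have w': "(w has_real_derivative w') (at (x \<bullet> x))"
    unfolding w_def w'_def by (rule radial_profile_deriv[OF s])
  have c: "((\<lambda>x. x $ j) has_derivative (\<lambda>v. v $ j)) (at x)" for j
    by (intro bounded_linear.has_derivative[OF bounded_linear_vec_nth] derivative_intros)
  have "partial_deriv j (newton s j) x = x $ j * (2 * x $ j * w') + w (x \<bullet> x)" for j
  proof -
    have "newton s j = (\<lambda>x. x $ j * w (x \<bullet> x))"
      by (auto simp: newton_def w_def a_def)
    then show ?thesis
      using partial_deriv_eqI[OF has_derivative_mult[OF c has_derivative_radial[OF w']], of j j]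
      by (simp add: inner_axis)
  qed
  then have "(\<Sum>j\<in>UNIV. partial_deriv j (newton s j) x)
      = (\<Sum>j\<in>UNIV. 2 * w' * (x $ j * x $ j) + w (x \<bullet> x))"
    by (simp add: mult_ac)
  also have "\<dots> = 2 * w' * (x \<bullet> x) + real CARD('n) * w (x \<bullet> x)"
    by (simp add: sum.distrib inner_vec_def sum_distrib_left)
  also have "\<dots> = source s x"
  proof (cases "x = 0")
    case False
    then have t: "x \<bullet> x > 0" by simp
    have pw: "t powr (b - 1) * t = t powr b" if "t > 0" for b t :: real
      using that powr_add[of t "b - 1" 1] by simp
    have "2 * w' * (x \<bullet> x) = 2 * a * ((x \<bullet> x) powr (a - 1) * (x \<bullet> x)) * smooth_step ((x \<bullet> x) / s\<^sup>2)
      + 2 * ((x \<bullet> x) powr (a + 1 - 1) * (x \<bullet> x)) * step_deriv ((x \<bullet> x) / s\<^sup>2) / s\<^sup>2"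
      by (simp add: w'_def algebra_simps)
    also have "\<dots> = 2 * a * w (x \<bullet> x) + source s x"
      unfolding pw[OF t] by (simp add: w_def source_def a_def)
    finally show ?thesis by (simp add: a_def)
  qed (simp add: w_def w'_def source_def smooth_step_eq_0 step_deriv_eq_0)
  finally show ?thesis .
qed

text \<open>
  The bound does not depend on the two scales; this is what makes the limit \<open>\<epsilon> \<rightarrow> 0\<close>, \<open>M \<rightarrow> \<infinity>\<close> possible.
\<close>

lemma abs_newton_diff_le:
  fixes x :: "real ^ 'n::finite"
  assumes "0 < \<epsilon>" "\<epsilon> \<le> M"
  shows "\<bar>newton \<epsilon> j x - newton M j x\<bar> \<le> smooth_step 2 * norm x powr (1 - real CARD('n))"
proof (cases "x = 0")
  case False
  let ?g = "smooth_step ((x \<bullet> x) / \<epsilon>\<^sup>2) - smooth_step ((x \<bullet> x) / M\<^sup>2)"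
  have "(x \<bullet> x) / M\<^sup>2 \<le> (x \<bullet> x) / \<epsilon>\<^sup>2"
    using assms by (intro divide_left_mono power_mono mult_pos_pos) auto
  then have g: "0 \<le> ?g" "?g \<le> smooth_step 2"
    using smooth_step_mono smooth_step_bounds(1)[of "(x \<bullet> x) / M\<^sup>2"]
      smooth_step_bounds(2)[of "(x \<bullet> x) / \<epsilon>\<^sup>2"] by (auto simp: algebra_simps)
  have "newton \<epsilon> j x - newton M j x = x $ j * (x \<bullet> x) powr (- (real CARD('n) / 2)) * ?g"
    by (simp add: newton_def algebra_simps)
  then have "\<bar>newton \<epsilon> j x - newton M j x\<bar> = \<bar>x $ j\<bar> * (x \<bullet> x) powr (- (real CARD('n) / 2)) * ?g"
    using g by (simp add: abs_mult)
  also have "\<dots> \<le> norm x * (x \<bullet> x) powr (- (real CARD('n) / 2)) * smooth_step 2"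
    using g by (intro mult_mono component_le_norm_cart) auto
  also have "(x \<bullet> x) powr (- (real CARD('n) / 2)) = norm x powr (- real CARD('n))"
    by (simp add: inner_self_powr)
  also have "norm x * norm x powr (- real CARD('n)) = norm x powr (1 - real CARD('n))"
    using False powr_add[of "norm x" 1 "- real CARD('n)"] by simp
  finally show ?thesis by (simp add: mult.commute)
qed (simp add: newton_def)

lemma newton_diff_eq_0:
  fixes x :: "real ^ 'n::finite"
  assumes "0 < \<epsilon>" "\<epsilon> \<le> M" "norm x \<ge> 2 * M"
  shows "newton \<epsilon> j x - newton M j x = 0"
proof -
  have "x \<bullet> x = (norm x)\<^sup>2" by (simp add: power2_norm_eq_inner)
  also have "\<dots> \<ge> (2 * M)\<^sup>2" using assms by (intro power_mono) auto
  finally have x: "x \<bullet> x \<ge> 4 * M\<^sup>2" by (simp add: power_mult_distrib)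
  have M: "\<epsilon>\<^sup>2 \<le> M\<^sup>2" "0 < \<epsilon>\<^sup>2" "0 < M\<^sup>2" using assms by (auto intro: power_mono)
  then have "2 * \<epsilon>\<^sup>2 \<le> x \<bullet> x" "2 * M\<^sup>2 \<le> x \<bullet> x" using x by linarith+
  with M have "(x \<bullet> x) / \<epsilon>\<^sup>2 \<ge> 2" "(x \<bullet> x) / M\<^sup>2 \<ge> 2"
    by (auto simp: le_divide_eq)
  then show ?thesis by (simp add: newton_def smooth_step_eq_2[of "(x \<bullet> x) / _"])
qed

lemma source_nonneg: "source s x \<ge> 0"
  by (simp add: source_def step_deriv_bounds)

lemma source_continuous:
  assumes "s > 0" shows "continuous_on S (source s :: real ^ 'n::finite \<Rightarrow> real)"
proof -
  have "continuous_on UNIV (\<lambda>x::real ^ 'n. \<Sum>j\<in>UNIV. partial_deriv j (newton s j) x)"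
    using Ck_newton[OF assms, where k = "Suc 0"] by (intro continuous_on_sum) auto
  then show ?thesis
    using continuous_on_subset by (auto simp: sum_partial_deriv_newton[OF assms])
qed

lemma source_measurable [measurable]: "s > 0 \<Longrightarrow> source s \<in> borel_measurable borel"
  by (intro borel_measurable_continuous_onI source_continuous)

lemma source_eq_0:
  fixes x :: "real ^ 'n::finite"
  assumes "s > 0" "norm x \<le> s \<or> norm x \<ge> 2 * s"
  shows "source s x = 0"
proof -
  have x: "x \<bullet> x = (norm x)\<^sup>2" by (simp add: power2_norm_eq_inner)
  have "(norm x)\<^sup>2 \<le> s\<^sup>2 \<or> (norm x)\<^sup>2 \<ge> (2 * s)\<^sup>2"
    using assms power_mono[of "norm x" s 2] power_mono[of "2 * s" "norm x" 2] by auto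
  then have "(x \<bullet> x) / s\<^sup>2 \<le> 1 \<or> (x \<bullet> x) / s\<^sup>2 \<ge> 2"
  proof
    assume "(2 * s)\<^sup>2 \<le> (norm x)\<^sup>2"
    moreover have "2 * s\<^sup>2 \<le> (2 * s)\<^sup>2" by (simp add: power_mult_distrib)
    ultimately have "2 * s\<^sup>2 \<le> (norm x)\<^sup>2" by linarith
    then show ?thesis using assms(1) unfolding x by (simp add: le_divide_eq)
  qed (use assms(1) in \<open>simp add: x divide_le_eq\<close>)
  then show ?thesis by (auto simp: source_def step_deriv_eq_0)
qed

text \<open>
  The gain of a factor \<open>1 / s\<close> over the far kernel makes the contribution of large scales vanish in the limit.
\<close>

lemma source_le_far_kernel:
  fixes x :: "real ^ 'n::finite"
  assumes s: "s > 0"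
  shows "source s x \<le> 8 / s * far_kernel s x"
proof (cases "norm x \<le> s \<or> norm x \<ge> 2 * s")
  case True
  then show ?thesis using source_eq_0[OF s True] s kernel_nonneg(2)[of s x] by simp
next
  case False
  then have x: "s < norm x" "norm x < 2 * s" by auto
  have "(x \<bullet> x) powr (1 - real CARD('n) / 2) = norm x powr (2 - real CARD('n))"
    by (simp add: inner_self_powr algebra_simps)
  then have "source s x = 2 * norm x powr (2 - real CARD('n)) * step_deriv ((x \<bullet> x) / s\<^sup>2) / s\<^sup>2"
    by (simp add: source_def)
  also have "\<dots> \<le> 2 * norm x powr (2 - real CARD('n)) * 1 / s\<^sup>2"
    by (intro divide_right_mono mult_left_mono step_deriv_bounds) auto
  also have "norm x powr (2 - real CARD('n)) = norm x * norm x powr (1 - real CARD('n))"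
    using x s powr_add[of "norm x" 1 "1 - real CARD('n)"] by simp
  also have "2 * (norm x * norm x powr (1 - real CARD('n))) * 1 / s\<^sup>2
      \<le> 2 * (2 * s * norm x powr (1 - real CARD('n))) * 1 / s\<^sup>2"
    using x s by (intro divide_right_mono mult_right_mono mult_left_mono) auto
  also have "\<dots> = 4 / s * norm x powr (1 - real CARD('n))"
    using s by (simp add: power2_eq_square field_simps)
  also have "\<dots> \<le> 8 / s * norm x powr (1 - real CARD('n))"
    using s by (intro mult_right_mono divide_right_mono) auto
  finally show ?thesis using x by (simp add: far_kernel_def)
qed

text \<open>
  The integral of \<open>source s\<close>, which is the same positive number for all \<open>s\<close>; it depends on the dimension only.
\<close>

definition source_mass :: "'n::finite itself \<Rightarrow> real" where
  "source_mass _ = enn2real (\<integral>\<^sup>+ x. ennreal (source 1 (x::real ^ 'n)) \<partial>lborel)"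

lemma nn_integral_source:
  assumes s: "s > 0"
  shows "(\<integral>\<^sup>+ x. ennreal (source s (x::real ^ 'n::finite)) \<partial>lborel) = ennreal (source_mass TYPE('n))"
    and "source_mass TYPE('n) > 0"
proof -
  let ?I = "\<integral>\<^sup>+ x. ennreal (source 1 (x::real ^ 'n)) \<partial>lborel"
  have "source 1 \<in> (Cc :: (real ^ 'n \<Rightarrow> real) set)"
    unfolding Cc_def
  proof (intro CollectI conjI source_continuous)
    have "{x :: real ^ 'n. source 1 x \<noteq> 0} \<subseteq> cball 0 2"
      using source_eq_0[of 1] by force
    then show "bounded {x :: real ^ 'n. source 1 x \<noteq> 0}"
      using bounded_subset bounded_cball by blast
  qed simp
  then have "integrable lborel (source 1 :: real ^ 'n \<Rightarrow> real)" by (rule Cc_integrable)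
  then have fin: "?I < \<infinity>"
    by (simp add: integrable_iff_bounded source_nonneg)
  then have I: "?I = ennreal (source_mass TYPE('n))"
    by (simp add: source_mass_def less_top)
  have "?I \<noteq> 0"
  proof
    assume "?I = 0"
    then have ae: "AE x in lborel. ennreal (source 1 (x::real ^ 'n)) = 0"
      by (subst (asm) nn_integral_0_iff_AE) auto
    \<comment> \<open>On this open shell the source is positive.\<close>
    let ?U = "{x :: real ^ 'n. 1 < x \<bullet> x \<and> x \<bullet> x < 2}"
    have pos: "source 1 x > 0" if "x \<in> ?U" for x
      using that step_deriv_pos[of "x \<bullet> x"] by (auto simp: source_def intro!: mult_pos_pos)
    have op: "open ?U" by (intro open_Collect_conj open_Collect_less continuous_intros)
    have "AE x in lborel. x \<notin> ?U"
      using ae pos by (auto elim!: eventually_mono simp: ennreal_eq_0_iff not_less[symmetric])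
    then have "emeasure lborel ?U = 0"
      using op by (subst (asm) AE_iff_measurable[of ?U]) auto
    then have "negligible ?U"
      using op by (simp add: negligible_iff_null_sets null_sets_completionI null_setsI)
    moreover have "axis undefined (sqrt (3 / 2)) \<in> ?U"
      by (simp add: inner_axis_axis)
    ultimately show False using open_not_negligible[OF op] by blast
  qed
  then show "source_mass TYPE('n) > 0" using I by (simp add: ennreal_eq_0_iff not_le)
  have scale: "source s (s *\<^sub>R x) = s powr (- real CARD('n)) * source 1 x" for x :: "real ^ 'n"
  proof -
    have "(s * s) powr (1 - real CARD('n) / 2) / s\<^sup>2 = s powr (- real CARD('n))"
    proof -
      have "s * s = s powr 2" using s by (simp add: power2_eq_square)
      then have "(s * s) powr (1 - real CARD('n) / 2) / s\<^sup>2 = s powr (2 - real CARD('n)) / s powr 2"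
        using s by (simp only: powr_powr) (simp add: algebra_simps)
      also have "\<dots> = s powr (- real CARD('n))" by (simp flip: powr_diff)
      finally show ?thesis .
    qed
    moreover have "(s * (s * (x \<bullet> x))) = (s * s) * (x \<bullet> x)" by simp
    ultimately show ?thesis
      using s by (simp add: source_def powr_mult power2_eq_square field_simps)
  qed
  have "(\<integral>\<^sup>+ x. ennreal (source s (x::real ^ 'n)) \<partial>lborel)
      = ennreal (s ^ CARD('n)) * (\<integral>\<^sup>+ x. ennreal (source s (s *\<^sub>R (x::real ^ 'n))) \<partial>lborel)"
    using s nn_integral_lborel_affine[of "\<lambda>x::real ^ 'n. ennreal (source s x)" s 0] by simp
  also have "\<dots> = ennreal (s ^ CARD('n)) * (ennreal (s powr (- real CARD('n))) * ?I)"
    unfolding scale using s by (simp add: ennreal_mult source_nonneg nn_integral_cmult)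
  also have "\<dots> = ?I"
    using s by (simp add: powr_minus powr_realpow field_simps flip: mult.assoc ennreal_mult)
  finally show "(\<integral>\<^sup>+ x. ennreal (source s (x::real ^ 'n)) \<partial>lborel) = ennreal (source_mass TYPE('n))"
    by (simp add: I)
qed

section \<open>Test fields with prescribed divergence\<close>

lemma conv_diff:
  assumes "h \<in> Cc" "continuous_on UNIV g1" "continuous_on UNIV g2"
  shows "conv h (\<lambda>z. g1 z - g2 z) x = conv h g1 x - conv h g2 x"
  using conv_integrable[OF assms(1,2)] conv_integrable[OF assms(1,3)]
  by (simp add: conv_def right_diff_distrib)

lemma conv_sum:
  assumes "h \<in> Cc" "\<And>i. i \<in> I \<Longrightarrow> continuous_on UNIV (g i)"
  shows "conv h (\<lambda>z. \<Sum>i\<in>I. g i z) x = (\<Sum>i\<in>I. conv h (g i) x)"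
  using conv_integrable[OF assms] by (simp add: conv_def sum_distrib_left)

lemma conv_eq_0:
  fixes h g :: "'a::euclidean_space \<Rightarrow> real"
  assumes "\<And>y. norm y > r \<Longrightarrow> h y = 0" "\<And>z. norm z \<ge> R \<Longrightarrow> g z = 0" "norm x > r + R"
  shows "conv h g x = 0"
proof -
  have "h y * g (x - y) = 0" for y
  proof (cases "norm y > r")
    case False
    then have "norm (x - y) \<ge> R" using norm_triangle_ineq2[of x y] assms(3) by linarith
    then show ?thesis by (simp add: assms)
  qed (simp add: assms)
  then have "(\<lambda>y. h y * g (x - y)) = (\<lambda>_. 0)" by blast
  then show ?thesis by (simp add: conv_def)
qed

lemma Cc_obtain_radius:
  assumes "h \<in> Cc"
  obtains r where "r > 0" "\<And>y. norm y > r \<Longrightarrow> h y = 0"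
proof -
  from assms have "bounded {x. h x \<noteq> 0}" by (simp add: Cc_def)
  then obtain r where "r > 0" "\<And>x. x \<in> {x. h x \<noteq> 0} \<Longrightarrow> norm x \<le> r"
    by (auto simp: bounded_pos)
  then show ?thesis by (intro that[of r]) force+
qed

lemma Cc_obtain_bound:
  assumes "h \<in> Cc"
  obtains S where "S > 0" "\<And>y. \<bar>h y\<bar> \<le> S"
proof -
  obtain r where r: "r > 0" "\<And>y. norm y > r \<Longrightarrow> h y = 0" using Cc_obtain_radius[OF assms] by blast
  have "compact (h ` cball 0 r)"
    using assms by (intro compact_continuous_image) (auto simp: Cc_def intro: continuous_on_subset)
  then obtain S where S: "S > 0" "\<And>y. y \<in> cball 0 r \<Longrightarrow> \<bar>h y\<bar> \<le> S"
    using compact_imp_bounded[of "h ` cball 0 r"] by (auto simp: bounded_pos)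
  have "\<bar>h y\<bar> \<le> S" for y
    using S r(2)[of y] by (cases "norm y > r") auto
  with S show ?thesis by (intro that)
qed

lemma Cc_measurable: "h \<in> Cc \<Longrightarrow> h \<in> borel_measurable borel"
  by (auto simp: Cc_def intro: borel_measurable_continuous_onI)

lemma abs_conv_le_nn_integral:
  fixes h g :: "'a::euclidean_space \<Rightarrow> real"
  assumes "h \<in> Cc" "continuous_on UNIV g"
  shows "ennreal \<bar>conv h g x\<bar> \<le> (\<integral>\<^sup>+ y. ennreal \<bar>h y\<bar> * ennreal \<bar>g (x - y)\<bar> \<partial>lborel)"
proof -
  have "ennreal \<bar>conv h g x\<bar> \<le> (\<integral>\<^sup>+ y. ennreal (norm (h y * g (x - y))) \<partial>lborel)"
    using integral_norm_bound_ennreal[OF conv_integrable[OF assms, of x]] by (simp add: conv_def)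
  then show ?thesis by (simp add: abs_mult ennreal_mult)
qed

text \<open>
  The convolution of \<open>h\<close> with the difference of two smoothed Newton kernels. The kernels agree far from the
  origin, so the difference is smooth with compact support and the result is a test field.
\<close>

definition solution_field :: "real \<Rightarrow> real \<Rightarrow> (real ^ 'n \<Rightarrow> real) \<Rightarrow> real ^ 'n::finite \<Rightarrow> real ^ 'n" where
  "solution_field \<epsilon> M h x = (\<chi> j. conv h (\<lambda>z. newton \<epsilon> j z - newton M j z) x)"

lemma Ck_newton_diff:
  assumes "0 < \<epsilon>" "0 < M"
  shows "Ck k (\<lambda>z::real ^ 'n::finite. newton \<epsilon> j z - newton M j z)"
proof -
  have "Ck k (\<lambda>z::real ^ 'n. newton \<epsilon> j z + (- 1) * newton M j z)"
    by (intro Ck_add Ck_mult Ck_const Ck_newton assms)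
  then show ?thesis by simp
qed

lemma Ck_solution_field:
  assumes "h \<in> Cc" "0 < \<epsilon>" "0 < M"
  shows "Ck k (solution_field \<epsilon> M h)"
  by (intro Ck_vec) (simp add: solution_field_def Ck_conv[OF assms(1)] Ck_newton_diff assms)

lemma solution_field_test_field:
  assumes h: "h \<in> Cc" and M: "0 < \<epsilon>" "\<epsilon> \<le> M"
  shows "solution_field \<epsilon> M h \<in> test_fields"
proof -
  obtain r where r: "r > 0" "\<And>y. norm y > r \<Longrightarrow> h y = 0" using Cc_obtain_radius[OF h] by blast
  have "{x. solution_field \<epsilon> M h x \<noteq> 0} \<subseteq> cball 0 (r + 2 * M)"
  proof
    fix x assume "x \<in> {x. solution_field \<epsilon> M h x \<noteq> 0}"
    then obtain j where "conv h (\<lambda>z. newton \<epsilon> j z - newton M j z) x \<noteq> 0"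
      by (auto simp: solution_field_def vec_eq_iff)
    then have "\<not> norm x > r + 2 * M"
      using conv_eq_0[of r h "2 * M" "\<lambda>z. newton \<epsilon> j z - newton M j z" x]
        r(2) newton_diff_eq_0[OF M, where j = j] by blast
    then show "x \<in> cball 0 (r + 2 * M)" by simp
  qed
  then have "bounded {x. solution_field \<epsilon> M h x \<noteq> 0}"
    using bounded_subset bounded_cball by blast
  then show ?thesis
    using Ck_solution_field[OF h] M by (simp add: test_fields_def compact_closure)
qed

lemma divergence_solution_field:
  assumes h: "h \<in> Cc" and M: "0 < \<epsilon>" "0 < M"
  shows "divergence (solution_field \<epsilon> M h) x = conv h (source \<epsilon>) x - conv h (source M) x"
proof -
  have d: "solution_field \<epsilon> M h differentiable (at x)"
    using Ck_solution_field[OF h M, of "Suc 0"] by simp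
  let ?K = "\<lambda>j z. newton \<epsilon> j z - newton M j z"
  have c: "continuous_on UNIV (partial_deriv j (?K j))" for j
    using Ck_newton_diff[OF M, of "Suc 0" j] by simp
  have "divergence (solution_field \<epsilon> M h) x = (\<Sum>j\<in>UNIV. conv h (partial_deriv j (?K j)) x)"
    using partial_deriv_vec_nth[OF d] conv_partial_deriv(2)[OF h Ck_newton_diff[OF M, of "Suc 0"]]
    by (simp add: divergence_def solution_field_def)
  also have "\<dots> = conv h (\<lambda>z. \<Sum>j\<in>UNIV. partial_deriv j (?K j) z) x"
    by (rule conv_sum[OF h c, symmetric])
  also have "(\<lambda>z. \<Sum>j\<in>UNIV. partial_deriv j (?K j) z) = (\<lambda>z. source \<epsilon> z - source M z)"
  proof
    fix z
    have "partial_deriv j (?K j) z = partial_deriv j (newton \<epsilon> j) z - partial_deriv j (newton M j) z" for j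
      using Ck_newton[OF M(1), of "Suc 0" j] Ck_newton[OF M(2), of "Suc 0" j]
      by (subst partial_deriv_eqI[OF has_derivative_diff])
         (auto simp: partial_deriv_def frechet_derivative_works)
    then show "(\<Sum>j\<in>UNIV. partial_deriv j (?K j) z) = source \<epsilon> z - source M z"
      by (simp add: sum_subtractf sum_partial_deriv_newton M)
  qed
  also have "conv h \<dots> x = conv h (source \<epsilon>) x - conv h (source M) x"
    by (intro conv_diff h source_continuous M)
  finally show ?thesis .
qed

text \<open>
  Young's inequality with the source in \<open>L\<^sup>1\<close>; used for the divergence.
\<close>

lemma conv_source_qnorm_le:
  fixes h :: "real ^ 'n::finite \<Rightarrow> real"
  assumes p: "p \<ge> 1" and h: "h \<in> Cc" and H: "qnorm_le p h H" "0 \<le> H" and s: "s > 0"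
  shows "qnorm_le p (conv h (source s)) (source_mass TYPE('n) * H)"
proof (rule qnorm_le_convolution[OF p])
  have [measurable]: "h \<in> borel_measurable borel" by (rule Cc_measurable[OF h])
  show "qnorm_le p (\<lambda>y. \<bar>h y\<bar>) H"
    using H by (auto simp: qnorm_le_def)
  show "(\<integral>\<^sup>+ y. ennreal (source s (y::real ^ 'n)) \<partial>lborel) \<le> ennreal (source_mass TYPE('n))"
    using nn_integral_source(1)[OF s, where 'n = 'n] by simp
  show "0 \<le> source_mass TYPE('n)" using nn_integral_source(2)[OF s, where 'n = 'n] by simp
  show "ennreal \<bar>conv h (source s) x\<bar> \<le> (\<integral>\<^sup>+ y. ennreal (source s (x - y)) * ennreal \<bar>h y\<bar> \<partial>lborel)" for x
    using abs_conv_le_nn_integral[OF h source_continuous[OF s], of x]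
    by (simp add: source_nonneg mult.commute)
  show "source s \<in> borel_measurable (borel :: (real ^ 'n) measure)" by (rule source_measurable[OF s])
  show "(\<lambda>y. \<bar>h y\<bar>) \<in> borel_measurable borel" by measurable
  show "0 \<le> H" by (rule H)
qed (rule source_nonneg abs_ge_zero)+

lemma conv_swap_nn:
  fixes a b :: "'a::euclidean_space \<Rightarrow> ennreal"
  assumes [measurable]: "a \<in> borel_measurable borel" "b \<in> borel_measurable borel"
  shows "(\<integral>\<^sup>+ y. a y * b (x - y) \<partial>lborel) = (\<integral>\<^sup>+ y. a (x - y) * b y \<partial>lborel)"
  using nn_integral_lborel_reflect[of "\<lambda>y. a y * b (x - y)" x] by simp

text \<open>
  Young's inequality with \<open>h\<close> in \<open>L\<^sup>1\<close> and the source in \<open>L\<^sup>q\<close>; used for the large scale.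
\<close>

lemma conv_source_far_qnorm_le:
  fixes h :: "real ^ 'n::finite \<Rightarrow> real"
  assumes p: "p \<ge> 1" and h: "h \<in> Cc" and L: "(\<integral>\<^sup>+ y. ennreal \<bar>h y\<bar> \<partial>lborel) \<le> ennreal L" "0 \<le> L"
    and s: "s > 0" and far: "qnorm_le p (far_kernel s :: real ^ 'n \<Rightarrow> real) D" "0 \<le> D"
  shows "qnorm_le p (conv h (source s)) (L * (8 / s * D))"
proof (rule qnorm_le_convolution[OF p])
  have [measurable]: "h \<in> borel_measurable borel" by (rule Cc_measurable[OF h])
  have "qnorm_le p (\<lambda>x::real ^ 'n. 8 / s * far_kernel s x) (8 / s * D)"
    using qnorm_le_scale[OF p far kernel_measurable(2), of "8 / s"] s by simp
  then show "qnorm_le p (source s :: real ^ 'n \<Rightarrow> real) (8 / s * D)"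
    by (rule qnorm_le_mono[OF p])
       (use s far source_le_far_kernel[OF s] in \<open>auto simp: source_nonneg kernel_nonneg\<close>)
  show "ennreal \<bar>conv h (source s) x\<bar> \<le> (\<integral>\<^sup>+ y. ennreal \<bar>h (x - y)\<bar> * ennreal (source s y) \<partial>lborel)" for x
    using abs_conv_le_nn_integral[OF h source_continuous[OF s], of x] s
    by (subst (asm) conv_swap_nn) (auto simp: source_nonneg)
  show "source s \<in> borel_measurable (borel :: (real ^ 'n) measure)" by (rule source_measurable[OF s])
  show "(\<lambda>y. \<bar>h y\<bar>) \<in> borel_measurable borel" by measurable
  show "0 \<le> 8 / s * D" using s far by simp
  show "(\<integral>\<^sup>+ y. ennreal \<bar>h y\<bar> \<partial>lborel) \<le> ennreal L" "0 \<le> L" by (rule L)+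
qed (rule source_nonneg abs_ge_zero)+

text \<open>
  The field is split at distance \<open>\<delta>\<close> into a near part \<open>g1\<close> and a far part \<open>g2\<close>. They are written with
  \<open>enn2real\<close>, so the proof has to check that both integrals are finite.
\<close>

lemma norm_solution_field_le:
  fixes h :: "real ^ 'n::finite \<Rightarrow> real"
  assumes h: "h \<in> Cc" and M: "0 < \<epsilon>" "\<epsilon> \<le> M" and \<delta>: "\<delta> > 0"
  defines "g1 \<equiv> \<lambda>x. enn2real (\<integral>\<^sup>+ y. ennreal (near_kernel \<delta> (x - y)) * ennreal \<bar>h y\<bar> \<partial>lborel)"
    and "g2 \<equiv> \<lambda>x. enn2real (\<integral>\<^sup>+ y. ennreal \<bar>h (x - y)\<bar> * ennreal (far_kernel \<delta> y) \<partial>lborel)"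
  shows "norm (solution_field \<epsilon> M h x) \<le> real CARD('n) * smooth_step 2 * (g1 x + g2 x)"
proof -
  have [measurable]: "h \<in> borel_measurable borel" by (rule Cc_measurable[OF h])
  obtain S where S: "S > 0" "\<And>y. \<bar>h y\<bar> \<le> S" using Cc_obtain_bound[OF h] by blast
  obtain C where C: "C > 0" "(\<integral>\<^sup>+ z. ennreal (near_kernel \<delta> (z::real ^ 'n)) \<partial>lborel) \<le> ennreal (C * \<delta>)"
    using near_kernel_bound[where 'a = "real ^ 'n"] \<delta> by blast
  have "(\<integral>\<^sup>+ y. ennreal (near_kernel \<delta> (x - y)) * ennreal \<bar>h y\<bar> \<partial>lborel)
      \<le> (\<integral>\<^sup>+ y. ennreal (near_kernel \<delta> (x - y)) * ennreal S \<partial>lborel)"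
    by (intro nn_integral_mono mult_left_mono ennreal_leI S) simp
  also have "\<dots> = (\<integral>\<^sup>+ y. ennreal (near_kernel \<delta> (x - y)) \<partial>lborel) * ennreal S"
    by (rule nn_integral_multc) measurable
  also have "(\<integral>\<^sup>+ y. ennreal (near_kernel \<delta> (x - y)) \<partial>lborel)
      = (\<integral>\<^sup>+ z. ennreal (near_kernel \<delta> (z::real ^ 'n)) \<partial>lborel)"
    by (rule nn_integral_lborel_reflect) measurable
  also have "\<dots> * ennreal S \<le> ennreal (C * \<delta>) * ennreal S" by (intro mult_right_mono C) simp
  also have "\<dots> < \<infinity>" by (simp add: ennreal_mult_less_top)
  finally have fin1: "ennreal (g1 x) = (\<integral>\<^sup>+ y. ennreal (near_kernel \<delta> (x - y)) * ennreal \<bar>h y\<bar> \<partial>lborel)"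
    by (simp add: g1_def)
  have "(\<integral>\<^sup>+ y. ennreal \<bar>h (x - y)\<bar> * ennreal (far_kernel \<delta> y) \<partial>lborel)
      \<le> (\<integral>\<^sup>+ y. ennreal \<bar>h (x - y)\<bar> * ennreal (\<delta> powr (1 - real CARD('n))) \<partial>lborel)"
    using \<delta> by (intro nn_integral_mono mult_left_mono ennreal_leI)
      (auto simp: far_kernel_def Suc_leI intro!: powr_mono2')
  also have "\<dots> = (\<integral>\<^sup>+ y. ennreal \<bar>h (x - y)\<bar> \<partial>lborel) * ennreal (\<delta> powr (1 - real CARD('n)))"
    by (rule nn_integral_multc) measurable
  also have "(\<integral>\<^sup>+ y. ennreal \<bar>h (x - y)\<bar> \<partial>lborel) = (\<integral>\<^sup>+ y. ennreal \<bar>h y\<bar> \<partial>lborel)"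
    using nn_integral_lborel_reflect[of "\<lambda>y. ennreal \<bar>h y\<bar>" x] by simp
  also have "\<dots> * ennreal (\<delta> powr (1 - real CARD('n))) < \<infinity>"
    using Cc_integrable[OF h] by (simp add: ennreal_mult_less_top integrable_iff_bounded)
  finally have fin2: "ennreal (g2 x) = (\<integral>\<^sup>+ y. ennreal \<bar>h (x - y)\<bar> * ennreal (far_kernel \<delta> y) \<partial>lborel)"
    by (simp add: g2_def)
  have "\<bar>solution_field \<epsilon> M h x $ j\<bar> \<le> smooth_step 2 * (g1 x + g2 x)" for j
  proof -
    let ?K = "\<lambda>z::real ^ 'n. newton \<epsilon> j z - newton M j z"
    have c: "continuous_on UNIV ?K"
      using Ck_imp_continuous[OF Ck_newton_diff[of \<epsilon> M 0 j]] M by simp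
    have "ennreal \<bar>solution_field \<epsilon> M h x $ j\<bar> \<le> (\<integral>\<^sup>+ y. ennreal \<bar>h y\<bar> * ennreal \<bar>?K (x - y)\<bar> \<partial>lborel)"
      using abs_conv_le_nn_integral[OF h c, of x] by (simp add: solution_field_def)
    also have "\<dots> \<le> (\<integral>\<^sup>+ y. ennreal (smooth_step 2) * (ennreal (near_kernel \<delta> (x - y)) * ennreal \<bar>h y\<bar>
        + ennreal \<bar>h y\<bar> * ennreal (far_kernel \<delta> (x - y))) \<partial>lborel)"
    proof (intro nn_integral_mono)
      fix y
      have "\<bar>?K (x - y)\<bar> \<le> smooth_step 2 * (near_kernel \<delta> (x - y) + far_kernel \<delta> (x - y))"
        using abs_newton_diff_le[OF M, of j "x - y"] by (auto simp: near_kernel_def far_kernel_def)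
      then have "\<bar>h y\<bar> * \<bar>?K (x - y)\<bar>
          \<le> \<bar>h y\<bar> * (smooth_step 2 * (near_kernel \<delta> (x - y) + far_kernel \<delta> (x - y)))"
        by (intro mult_left_mono) auto
      also have "\<dots> = smooth_step 2 * (near_kernel \<delta> (x - y) * \<bar>h y\<bar> + \<bar>h y\<bar> * far_kernel \<delta> (x - y))"
        by (simp add: algebra_simps)
      finally show "ennreal \<bar>h y\<bar> * ennreal \<bar>?K (x - y)\<bar>
        \<le> ennreal (smooth_step 2) * (ennreal (near_kernel \<delta> (x - y)) * ennreal \<bar>h y\<bar>
          + ennreal \<bar>h y\<bar> * ennreal (far_kernel \<delta> (x - y)))"
        using smooth_step_bounds(1)[of 2]
        by (simp add: kernel_nonneg ennreal_leI flip: ennreal_mult ennreal_plus)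
    qed
    also have "\<dots> = ennreal (smooth_step 2) * (ennreal (g1 x)
        + (\<integral>\<^sup>+ y. ennreal \<bar>h y\<bar> * ennreal (far_kernel \<delta> (x - y)) \<partial>lborel))"
      unfolding fin1 by (subst nn_integral_cmult, measurable, subst nn_integral_add) auto
    also have "(\<integral>\<^sup>+ y. ennreal \<bar>h y\<bar> * ennreal (far_kernel \<delta> (x - y)) \<partial>lborel) = ennreal (g2 x)"
      unfolding fin2 by (rule conv_swap_nn) measurable
    also have "ennreal (smooth_step 2) * (ennreal (g1 x) + ennreal (g2 x))
        = ennreal (smooth_step 2 * (g1 x + g2 x))"
      using smooth_step_bounds(1)[of 2] by (simp add: g1_def g2_def flip: ennreal_plus ennreal_mult)
    finally show ?thesis
      using smooth_step_bounds(1)[of 2] by (simp add: g1_def g2_def ennreal_le_iff)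
  qed
  then have "(\<Sum>j\<in>UNIV. \<bar>solution_field \<epsilon> M h x $ j\<bar>)
      \<le> (\<Sum>j\<in>(UNIV::'n set). smooth_step 2 * (g1 x + g2 x))"
    by (intro sum_mono)
  with norm_le_l1_cart[of "solution_field \<epsilon> M h x"] show ?thesis by simp
qed

text \<open>
  Young's inequality is applied twice, with the near kernel in \<open>L\<^sup>1\<close> and \<open>h\<close> in \<open>L\<^sup>q\<close>, and with the far kernel
  in \<open>L\<^sup>q\<close> and \<open>h\<close> in \<open>L\<^sup>1\<close>.
\<close>

lemma Lp_norm_solution_field_le:
  fixes h :: "real ^ 'n::finite \<Rightarrow> real"
  assumes p: "p \<ge> 1" and h: "h \<in> Cc" and M: "0 < \<epsilon>" "\<epsilon> \<le> M" and \<delta>: "\<delta> > 0"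
    and H: "qnorm_le p h H" "0 \<le> H"
    and L: "(\<integral>\<^sup>+ y. ennreal \<bar>h y\<bar> \<partial>lborel) \<le> ennreal L" "0 \<le> L"
    and near: "(\<integral>\<^sup>+ z. ennreal (near_kernel \<delta> (z::real ^ 'n)) \<partial>lborel) \<le> ennreal A" "0 \<le> A"
    and far: "qnorm_le p (far_kernel \<delta> :: real ^ 'n \<Rightarrow> real) D" "0 \<le> D"
  shows "Lp_norm (conjugate_exponent p) (solution_field \<epsilon> M h)
    \<le> ennreal (4 * real CARD('n) * smooth_step 2 * (A * H + L * D))"
proof -
  have [measurable]: "h \<in> borel_measurable borel" by (rule Cc_measurable[OF h])
  define g1 where "g1 = (\<lambda>x. enn2real (\<integral>\<^sup>+ y. ennreal (near_kernel \<delta> (x - y)) * ennreal \<bar>h y\<bar> \<partial>lborel))"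
  define g2 where "g2 = (\<lambda>x. enn2real (\<integral>\<^sup>+ y. ennreal \<bar>h (x - y)\<bar> * ennreal (far_kernel \<delta> y) \<partial>lborel))"
  have [measurable]: "g1 \<in> borel_measurable borel" "g2 \<in> borel_measurable borel"
    unfolding g1_def g2_def by measurable
  have g0: "g1 x \<ge> 0" "g2 x \<ge> 0" for x by (auto simp: g1_def g2_def)
  have enn: "ennreal (enn2real t) \<le> t" for t :: ennreal by (cases t) auto
  have "qnorm_le p g1 (A * H)"
    by (rule qnorm_le_convolution[OF p _ H(2) near, where b = "\<lambda>y. \<bar>h y\<bar>"])
       (use H in \<open>auto simp: qnorm_le_def kernel_nonneg g1_def enn\<close>)
  moreover have "qnorm_le p g2 (L * D)"
    by (rule qnorm_le_convolution[OF p far L])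
       (auto simp: kernel_nonneg g2_def enn)
  ultimately have q: "qnorm_le p (\<lambda>x. g1 x + g2 x) (4 * (A * H + L * D))"
    using H L near far by (intro qnorm_le_add[OF p, of g1 _ g2]) (auto simp: abs_triangle_ineq)
  let ?c = "real CARD('n) * smooth_step 2"
  have c: "?c \<ge> 0" using smooth_step_bounds(1)[of 2] by simp
  have "qnorm_le p (\<lambda>x. ?c * (g1 x + g2 x)) (\<bar>?c\<bar> * (4 * (A * H + L * D)))"
    using H L near far by (intro qnorm_le_scale[OF p q]) auto
  then have "Lp_norm (conjugate_exponent p) (solution_field \<epsilon> M h)
      \<le> ennreal (\<bar>?c\<bar> * (4 * (A * H + L * D)))"
  proof (rule Lp_norm_conjugate_le[OF p])
    show "0 \<le> \<bar>?c\<bar> * (4 * (A * H + L * D))" using H L near far by simp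
    show "norm (solution_field \<epsilon> M h x) \<le> \<bar>?c * (g1 x + g2 x)\<bar>" for x
      unfolding g1_def g2_def
      by (rule order_trans[OF norm_solution_field_le[OF h M \<delta>] abs_ge_self])
    show "solution_field \<epsilon> M h \<in> borel_measurable borel"
      using Ck_imp_continuous[OF Ck_solution_field[OF h, of \<epsilon> M 0]] M
      by (intro borel_measurable_continuous_onI) auto
  qed
  also have "\<bar>?c\<bar> * (4 * (A * H + L * D)) = 4 * real CARD('n) * smooth_step 2 * (A * H + L * D)"
    using c by simp
  finally show ?thesis .
qed

lemma Lp_norm_divergence_le:
  fixes h :: "real ^ 'n::finite \<Rightarrow> real"
  assumes p: "p \<ge> 1" and h: "h \<in> Cc" and M: "0 < \<epsilon>" "0 < M"
    and H: "qnorm_le p h H" "0 \<le> H"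
  shows "Lp_norm (conjugate_exponent p) (divergence (solution_field \<epsilon> M h))
    \<le> ennreal (8 * source_mass TYPE('n) * H)"
proof -
  have m: "source_mass TYPE('n) \<ge> 0" using nn_integral_source(2)[OF M(1), where 'n = 'n] by simp
  have cm [measurable]: "conv h (source s) \<in> borel_measurable borel" if "s > 0" for s
    using that by (intro borel_measurable_continuous_onI conv_continuous h source_continuous)
  let ?g = "\<lambda>x. conv h (source \<epsilon>) x - conv h (source M) x"
  have "qnorm_le p ?g (4 * (source_mass TYPE('n) * H + source_mass TYPE('n) * H))"
    using m H cm M
    by (intro qnorm_le_add[OF p conv_source_qnorm_le[OF p h H M(1)] conv_source_qnorm_le[OF p h H M(2)]]) auto
  then have "Lp_norm (conjugate_exponent p) (divergence (solution_field \<epsilon> M h))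
      \<le> ennreal (4 * (source_mass TYPE('n) * H + source_mass TYPE('n) * H))"
    using m H cm M by (intro Lp_norm_conjugate_le[OF p]) (auto simp: divergence_solution_field[OF h M, abs_def])
  then show ?thesis by (simp add: mult_ac)
qed

section \<open>A lower bound for \<open>\<sigma>\<^sub>p\<close> by pairings\<close>

lemma Lp_integrable_on_ball:
  fixes f :: "'a::euclidean_space \<Rightarrow> real"
  assumes p: "p \<ge> 1" and f: "f \<in> Lp_space (ereal p)"
  shows "integrable lebesgue (\<lambda>x. indicator (cball 0 r) x * f x)"
proof (rule integrableI_bounded)
  have [measurable]: "f \<in> borel_measurable lebesgue" using f by (simp add: Lp_space_iff)
  have b [measurable]: "cball (0::'a) r \<in> sets lebesgue" by simp
  show "(\<lambda>x. indicator (cball 0 r) x * f x) \<in> borel_measurable lebesgue" by measurable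
  have "(\<integral>\<^sup>+ x. ennreal (norm (indicator (cball 0 r) x * f x)) \<partial>lebesgue)
      \<le> (\<integral>\<^sup>+ x. indicator (cball 0 r) x + ennreal (\<bar>f x\<bar> powr p) \<partial>lebesgue)"
  proof (rule nn_integral_mono)
    fix x
    have "\<bar>f x\<bar> \<le> 1 + \<bar>f x\<bar> powr p"
    proof (cases "\<bar>f x\<bar> \<le> 1")
      case False
      then have "\<bar>f x\<bar> powr 1 \<le> \<bar>f x\<bar> powr p" using p by (intro powr_mono) auto
      with False show ?thesis by simp
    qed (simp add: add_increasing2)
    then have "ennreal \<bar>f x\<bar> \<le> 1 + ennreal (\<bar>f x\<bar> powr p)"
      by (metis abs_ge_zero ennreal_1 ennreal_leI ennreal_plus powr_ge_zero zero_le_one)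
    then show "ennreal (norm (indicator (cball 0 r) x * f x)) \<le> indicator (cball 0 r) x + ennreal (\<bar>f x\<bar> powr p)"
      by (auto simp: indicator_def)
  qed
  also have "\<dots> = emeasure lebesgue (cball (0::'a) r) + (\<integral>\<^sup>+ x. ennreal (\<bar>f x\<bar> powr p) \<partial>lebesgue)"
    by (subst nn_integral_add) (auto simp: nn_integral_indicator)
  also have "\<dots> < \<infinity>"
    using f emeasure_lborel_cball_finite[of "0::'a" r] by (simp add: Lp_space_iff)
  finally show "(\<integral>\<^sup>+ x. ennreal (norm (indicator (cball 0 r) x * f x)) \<partial>lebesgue) < \<infinity>" .
qed

lemma bounded_support_mult_Lp_integrable:
  fixes f h :: "'a::euclidean_space \<Rightarrow> real"
  assumes p: "p \<ge> 1" and f: "f \<in> Lp_space (ereal p)"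
    and h: "h \<in> borel_measurable lebesgue" "\<And>x. \<bar>h x\<bar> \<le> B" "\<And>x. norm x > r \<Longrightarrow> h x = 0"
  shows "integrable lebesgue (\<lambda>x. h x * f x)"
proof (rule Bochner_Integration.integrable_bound)
  show "integrable lebesgue (\<lambda>x. B * (indicator (cball 0 r) x * f x))"
    by (intro integrable_mult_right Lp_integrable_on_ball[OF p f])
  show "(\<lambda>x. h x * f x) \<in> borel_measurable lebesgue"
    using f h(1) by (intro borel_measurable_times) (auto simp: Lp_space_iff)
  have "B \<ge> 0" using h(2)[of 0] by linarith
  then show "AE x in lebesgue. norm (h x * f x) \<le> norm (B * (indicator (cball 0 r) x * f x))"
    using h(2,3) by (intro AE_I2) (auto simp: abs_mult indicator_def not_le intro: mult_right_mono)
qed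

lemma borel_imp_lebesgue_measurable:
  "g \<in> borel_measurable borel \<Longrightarrow> g \<in> borel_measurable lebesgue"
  by (simp add: measurable_completion)

lemma Cc_mult_Lp_integrable:
  assumes p: "p \<ge> 1" and f: "f \<in> Lp_space (ereal p)" and h: "h \<in> Cc"
  shows "integrable lebesgue (\<lambda>x. h x * f x)"
proof -
  obtain r where r: "r > 0" "\<And>y. norm y > r \<Longrightarrow> h y = 0" using Cc_obtain_radius[OF h] by blast
  obtain S where S: "S > 0" "\<And>y. \<bar>h y\<bar> \<le> S" using Cc_obtain_bound[OF h] by blast
  show ?thesis
    using bounded_support_mult_Lp_integrable[OF p f borel_imp_lebesgue_measurable[OF Cc_measurable[OF h]] S(2) r(2)] .
qed

lemma conv_source_Cc:
  assumes h: "h \<in> Cc" and s: "s > 0"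
  shows "conv h (source s) \<in> Cc"
proof -
  obtain r where r: "r > 0" "\<And>y. norm y > r \<Longrightarrow> h y = 0" using Cc_obtain_radius[OF h] by blast
  have "{x. conv h (source s) x \<noteq> 0} \<subseteq> cball 0 (r + 2 * s)"
    using conv_eq_0[of r h "2 * s" "source s"] r(2) source_eq_0[OF s] by (force simp: not_le)
  then have "bounded {x. conv h (source s) x \<noteq> 0}" using bounded_subset bounded_cball by blast
  then show ?thesis by (simp add: Cc_def conv_continuous[OF h source_continuous[OF s]])
qed

lemma source_integral:
  assumes s: "s > 0"
  shows "integrable lborel (\<lambda>y. source s (x - y) :: real)"
    "(\<integral>y. source s ((x::real ^ 'n::finite) - y) \<partial>lborel) = source_mass TYPE('n)"
proof -
  have [measurable]: "source s \<in> borel_measurable (borel :: (real ^ 'n) measure)"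
    by (rule source_measurable[OF s])
  have *: "(\<integral>\<^sup>+ y. ennreal (source s (x - y)) \<partial>lborel) = ennreal (source_mass TYPE('n))"
    using nn_integral_lborel_reflect[of "\<lambda>y. ennreal (source s y)" x] nn_integral_source(1)[OF s, where 'n = 'n]
    by simp
  show "integrable lborel (\<lambda>y. source s (x - y))"
    using * by (intro integrableI_bounded) (auto simp: source_nonneg)
  show "(\<integral>y. source s (x - y) \<partial>lborel) = source_mass TYPE('n)"
    using nn_integral_source(2)[OF s, where 'n = 'n] *
    by (subst integral_eq_nn_integral) (auto simp: source_nonneg)
qed

text \<open>
  The sources at small scales are an approximate identity, up to the factor \<open>source_mass\<close>.
\<close>

lemma conv_source_tendsto:
  fixes h :: "real ^ 'n::finite \<Rightarrow> real"
  assumes h: "h \<in> Cc"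
  shows "(\<lambda>k. conv h (source (1 / real (Suc k))) x) \<longlonglongrightarrow> source_mass TYPE('n) * h x"
proof (rule LIMSEQ_I)
  fix e :: real assume e: "e > 0"
  define m where "m = source_mass TYPE('n)"
  have m: "m > 0" using nn_integral_source(2)[OF zero_less_one, where 'n = 'n] by (simp add: m_def)
  have "isCont h x" using h by (simp add: Cc_def continuous_on_eq_continuous_at)
  then obtain d where d: "d > 0" "\<And>y. dist y x < d \<Longrightarrow> dist (h y) (h x) < e / (2 * m)"
    using e m unfolding continuous_at_eps_delta by (metis divide_pos_pos mult_pos_pos zero_less_numeral)
  obtain k0 where k0: "1 / real (Suc k0) < d / 2" using d(1) nat_approx_posE[of "d / 2"] by auto
  show "\<exists>k0. \<forall>k\<ge>k0. norm (conv h (source (1 / real (Suc k))) x - source_mass TYPE('n) * h x) < e"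
  proof (intro exI allI impI)
    fix k assume k: "k \<ge> k0"
    define s where "s = 1 / real (Suc k)"
    have s: "s > 0" by (simp add: s_def)
    have "s \<le> 1 / real (Suc k0)" unfolding s_def using k by (intro divide_left_mono) auto
    with k0 have sd: "2 * s < d" by simp
    have i1: "integrable lborel (\<lambda>y. h y * source s (x - y))"
      by (rule conv_integrable[OF h source_continuous[OF s]])
    have i2: "integrable lborel (\<lambda>y. h x * source s (x - y))"
      by (intro integrable_mult_right source_integral(1)[OF s])
    have "conv h (source s) x - m * h x = (\<integral>y. (h y - h x) * source s (x - y) \<partial>lborel)"
      using i1 i2 source_integral(2)[OF s, of x]
      by (simp add: conv_def left_diff_distrib m_def mult.commute)
    also have "norm \<dots> \<le> (\<integral>y. e / (2 * m) * source s (x - y) \<partial>lborel)"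
    proof (rule Bochner_Integration.integral_norm_bound_integral)
      show "integrable lborel (\<lambda>y. (h y - h x) * source s (x - y))"
        using i1 i2 by (simp add: left_diff_distrib)
      show "integrable lborel (\<lambda>y. e / (2 * m) * source s (x - y))"
        by (intro integrable_mult_right source_integral(1)[OF s])
      fix y
      show "norm ((h y - h x) * source s (x - y)) \<le> e / (2 * m) * source s (x - y)"
      proof (cases "norm (x - y) < 2 * s")
        case True
        then have "dist y x < d" using sd by (simp add: dist_norm norm_minus_commute)
        then have "\<bar>h y - h x\<bar> \<le> e / (2 * m)" using d(2)[of y] by (simp add: dist_real_def)
        from mult_right_mono[OF this source_nonneg[of s "x - y"]] show ?thesis
          by (simp add: abs_mult source_nonneg)
      next
        case False
        then have "source s (x - y) = 0" using source_eq_0[OF s, of "x - y"] by linarith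
        then show ?thesis by simp
      qed
    qed
    also have "\<dots> = e / 2"
      using m source_integral(2)[OF s, of x] by (simp add: m_def)
    finally show "norm (conv h (source (1 / real (Suc k))) x - source_mass TYPE('n) * h x) < e"
      using e by (simp add: s_def m_def)
  qed
qed

lemma abs_conv_source_le:
  fixes h :: "real ^ 'n::finite \<Rightarrow> real"
  assumes h: "h \<in> Cc" and S: "\<And>y. \<bar>h y\<bar> \<le> S" and s: "s > 0"
  shows "\<bar>conv h (source s) x\<bar> \<le> S * source_mass TYPE('n)"
proof -
  have "norm (conv h (source s) x) \<le> (\<integral>y. S * source s (x - y) \<partial>lborel)"
    unfolding conv_def
  proof (rule Bochner_Integration.integral_norm_bound_integral)
    show "integrable lborel (\<lambda>y. h y * source s (x - y))"
      by (rule conv_integrable[OF h source_continuous[OF s]])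
    show "integrable lborel (\<lambda>y. S * source s (x - y))"
      by (intro integrable_mult_right source_integral(1)[OF s])
    show "norm (h y * source s (x - y)) \<le> S * source s (x - y)" for y
      using mult_right_mono[OF S[of y] source_nonneg[of s "x - y"]] by (simp add: abs_mult source_nonneg)
  qed
  then show ?thesis using source_integral(2)[OF s, of x] by simp
qed

lemma pairing_conv_source_tendsto:
  fixes h f :: "real ^ 'n::finite \<Rightarrow> real"
  assumes p: "p \<ge> 1" and f: "f \<in> Lp_space (ereal p)" and h: "h \<in> Cc"
  shows "(\<lambda>k. \<integral>x. conv h (source (1 / real (Suc k))) x * f x \<partial>lebesgue)
     \<longlonglongrightarrow> source_mass TYPE('n) * (\<integral>x. h x * f x \<partial>lebesgue)"
proof -
  obtain r where r: "r > 0" "\<And>y. norm y > r \<Longrightarrow> h y = 0" using Cc_obtain_radius[OF h] by blast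
  obtain S where S: "S > 0" "\<And>y. \<bar>h y\<bar> \<le> S" using Cc_obtain_bound[OF h] by blast
  define m where "m = source_mass TYPE('n)"
  have m: "m > 0" using nn_integral_source(2)[OF zero_less_one, where 'n = 'n] by (simp add: m_def)
  have s: "1 / real (Suc k) > 0" "1 / real (Suc k) \<le> 1" for k by auto
  have "(\<lambda>k. \<integral>x. conv h (source (1 / real (Suc k))) x * f x \<partial>lebesgue)
     \<longlonglongrightarrow> (\<integral>x. m * h x * f x \<partial>lebesgue)"
  proof (rule integral_dominated_convergence)
    show "integrable lebesgue (\<lambda>x. norm (S * m * (indicator (cball 0 (r + 2)) x * f x)))"
      by (intro integrable_norm integrable_mult_right Lp_integrable_on_ball[OF p f])
    show "(\<lambda>x. m * h x * f x) \<in> borel_measurable lebesgue"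
      using Cc_mult_Lp_integrable[OF p f h, THEN borel_measurable_integrable] by (simp add: mult.assoc)
    show "(\<lambda>x. conv h (source (1 / real (Suc k))) x * f x) \<in> borel_measurable lebesgue" for k
      using Cc_mult_Lp_integrable[OF p f conv_source_Cc[OF h s(1)], THEN borel_measurable_integrable] .
    show "AE x in lebesgue. (\<lambda>k. conv h (source (1 / real (Suc k))) x * f x) \<longlonglongrightarrow> m * h x * f x"
      unfolding m_def by (intro AE_I2 tendsto_mult_right conv_source_tendsto[OF h])
    show "AE x in lebesgue. norm (conv h (source (1 / real (Suc k))) x * f x)
        \<le> norm (S * m * (indicator (cball 0 (r + 2)) x * f x))" for k
    proof (rule AE_I2)
      fix x
      show "norm (conv h (source (1 / real (Suc k))) x * f x)
        \<le> norm (S * m * (indicator (cball 0 (r + 2)) x * f x))"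
      proof (cases "norm x > r + 2")
        case True
        have "conv h (source (1 / real (Suc k))) x = 0"
        proof (rule conv_eq_0[of r h 2 "source (1 / real (Suc k))"])
          show "source (1 / real (Suc k)) z = 0" if "2 \<le> norm z" for z :: "real ^ 'n"
            by (rule source_eq_0[OF s(1)]) (use that s(2)[of k] in linarith)
        qed (use r True in auto)
        then show ?thesis by simp
      next
        case False
        have "\<bar>conv h (source (1 / real (Suc k))) x\<bar> * \<bar>f x\<bar> \<le> S * m * \<bar>f x\<bar>"
          unfolding m_def by (intro mult_right_mono abs_conv_source_le[OF h S(2) s(1)]) auto
        with False show ?thesis using S m by (simp add: abs_mult)
      qed
    qed
  qed
  then show ?thesis by (simp add: m_def mult.assoc)
qed

text \<open>
  The two bounds in \<open>small\<close> make the test fields \<open>solution_field \<epsilon> M h\<close> admissible in the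
  definition of \<open>\<sigma>\<^sub>p(f, \<delta>)\<close> for all scales \<open>\<epsilon> \<le> M\<close>.
\<close>

lemma pairing_le_sigma_p_normalized:
  fixes h f :: "real ^ 'n::finite \<Rightarrow> real"
  assumes p: "p = 1 \<or> (1 < p \<and> p < real CARD('n))" and f: "f \<in> Lp_space (ereal p)" and h: "h \<in> Cc"
    and \<delta>: "\<delta> > 0"
    and H: "qnorm_le p h H" "0 \<le> H"
    and L: "(\<integral>\<^sup>+ y. ennreal \<bar>h y\<bar> \<partial>lborel) \<le> ennreal L" "0 < L"
    and near: "(\<integral>\<^sup>+ z. ennreal (near_kernel \<delta> (z::real ^ 'n)) \<partial>lborel) \<le> ennreal A" "0 \<le> A"
    and far: "\<And>R. R > 0 \<Longrightarrow> qnorm_le p (far_kernel R :: real ^ 'n \<Rightarrow> real) (D * R powr (1 - real CARD('n) / p))"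
      "0 < D"
    and small: "8 * source_mass TYPE('n) * H \<le> 1"
      "4 * real CARD('n) * smooth_step 2 * (A * H + L * (D * \<delta> powr (1 - real CARD('n) / p))) \<le> \<delta>"
  shows "source_mass TYPE('n) * (\<integral>x. h x * f x \<partial>lebesgue) \<le> sigma_p p f \<delta>"
proof -
  have p1: "p \<ge> 1" using p by auto
  have np: "1 - real CARD('n) / p \<le> 0" using p by (auto simp: Suc_leI)
  \<comment> \<open>The scales \<open>\<epsilon>\<close> and \<open>M\<close> are sent to \<open>0\<close> and \<open>\<infinity>\<close> simultaneously.\<close>
  define \<epsilon> where "\<epsilon> = (\<lambda>k. 1 / real (Suc k))"
  define M where "M = (\<lambda>k. real (Suc k))"
  have eM: "0 < \<epsilon> k" "\<epsilon> k \<le> M k" "0 < M k" "1 \<le> M k" for k by (auto simp: \<epsilon>_def M_def divide_le_eq algebra_simps)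
  let ?I = "\<lambda>g. \<integral>x. conv h g x * f x \<partial>lebesgue"
  have up: "?I (source (\<epsilon> k)) - ?I (source (M k)) \<le> sigma_p p f \<delta>" for k
  proof -
    have "(\<integral>x. divergence (solution_field (\<epsilon> k) (M k) h) x * f x \<partial>lebesgue) \<le> sigma_p p f \<delta>"
    proof (rule sigma_p_ge[OF p1 f solution_field_test_field[OF h eM(1,2)]])
      have "Lp_norm (conjugate_exponent p) (divergence (solution_field (\<epsilon> k) (M k) h))
          \<le> ennreal (8 * source_mass TYPE('n) * H)"
        by (rule Lp_norm_divergence_le[OF p1 h eM(1,3) H])
      also have "\<dots> \<le> 1" using small(1) ennreal_leI by fastforce
      finally show "Lp_norm (conjugate_exponent p) (divergence (solution_field (\<epsilon> k) (M k) h)) \<le> 1" .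
      have "Lp_norm (conjugate_exponent p) (solution_field (\<epsilon> k) (M k) h) \<le>
          ennreal (4 * real CARD('n) * smooth_step 2 * (A * H + L * (D * \<delta> powr (1 - real CARD('n) / p))))"
        using L far(2) by (intro Lp_norm_solution_field_le[OF p1 h eM(1,2) \<delta> H L(1) _ near far(1)[OF \<delta>]]) auto
      also have "\<dots> \<le> ennreal \<delta>" by (rule ennreal_leI[OF small(2)])
      finally show "Lp_norm (conjugate_exponent p) (solution_field (\<epsilon> k) (M k) h) \<le> ennreal \<delta>" .
    qed
    also have "(\<integral>x. divergence (solution_field (\<epsilon> k) (M k) h) x * f x \<partial>lebesgue)
        = ?I (source (\<epsilon> k)) - ?I (source (M k))"
      using Cc_mult_Lp_integrable[OF p1 f conv_source_Cc[OF h eM(1)[of k]]]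
        Cc_mult_Lp_integrable[OF p1 f conv_source_Cc[OF h eM(3)[of k]]]
      by (simp add: divergence_solution_field[OF h eM(1,3)] left_diff_distrib)
    finally show ?thesis .
  qed
  have "(\<lambda>k. ?I (source (M k))) \<longlonglongrightarrow> 0"
  proof (rule Lim_null_comparison)
    show "\<forall>\<^sub>F k in sequentially. norm (?I (source (M k))) \<le> (L * (8 * D) * pairing_bound p f) * (1 / real (Suc k))"
    proof (intro always_eventually allI)
      fix k
      have "qnorm_le p (conv h (source (M k))) (L * (8 / M k * (D * M k powr (1 - real CARD('n) / p))))"
        using L far(2) by (intro conv_source_far_qnorm_le[OF p1 h L(1) _ eM(3) far(1)[OF eM(3)]]) auto
      moreover have "M k powr (1 - real CARD('n) / p) \<le> 1"
        using powr_mono[OF np eM(4), of k] eM(3)[of k] by simp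
      then have "L * (8 / M k * (D * M k powr (1 - real CARD('n) / p))) \<le> L * (8 / M k * (D * 1))"
        using L far(2) eM(3)[of k] by (intro mult_left_mono) auto
      ultimately have "qnorm_le p (conv h (source (M k))) (L * (8 / M k * (D * 1)))"
        using L far(2) eM(3)[of k] by (elim qnorm_le_mono[OF p1]) auto
      then have "\<bar>?I (source (M k))\<bar> \<le> L * (8 / M k * (D * 1)) * pairing_bound p f"
        using L far(2) eM(3)[of k] Cc_measurable[OF conv_source_Cc[OF h eM(3)]]
        by (intro qnorm_le_pairing[OF p1 f]) auto
      then show "norm (?I (source (M k))) \<le> (L * (8 * D) * pairing_bound p f) * (1 / real (Suc k))"
        by (simp add: M_def mult_ac)
    qed
    show "(\<lambda>k. (L * (8 * D) * pairing_bound p f) * (1 / real (Suc k))) \<longlonglongrightarrow> 0"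
      using tendsto_mult_right_zero[OF LIMSEQ_inverse_real_of_nat] by (simp only: inverse_eq_divide)
  qed
  then have "(\<lambda>k. ?I (source (\<epsilon> k)) - ?I (source (M k)))
      \<longlonglongrightarrow> source_mass TYPE('n) * (\<integral>x. h x * f x \<partial>lebesgue) - 0"
    unfolding \<epsilon>_def by (intro tendsto_diff pairing_conv_source_tendsto[OF p1 f h])
  then show ?thesis using up by (intro LIMSEQ_le_const2) auto
qed

text \<open>
  The key estimate: \<open>\<integral> h f \<le> C \<sigma>\<^sub>p(f, \<delta>) (\<parallel>h\<parallel>\<^sub>q + \<delta>\<^sup>-\<^sup>n\<^sup>/\<^sup>p \<parallel>h\<parallel>\<^sub>1)\<close>. It is obtained from the normalized case by dividing
  \<open>h\<close> by a multiple of the last factor.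
\<close>

lemma pairing_le_sigma_p_Cc:
  assumes p: "p = 1 \<or> (1 < p \<and> p < real CARD('n::finite))"
  obtains C where "C > 0"
    "\<And>(f :: real ^ 'n \<Rightarrow> real) h \<delta> H L. \<lbrakk>f \<in> Lp_space (ereal p); h \<in> Cc; \<delta> > 0; H > 0; L > 0; qnorm_le p h H;
        (\<integral>\<^sup>+ y. ennreal \<bar>h y\<bar> \<partial>lborel) \<le> ennreal L\<rbrakk> \<Longrightarrow>
      (\<integral>x. h x * f x \<partial>lebesgue) \<le> C * sigma_p p f \<delta> * (H + \<delta> powr (- real CARD('n) / p) * L)"
proof -
  obtain A where A: "A > 0"
      "\<And>R. R > 0 \<Longrightarrow> (\<integral>\<^sup>+ z. ennreal (near_kernel R (z::real ^ 'n)) \<partial>lborel) \<le> ennreal (A * R)"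
    using near_kernel_bound[where 'a = "real ^ 'n"] by blast
  obtain D where D: "D > 0"
      "\<And>R. R > 0 \<Longrightarrow> qnorm_le p (far_kernel R :: real ^ 'n \<Rightarrow> real) (D * R powr (1 - real CARD('n) / p))"
    using far_kernel_bound[where 'a = "real ^ 'n"] p by auto
  define m where "m = source_mass TYPE('n)"
  have m: "m > 0" using nn_integral_source(2)[OF zero_less_one, where 'n = 'n] by (simp add: m_def)
  define \<kappa> where "\<kappa> = 4 * real CARD('n) * smooth_step 2"
  have \<kappa>: "\<kappa> \<ge> 0" using smooth_step_bounds(1)[of 2] by (simp add: \<kappa>_def)
  define C0 where "C0 = 8 * m + \<kappa> * (A + D)"
  have C0: "C0 > 0" unfolding C0_def using m \<kappa> A D by (intro add_pos_nonneg mult_nonneg_nonneg) auto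
  have p1: "p \<ge> 1" using p by auto
  show ?thesis
  proof
    show "C0 / m > 0" using C0 m by simp
    fix f h :: "real ^ 'n \<Rightarrow> real" and \<delta> H L :: real
    assume f: "f \<in> Lp_space (ereal p)" and h: "h \<in> Cc" and pos: "\<delta> > 0" "H > 0" "L > 0"
      and H: "qnorm_le p h H" and L: "(\<integral>\<^sup>+ y. ennreal \<bar>h y\<bar> \<partial>lborel) \<le> ennreal L"
    define d where "d = \<delta> powr (- real CARD('n) / p)"
    have d: "d > 0" "\<delta> powr (1 - real CARD('n) / p) = \<delta> * d"
      using pos powr_add[of \<delta> 1 "- real CARD('n) / p"] by (auto simp: d_def)
    define Q where "Q = C0 * (H + d * L)"
    have Q: "Q > 0" unfolding Q_def using C0 d pos by (intro mult_pos_pos add_pos_pos) auto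
    let ?h = "\<lambda>x. (1 / Q) * h x"
    have [measurable]: "h \<in> borel_measurable borel" by (rule Cc_measurable[OF h])
    have "m * (\<integral>x. ?h x * f x \<partial>lebesgue) \<le> sigma_p p f \<delta>"
      unfolding m_def
    proof (rule pairing_le_sigma_p_normalized[OF p f _ pos(1), where H = "H / Q" and L = "L / Q" and A = "A * \<delta>" and D = D])
      show "?h \<in> Cc" using h Q by (auto simp: Cc_def intro!: continuous_intros)
      show "qnorm_le p ?h (H / Q)"
        using qnorm_le_scale[OF p1 H, of "1 / Q"] pos Q by simp
      have "(\<integral>\<^sup>+ y. ennreal \<bar>?h y\<bar> \<partial>lborel) = (\<integral>\<^sup>+ y. ennreal (1 / Q) * ennreal \<bar>h y\<bar> \<partial>lborel)"
        using Q by (simp add: abs_mult flip: ennreal_mult)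
      also have "\<dots> = ennreal (1 / Q) * (\<integral>\<^sup>+ y. ennreal \<bar>h y\<bar> \<partial>lborel)"
        by (rule nn_integral_cmult) measurable
      also have "\<dots> \<le> ennreal (1 / Q) * ennreal L" by (intro mult_left_mono L) simp
      also have "\<dots> = ennreal (L / Q)" using Q pos by (simp flip: ennreal_mult)
      finally show "(\<integral>\<^sup>+ y. ennreal \<bar>?h y\<bar> \<partial>lborel) \<le> ennreal (L / Q)" .
      show "(\<integral>\<^sup>+ z. ennreal (near_kernel \<delta> (z::real ^ 'n)) \<partial>lborel) \<le> ennreal (A * \<delta>)"
        by (rule A(2)[OF pos(1)])
      have "8 * m * H \<le> C0 * (H + d * L)"
        unfolding C0_def using m \<kappa> A D d pos by (intro mult_mono) auto
      then show "8 * source_mass TYPE('n) * (H / Q) \<le> 1"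
        using Q by (simp add: m_def[symmetric] divide_le_eq) (simp add: Q_def)
      have "\<kappa> * (A * H + D * (d * L)) \<le> \<kappa> * ((A + D) * (H + d * L))"
        using \<kappa> A D d pos by (intro mult_left_mono) (auto simp: algebra_simps)
      also have "\<dots> \<le> Q"
        unfolding Q_def C0_def using m d pos by (simp add: algebra_simps)
      finally have "\<delta> * (\<kappa> * (A * H + D * (d * L))) \<le> \<delta> * Q"
        using pos by (intro mult_left_mono) auto
      then have "\<delta> * (\<kappa> * (A * H + D * (d * L))) / Q \<le> \<delta>"
        using Q by (simp add: divide_le_eq)
      then show "4 * real CARD('n) * smooth_step 2 *
          (A * \<delta> * (H / Q) + L / Q * (D * \<delta> powr (1 - real CARD('n) / p))) \<le> \<delta>"
        unfolding \<kappa>_def[symmetric] d(2) using Q by (simp add: field_simps)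
    qed (use A D pos Q in auto)
    then have "m * (\<integral>x. h x * f x \<partial>lebesgue) \<le> Q * sigma_p p f \<delta>"
      using Q by (simp add: mult.assoc field_simps)
    then show "(\<integral>x. h x * f x \<partial>lebesgue)
        \<le> C0 / m * sigma_p p f \<delta> * (H + \<delta> powr (- real CARD('n) / p) * L)"
      using m by (simp add: Q_def d_def field_simps)
  qed
qed

lemma clip_cutoff_Cc:
  fixes g :: "'a::euclidean_space \<Rightarrow> real"
  assumes "continuous_on UNIV g"
  shows "(\<lambda>x. max 0 (min 1 (r + 1 - norm x)) * max (- B) (min B (g x))) \<in> Cc"
  unfolding Cc_def
proof (intro CollectI conjI)
  show "continuous_on UNIV (\<lambda>x. max 0 (min 1 (r + 1 - norm x)) * max (- B) (min B (g x)))"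
    by (intro continuous_intros assms)
  have "{x. max 0 (min 1 (r + 1 - norm x)) * max (- B) (min B (g x)) \<noteq> 0} \<subseteq> cball 0 (r + 1)"
    by (auto simp: max_def min_def split: if_splits)
  then show "bounded {x. max 0 (min 1 (r + 1 - norm x)) * max (- B) (min B (g x)) \<noteq> 0}"
    using bounded_subset bounded_cball by blast
qed

lemma bounded_measurable_approx_Cc:
  fixes h :: "'a::euclidean_space \<Rightarrow> real"
  assumes h: "h \<in> borel_measurable lebesgue" "\<And>x. \<bar>h x\<bar> \<le> B" "\<And>x. norm x > r \<Longrightarrow> h x = 0"
  obtains u where "\<And>k. u k \<in> Cc" "\<And>k x. \<bar>u k x\<bar> \<le> B" "\<And>k x. norm x > r + 1 \<Longrightarrow> u k x = 0"
    "AE x in lebesgue. (\<lambda>k. u k x) \<longlonglongrightarrow> h x"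
proof -
  have "h measurable_on UNIV"
    by (rule lebesgue_measurable_imp_measurable_on_real[OF h(1)]) simp
  then obtain N g where N: "negligible N" and g: "\<And>n. continuous_on UNIV (g n)"
      "\<And>x. x \<notin> N \<Longrightarrow> (\<lambda>n. g n x) \<longlonglongrightarrow> h x"
    by (auto simp: measurable_on_def)
  have B: "B \<ge> 0" using h(2)[of 0] by linarith
  let ?u = "\<lambda>k x. max 0 (min 1 (r + 1 - norm x)) * max (- B) (min B (g k x))"
  show ?thesis
  proof (rule that[of ?u])
    show "?u k \<in> Cc" for k by (rule clip_cutoff_Cc[OF g(1)])
    show "\<bar>?u k x\<bar> \<le> B" for k x
    proof -
      have "\<bar>max 0 (min 1 (r + 1 - norm x))\<bar> * \<bar>max (- B) (min B (g k x))\<bar> \<le> 1 * B"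
        using B by (intro mult_mono) auto
      then show ?thesis by (simp add: abs_mult)
    qed
    show "?u k x = 0" if "norm x > r + 1" for k x using that by simp
    have "AE x in lebesgue. x \<notin> N"
      using N by (intro AE_not_in) (simp add: negligible_iff_null_sets)
    then show "AE x in lebesgue. (\<lambda>k. ?u k x) \<longlonglongrightarrow> h x"
    proof eventually_elim
      case (elim x)
      have "(\<lambda>k. ?u k x) \<longlonglongrightarrow> max 0 (min 1 (r + 1 - norm x)) * max (- B) (min B (h x))"
        by (intro tendsto_intros g(2) elim)
      also have "max 0 (min 1 (r + 1 - norm x)) * max (- B) (min B (h x)) = h x"
        using h(2,3)[of x] by (cases "norm x > r") (auto simp: max_def min_def abs_le_iff)
      finally show ?case .
    qed
  qed
qed

text \<open>
  An upper bound for pairings that holds for all \<open>h\<close> in \<open>Cc\<close> with given bounds on the \<open>L\<^sup>q\<close>- and \<open>L\<^sup>1\<close>-norms extends to bounded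
  measurable functions of bounded support. Strict inequalities for the integral norms ensure that the
  approximating continuous functions eventually satisfy the bounds; for \<open>q = \<infinity>\<close> they do so because they are
  clipped at the level \<open>B\<close>.
\<close>

lemma pairing_le_extend_Cc:
  fixes f h :: "'a::euclidean_space \<Rightarrow> real"
  assumes p: "p \<ge> 1" and f: "f \<in> Lp_space (ereal p)"
    and Cc: "\<And>h. h \<in> Cc \<Longrightarrow> qnorm_le p h H \<Longrightarrow> (\<integral>\<^sup>+ y. ennreal \<bar>h y\<bar> \<partial>lborel) \<le> ennreal L \<Longrightarrow>
      (\<integral>x. h x * f x \<partial>lebesgue) \<le> X"
    and h: "h \<in> borel_measurable lebesgue" "\<And>x. \<bar>h x\<bar> \<le> B" "\<And>x. norm x > r \<Longrightarrow> h x = 0"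
    and H: "p = 1 \<Longrightarrow> B \<le> H"
      "p > 1 \<Longrightarrow> (\<integral>\<^sup>+ x. ennreal (\<bar>h x\<bar> powr (p / (p - 1))) \<partial>lebesgue) < ennreal (H powr (p / (p - 1)))"
    and L: "(\<integral>\<^sup>+ x. ennreal \<bar>h x\<bar> \<partial>lebesgue) < ennreal L"
  shows "(\<integral>x. h x * f x \<partial>lebesgue) \<le> X"
proof -
  obtain u where u: "\<And>k. u k \<in> Cc" "\<And>k x. \<bar>u k x\<bar> \<le> B" "\<And>k x. norm x > r + 1 \<Longrightarrow> u k x = 0"
      "AE x in lebesgue. (\<lambda>k. u k x) \<longlonglongrightarrow> h x"
    using bounded_measurable_approx_Cc[OF h] by blast
  have um [measurable]: "u k \<in> borel_measurable lebesgue" for k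
    by (rule borel_imp_lebesgue_measurable[OF Cc_measurable[OF u(1)]])
  note [measurable] = h(1)
  have B: "B \<ge> 0" using h(2)[of 0] by linarith
  have conv: "(\<lambda>k. \<integral>\<^sup>+ x. ennreal (\<bar>u k x\<bar> powr s) \<partial>lebesgue) \<longlonglongrightarrow> (\<integral>\<^sup>+ x. ennreal (\<bar>h x\<bar> powr s) \<partial>lebesgue)"
    if s: "s > 0" for s
  proof (rule nn_integral_dominated_convergence)
    have [measurable]: "cball (0::'a) (r + 1) \<in> sets lebesgue" by simp
    show "(\<lambda>x. ennreal (B powr s) * indicator (cball (0::'a) (r + 1)) x) \<in> borel_measurable lebesgue"
      by measurable
    show "AE x in lebesgue. ennreal (\<bar>u k x\<bar> powr s) \<le> ennreal (B powr s) * indicator (cball 0 (r + 1)) x" for k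
    proof (rule AE_I2)
      fix x
      show "ennreal (\<bar>u k x\<bar> powr s) \<le> ennreal (B powr s) * indicator (cball 0 (r + 1)) x"
        using u(2)[of k x] u(3)[of x k] s
        by (cases "norm x > r + 1") (auto simp: indicator_def intro!: ennreal_leI powr_mono2)
    qed
    have "(\<integral>\<^sup>+ x. ennreal (B powr s) * indicator (cball (0::'a) (r + 1)) x \<partial>lebesgue)
        = ennreal (B powr s) * emeasure lebesgue (cball (0::'a) (r + 1))"
      by (rule nn_integral_cmult_indicator) simp
    also have "\<dots> < \<infinity>"
      using emeasure_lborel_cball_finite[of "0::'a" "r + 1"] by (simp add: ennreal_mult_less_top)
    finally show "(\<integral>\<^sup>+ x. ennreal (B powr s) * indicator (cball (0::'a) (r + 1)) x \<partial>lebesgue) < \<infinity>" .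
    show "AE x in lebesgue. (\<lambda>k. ennreal (\<bar>u k x\<bar> powr s)) \<longlonglongrightarrow> ennreal (\<bar>h x\<bar> powr s)"
      using u(4)
    proof eventually_elim
      case (elim x)
      then show ?case using s by (intro tendsto_ennrealI tendsto_powr2 tendsto_rabs tendsto_const) auto
    qed
  qed measurable
  have "(\<lambda>k. \<integral>\<^sup>+ x. ennreal \<bar>u k x\<bar> \<partial>lebesgue) \<longlonglongrightarrow> (\<integral>\<^sup>+ x. ennreal \<bar>h x\<bar> \<partial>lebesgue)"
    using conv[of 1] by simp
  then have evL: "\<forall>\<^sub>F k in sequentially. (\<integral>\<^sup>+ x. ennreal \<bar>u k x\<bar> \<partial>lebesgue) < ennreal L"
    using L by (rule order_tendstoD(2))
  have evH: "\<forall>\<^sub>F k in sequentially. qnorm_le p (u k) H"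
  proof (cases "p = 1")
    case True
    have "\<bar>u k x\<bar> \<le> H" for k x using u(2)[of k x] H(1)[OF True] by linarith
    then show ?thesis using True by (simp add: qnorm_le_def)
  next
    case False
    with p have p': "p > 1" by simp
    then have q: "p / (p - 1) > 0" by simp
    show ?thesis
      using order_tendstoD(2)[OF conv[OF q] H(2)[OF p']]
      by eventually_elim (use False in \<open>simp add: qnorm_le_def nn_integral_completion\<close>)
  qed
  have "\<forall>\<^sub>F k in sequentially. (\<integral>x. u k x * f x \<partial>lebesgue) \<le> X"
    using evL evH
    by eventually_elim (rule Cc[OF u(1)], simp_all add: nn_integral_completion)
  moreover have "(\<lambda>k. \<integral>x. u k x * f x \<partial>lebesgue) \<longlonglongrightarrow> (\<integral>x. h x * f x \<partial>lebesgue)"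
  proof (rule integral_dominated_convergence)
    have fm: "f \<in> borel_measurable lebesgue" using f by (simp add: Lp_space_iff)
    show "integrable lebesgue (\<lambda>x. norm (B * (indicator (cball 0 (r + 1)) x * f x)))"
      by (intro integrable_norm integrable_mult_right Lp_integrable_on_ball[OF p f])
    show "(\<lambda>x. h x * f x) \<in> borel_measurable lebesgue" "(\<lambda>x. u k x * f x) \<in> borel_measurable lebesgue" for k
      by (intro borel_measurable_times h um fm)+
    show "AE x in lebesgue. (\<lambda>k. u k x * f x) \<longlonglongrightarrow> h x * f x"
      using u(4) by eventually_elim (rule tendsto_mult_right)
    show "AE x in lebesgue. norm (u k x * f x) \<le> norm (B * (indicator (cball 0 (r + 1)) x * f x))" for k
      using u(2)[of k] u(3)[of _ k] B
      by (intro AE_I2) (auto simp: abs_mult indicator_def not_le intro: mult_right_mono)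
  qed
  ultimately show ?thesis
    by (intro tendsto_upperbound[of "\<lambda>k. \<integral>x. u k x * f x \<partial>lebesgue" _ sequentially]) auto
qed

section \<open>Tails of \<open>f\<close> are controlled by \<open>\<sigma>\<^sub>p\<close>\<close>

lemma Lp_norm_eq:
  fixes f :: "'a::euclidean_space \<Rightarrow> real"
  assumes p: "p \<ge> 1" and f: "f \<in> Lp_space (ereal p)"
  shows "(\<integral>\<^sup>+ x. ennreal (\<bar>f x\<bar> powr p) \<partial>lebesgue) = ennreal (enn2real (Lp_norm (ereal p) f) powr p)"
proof -
  define I where "I = (\<integral>\<^sup>+ x. ennreal (\<bar>f x\<bar> powr p) \<partial>lebesgue)"
  have I: "I < \<infinity>" using f by (simp add: Lp_space_iff I_def)
  then have "Lp_norm (ereal p) f = ennreal (enn2real I powr (1 / p))"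
    by (simp add: Lp_norm_def I_def[symmetric] Let_def)
  then have "enn2real (Lp_norm (ereal p) f) powr p = enn2real I"
    using p by (simp add: powr_powr)
  with I show ?thesis by (simp add: I_def less_top)
qed

text \<open>
  The test function is \<open>h = sgn f \<bar>f\<bar>\<^sup>p\<^sup>-\<^sup>1\<close> on the set \<open>E\<close> of the indicator, with \<open>T\<close> the integral of \<open>\<bar>f\<bar>\<^sup>p\<close> over \<open>E\<close>.
  Then \<open>\<integral> h f = T\<close> and \<open>\<parallel>h\<parallel>\<^sub>q = T\<^sup>1\<^sup>-\<^sup>1\<^sup>/\<^sup>p\<close>. Since \<open>\<bar>f\<bar> \<ge> t \<parallel>f\<parallel>\<^sub>p\<close> on \<open>E\<close> and \<open>T\<^sup>1\<^sup>/\<^sup>p \<le> \<parallel>f\<parallel>\<^sub>p\<close>, also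
  \<open>t \<parallel>h\<parallel>\<^sub>1 \<le> T / \<parallel>f\<parallel>\<^sub>p \<le> T\<^sup>1\<^sup>-\<^sup>1\<^sup>/\<^sup>p\<close>, and the assumed pairing bound gives \<open>T\<^sup>1\<^sup>/\<^sup>p \<le> 4 C s\<close>. The bounds by \<open>j\<close> make \<open>h\<close>
  bounded with bounded support.
\<close>

lemma truncated_tail_le_sigma_p:
  fixes f :: "real ^ 'n::finite \<Rightarrow> real"
  assumes p: "p = 1 \<or> (1 < p \<and> p < real CARD('n))"
    and f: "f \<in> Lp_space (ereal p)" and F: "Lp_norm (ereal p) f > 0" and t: "t > 0"
    and C: "C > 0" "\<And>h H L. \<lbrakk>h \<in> Cc; H > 0; L > 0; qnorm_le p h H;
        (\<integral>\<^sup>+ y. ennreal \<bar>h y\<bar> \<partial>lborel) \<le> ennreal L\<rbrakk> \<Longrightarrow>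
      (\<integral>x. h x * f x \<partial>lebesgue) \<le> C * s * (H + t * L)"
    and j: "j \<ge> 0"
  shows "(\<integral>\<^sup>+ x. ennreal (\<bar>f x\<bar> powr p) *
        indicator {x. t * enn2real (Lp_norm (ereal p) f) \<le> \<bar>f x\<bar> \<and> \<bar>f x\<bar> \<le> j \<and> norm x \<le> j} x \<partial>lebesgue)
      \<le> ennreal ((4 * C) powr p) * ennreal (s powr p)"
proof -
  have p1: "p \<ge> 1" using p by auto
  define F where "F = enn2real (Lp_norm (ereal p) f)"
  have "Lp_norm (ereal p) f < \<infinity>" using f by (simp add: Lp_space_def)
  then have F0: "F > 0" using F by (simp add: F_def enn2real_positive_iff)
  have fm [measurable]: "f \<in> borel_measurable lebesgue" using f by (simp add: Lp_space_iff)
  define E where "E = {x. t * F \<le> \<bar>f x\<bar> \<and> \<bar>f x\<bar> \<le> j \<and> norm x \<le> j}"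
  have nm [measurable]: "(\<lambda>x::real ^ 'n. norm x) \<in> borel_measurable lebesgue"
    by (rule borel_imp_lebesgue_measurable) measurable
  have Em [measurable]: "E \<in> sets lebesgue"
  proof -
    have "{x \<in> space lebesgue. t * F \<le> \<bar>f x\<bar> \<and> \<bar>f x\<bar> \<le> j \<and> norm x \<le> j} \<in> sets lebesgue"
      by measurable
    then show ?thesis by (simp add: E_def)
  qed
  define I where "I = (\<integral>\<^sup>+ x. ennreal (\<bar>f x\<bar> powr p) * indicator E x \<partial>lebesgue)"
  define T where "T = enn2real I"
  have "I \<le> (\<integral>\<^sup>+ x. ennreal (\<bar>f x\<bar> powr p) \<partial>lebesgue)"
    unfolding I_def by (intro nn_integral_mono) (auto simp: indicator_def)
  also have IF: "\<dots> = ennreal (F powr p)" unfolding F_def by (rule Lp_norm_eq[OF p1 f])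
  finally have I: "I \<le> ennreal (F powr p)" .
  then have "I < \<infinity>" by (rule le_less_trans) simp
  then have IT: "I = ennreal T" by (simp add: T_def less_top)
  have TF: "T \<le> F powr p" using I unfolding IT by (simp add: ennreal_le_iff)
  have "I \<le> ennreal ((4 * C) powr p) * ennreal (s powr p)"
  proof (cases "T > 0")
    case False
    then have "T = 0" by (simp add: T_def not_less order_antisym)
    then show ?thesis by (simp add: IT)
  next
    case True
    define h where "h = (\<lambda>x. indicator E x * (sgn (f x) * \<bar>f x\<bar> powr (p - 1)))"
    have hm: "h \<in> borel_measurable lebesgue" unfolding h_def sgn_if by measurable
    have fE: "\<bar>f x\<bar> > 0" if "x \<in> E" for x
      using that mult_pos_pos[OF t F0] by (auto simp: E_def)
    have habs: "\<bar>h x\<bar> = indicator E x * \<bar>f x\<bar> powr (p - 1)" for x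
      using fE[of x] by (auto simp: h_def indicator_def abs_mult abs_sgn_eq)
    \<comment> \<open>The factors \<open>2\<close> create the room needed for strict inequalities.\<close>
    define H where "H = 2 * T powr (1 - 1 / p)"
    define L where "L = 2 * T powr (1 - 1 / p) / t"
    have HL: "H > 0" "L > 0" using True t by (auto simp: H_def L_def)
    have hf: "h x * f x = \<bar>f x\<bar> powr p * indicator E x" for x
    proof (cases "x \<in> E")
      case True
      then have "sgn (f x) * \<bar>f x\<bar> powr (p - 1) * f x = \<bar>f x\<bar> powr (p - 1) * \<bar>f x\<bar>"
        by (simp add: sgn_if)
      also have "\<dots> = \<bar>f x\<bar> powr p" using fE[OF True] powr_add[of "\<bar>f x\<bar>" "p - 1" 1] by simp
      finally show ?thesis using True by (simp add: h_def)
    qed (simp add: h_def)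
    have "(\<integral>x. h x * f x \<partial>lebesgue) \<le> C * s * (H + t * L)"
    proof (rule pairing_le_extend_Cc[OF p1 f C(2)[OF _ HL] hm, where B = "1 + j powr (p - 1) * of_bool (p \<noteq> 1)" and r = j])
      show "\<bar>h x\<bar> \<le> 1 + j powr (p - 1) * of_bool (p \<noteq> 1)" for x
      proof (cases "x \<in> E")
        case xE: True
        show ?thesis
        proof (cases "p = 1")
          case True
          then show ?thesis using xE fE[OF xE] by (simp add: habs)
        next
          case False
          have "\<bar>f x\<bar> powr (p - 1) \<le> j powr (p - 1)"
            using xE p1 by (intro powr_mono2) (auto simp: E_def)
          then show ?thesis using xE False by (simp add: habs)
        qed
      qed (simp add: habs)
      show "h x = 0" if "norm x > j" for x using that by (simp add: h_def E_def indicator_def)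
      show "1 + j powr (p - 1) * of_bool (p \<noteq> 1) \<le> H" if "p = 1"
        using that True by (simp add: H_def)
      show "(\<integral>\<^sup>+ x. ennreal (\<bar>h x\<bar> powr (p / (p - 1))) \<partial>lebesgue) < ennreal (H powr (p / (p - 1)))"
        if p: "p > 1"
      proof -
        have "\<bar>h x\<bar> powr (p / (p - 1)) = \<bar>f x\<bar> powr p * indicator E x" for x
          using p by (cases "x \<in> E") (auto simp: habs powr_powr)
        then have "(\<integral>\<^sup>+ x. ennreal (\<bar>h x\<bar> powr (p / (p - 1))) \<partial>lebesgue) = ennreal T"
          unfolding IT[symmetric] I_def by (intro nn_integral_cong) (simp add: indicator_def)
        also have "\<dots> < ennreal (H powr (p / (p - 1)))"
        proof -
          have "1 - 1 / p = (p - 1) / p" using p by (simp add: diff_divide_distrib)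
          then have e: "(1 - 1 / p) * (p / (p - 1)) = 1" using p by simp
          have "H powr (p / (p - 1)) = 2 powr (p / (p - 1)) * T powr ((1 - 1 / p) * (p / (p - 1)))"
            using True by (simp add: H_def powr_mult powr_powr)
          also have "\<dots> = 2 powr (p / (p - 1)) * T" unfolding e using True by simp
          also have "\<dots> > 1 * T"
          proof (rule mult_strict_right_mono[OF _ True])
            show "1 < (2::real) powr (p / (p - 1))"
              using p powr_less_mono[of 0 "p / (p - 1)" 2] by simp
          qed
          finally show ?thesis using True by (simp add: ennreal_less_iff)
        qed
        finally show ?thesis .
      qed
      have "(\<integral>\<^sup>+ x. ennreal \<bar>h x\<bar> \<partial>lebesgue)
          \<le> (\<integral>\<^sup>+ x. ennreal (1 / (t * F)) * (ennreal (\<bar>f x\<bar> powr p) * indicator E x) \<partial>lebesgue)"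
      proof (rule nn_integral_mono)
        fix x
        show "ennreal \<bar>h x\<bar> \<le> ennreal (1 / (t * F)) * (ennreal (\<bar>f x\<bar> powr p) * indicator E x)"
        proof (cases "x \<in> E")
          case xE: True
          have "\<bar>f x\<bar> powr (p - 1) * (t * F) \<le> \<bar>f x\<bar> powr (p - 1) * \<bar>f x\<bar>"
            using xE by (intro mult_left_mono) (auto simp: E_def)
          also have "\<dots> = \<bar>f x\<bar> powr p" using fE[OF xE] powr_add[of "\<bar>f x\<bar>" "p - 1" 1] by simp
          finally have "\<bar>f x\<bar> powr (p - 1) \<le> 1 / (t * F) * \<bar>f x\<bar> powr p"
            using t F0 by (simp add: field_simps)
          then show ?thesis using xE t F0 by (simp add: habs ennreal_leI flip: ennreal_mult)
        qed (simp add: habs)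
      qed
      also have "\<dots> = ennreal (1 / (t * F)) * ennreal T"
        unfolding IT[symmetric] I_def by (rule nn_integral_cmult) measurable
      also have "\<dots> = ennreal (T / (t * F))" using True t F0 by (simp flip: ennreal_mult)
      also have "\<dots> < ennreal L"
      proof -
        have "T powr (1 / p) \<le> (F powr p) powr (1 / p)"
          using True TF p1 by (intro powr_mono2) auto
        then have TF': "T powr (1 / p) \<le> F" using p1 F0 by (simp add: powr_powr)
        have "T = T powr (1 - 1 / p) * T powr (1 / p)" using True by (simp flip: powr_add)
        also have "\<dots> \<le> T powr (1 - 1 / p) * F" by (intro mult_left_mono TF') simp
        also have "\<dots> < 2 * T powr (1 - 1 / p) * F" using True F0 by simp
        finally have "T / (t * F) < L"
          using t F0 by (simp add: L_def field_simps)
        then show ?thesis using HL by (simp add: ennreal_lessI)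
      qed
      finally show "(\<integral>\<^sup>+ x. ennreal \<bar>h x\<bar> \<partial>lebesgue) < ennreal L" .
    qed
    moreover have "(\<integral>x. h x * f x \<partial>lebesgue) = T"
    proof -
      have "(\<integral>x. h x * f x \<partial>lebesgue) = enn2real (\<integral>\<^sup>+ x. ennreal (\<bar>f x\<bar> powr p * indicator E x) \<partial>lebesgue)"
        unfolding hf by (rule integral_eq_nn_integral) auto
      also have "(\<integral>\<^sup>+ x. ennreal (\<bar>f x\<bar> powr p * indicator E x) \<partial>lebesgue) = I"
        unfolding I_def by (intro nn_integral_cong) (auto simp: indicator_def)
      finally show ?thesis by (simp add: T_def)
    qed
    ultimately have "T \<le> C * s * (H + t * L)" by simp
    also have "\<dots> = 4 * C * s * T powr (1 - 1 / p)" using t by (simp add: H_def L_def)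
    finally have "T powr (1 - 1 / p) * T powr (1 / p) \<le> T powr (1 - 1 / p) * (4 * C * s)"
      using True by (simp add: mult_ac flip: powr_add)
    then have T: "T powr (1 / p) \<le> 4 * C * s" using True by simp
    have s: "s > 0"
    proof -
      have "0 < T powr (1 / p)" using True by simp
      also note T
      finally show ?thesis using C(1) by (simp add: zero_less_mult_iff)
    qed
    have "T = (T powr (1 / p)) powr p" using True p1 by (simp add: powr_powr)
    also have "\<dots> \<le> (4 * C * s) powr p" using T p1 by (intro powr_mono2) auto
    also have "\<dots> = (4 * C) powr p * s powr p" using C(1) s by (simp add: powr_mult)
    finally show ?thesis by (simp add: IT ennreal_leI flip: ennreal_mult)
  qed
  then show ?thesis by (simp add: I_def E_def F_def)
qed

lemma tail_le_sigma_p: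
  fixes f :: "real ^ 'n::finite \<Rightarrow> real"
  assumes p: "p = 1 \<or> (1 < p \<and> p < real CARD('n))"
    and f: "f \<in> Lp_space (ereal p)" and F: "Lp_norm (ereal p) f > 0"
  obtains K where "K > 0"
    "\<And>t. t > 0 \<Longrightarrow>
      (\<integral>\<^sup>+ x. ennreal (\<bar>f x\<bar> powr p) * indicator {x. t * enn2real (Lp_norm (ereal p) f) \<le> \<bar>f x\<bar>} x \<partial>lebesgue)
        \<le> ennreal K * ennreal (sigma_p p f (t powr (- p / real CARD('n))) powr p)"
proof -
  have p1: "p \<ge> 1" using p by auto
  obtain C where C: "C > 0"
    "\<And>(f :: real ^ 'n \<Rightarrow> real) h \<delta> H L. \<lbrakk>f \<in> Lp_space (ereal p); h \<in> Cc; \<delta> > 0; H > 0; L > 0; qnorm_le p h H;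
        (\<integral>\<^sup>+ y. ennreal \<bar>h y\<bar> \<partial>lborel) \<le> ennreal L\<rbrakk> \<Longrightarrow>
      (\<integral>x. h x * f x \<partial>lebesgue) \<le> C * sigma_p p f \<delta> * (H + \<delta> powr (- real CARD('n) / p) * L)"
    using pairing_le_sigma_p_Cc[OF p] by blast
  show ?thesis
  proof
    show "(4 * C) powr p > 0" using C(1) by simp
    fix t :: real
    assume t: "t > 0"
    define \<delta> where "\<delta> = t powr (- p / real CARD('n))"
    have \<delta>: "\<delta> > 0" "\<delta> powr (- real CARD('n) / p) = t"
      using t p1 by (auto simp: \<delta>_def powr_powr)
    define F where "F = enn2real (Lp_norm (ereal p) f)"
    have fm [measurable]: "f \<in> borel_measurable lebesgue" using f by (simp add: Lp_space_iff)
    have nm [measurable]: "(\<lambda>x::real ^ 'n. norm x) \<in> borel_measurable lebesgue"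
      by (rule borel_imp_lebesgue_measurable) measurable
    define E where "E = (\<lambda>j. {x. t * F \<le> \<bar>f x\<bar> \<and> \<bar>f x\<bar> \<le> real j \<and> norm x \<le> real j})"
    have Em [measurable]: "E j \<in> sets lebesgue" for j
    proof -
      have "{x \<in> space lebesgue. t * F \<le> \<bar>f x\<bar> \<and> \<bar>f x\<bar> \<le> real j \<and> norm x \<le> real j} \<in> sets lebesgue"
        by measurable
      then show ?thesis by (simp add: E_def)
    qed
    let ?v = "\<lambda>j x. ennreal (\<bar>f x\<bar> powr p) * indicator (E j) x"
    let ?X = "ennreal ((4 * C) powr p) * ennreal (sigma_p p f \<delta> powr p)"
    have "(\<lambda>j. integral\<^sup>N lebesgue (?v j))
        \<longlonglongrightarrow> (\<integral>\<^sup>+ x. ennreal (\<bar>f x\<bar> powr p) * indicator {x. t * F \<le> \<bar>f x\<bar>} x \<partial>lebesgue)"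
    proof (rule nn_integral_LIMSEQ)
      show "incseq ?v"
        by (auto simp: incseq_def le_fun_def E_def indicator_def)
      show "?v j \<in> borel_measurable lebesgue" for j by measurable
      show "(\<lambda>j. ?v j x) \<longlonglongrightarrow> ennreal (\<bar>f x\<bar> powr p) * indicator {x. t * F \<le> \<bar>f x\<bar>} x" for x
      proof (rule tendsto_eventually)
        obtain j0 :: nat where "max \<bar>f x\<bar> (norm x) \<le> real j0" using real_arch_simple by blast
        then have j: "\<bar>f x\<bar> \<le> real j \<and> norm x \<le> real j" if "j \<ge> j0" for j
          using that by (meson max.boundedE of_nat_le_iff order_trans)
        show "\<forall>\<^sub>F j in sequentially. ?v j x = ennreal (\<bar>f x\<bar> powr p) * indicator {x. t * F \<le> \<bar>f x\<bar>} x"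
          using eventually_ge_at_top[of j0]
          by eventually_elim (use j in \<open>auto simp: E_def indicator_def\<close>)
      qed
    qed
    moreover have "integral\<^sup>N lebesgue (?v j) \<le> ?X" for j
      unfolding E_def F_def
      by (rule truncated_tail_le_sigma_p[OF p f F t C(1) C(2)[OF f _ \<delta>(1), unfolded \<delta>(2)]]) auto
    ultimately have "(\<integral>\<^sup>+ x. ennreal (\<bar>f x\<bar> powr p) * indicator {x. t * F \<le> \<bar>f x\<bar>} x \<partial>lebesgue) \<le> ?X"
      by (intro LIMSEQ_le_const2) auto
    then show "(\<integral>\<^sup>+ x. ennreal (\<bar>f x\<bar> powr p) *
          indicator {x. t * enn2real (Lp_norm (ereal p) f) \<le> \<bar>f x\<bar>} x \<partial>lebesgue)
        \<le> ennreal ((4 * C) powr p) * ennreal (sigma_p p f (t powr (- p / real CARD('n))) powr p)"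
      by (simp add: F_def \<delta>_def)
  qed
qed

section \<open>Integration against the Stieltjes measure\<close>

lemma stieltjes_measure_facts:
  fixes U :: "real \<Rightarrow> real"
  assumes "mono_on {0..} U" "continuous_on {0..} U"
  shows "sigma_finite_measure (stieltjes_measure U)"
    and "0 \<le> a \<Longrightarrow> a \<le> b \<Longrightarrow> emeasure (stieltjes_measure U) {a..b} = ennreal (U b - U a)"
    and "sets (stieltjes_measure U) = sets borel"
proof -
  have mono: "U (max 0 x) \<le> U (max 0 y)" if "x \<le> y" for x y
    using assms(1) that by (auto simp: mono_on_def)
  have cont: "continuous_on UNIV (\<lambda>t. U (max 0 t))"
    by (rule continuous_on_compose2[OF assms(2)]) (auto intro: continuous_intros)
  show "sigma_finite_measure (stieltjes_measure U)"
    unfolding stieltjes_measure_def using mono cont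
    by (intro sigma_finite_interval_measure)
       (auto simp: continuous_on_eq_continuous_at intro: continuous_at_imp_continuous_within)
  show "0 \<le> a \<Longrightarrow> a \<le> b \<Longrightarrow> emeasure (stieltjes_measure U) {a..b} = ennreal (U b - U a)"
    unfolding stieltjes_measure_def
    by (subst emeasure_interval_measure_Icc[OF _ mono cont]) auto
qed (simp add: stieltjes_measure_def)

theorem theorem3p3:
  fixes f :: "real ^ 'n::finite \<Rightarrow> real" and p N :: real and U :: "real \<Rightarrow> real"
  assumes "(1 \<le> p \<and> p < real CARD('n)) \<or> (CARD('n) = 1 \<and> p = 1)"
    and "f \<in> Lp_space (ereal p)"
    and "Lp_norm (ereal p) f > 0"
    and "\<And>t. 0 \<le> t \<Longrightarrow> 0 \<le> U t"
    and "mono_on {0..} U"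
    and "continuous_on {0..} U"
    and "N > 0"
    and "(\<integral>\<^sup>+ t\<in>{N..}. ennreal (sigma_p p f (t powr (- p / real CARD('n))) powr p)
            \<partial>stieltjes_measure U) < \<infinity>"
  shows "(\<integral>\<^sup>+ x. ennreal (\<bar>f x\<bar> powr p * U (\<bar>f x\<bar> / enn2real (Lp_norm (ereal p) f)))
            \<partial>lebesgue) < \<infinity>"
proof -
  have p: "p = 1 \<or> (1 < p \<and> p < real CARD('n))" and p1: "p \<ge> 1" using assms(1) by auto
  note f = assms(2) and U0 = assms(4) and N = assms(7)
  obtain K where K: "K > 0"
    "\<And>t. t > 0 \<Longrightarrow>
      (\<integral>\<^sup>+ x. ennreal (\<bar>f x\<bar> powr p) * indicator {x. t * enn2real (Lp_norm (ereal p) f) \<le> \<bar>f x\<bar>} x \<partial>lebesgue)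
        \<le> ennreal K * ennreal (sigma_p p f (t powr (- p / real CARD('n))) powr p)"
    using tail_le_sigma_p[OF p f assms(3)] by blast
  define F where "F = enn2real (Lp_norm (ereal p) f)"
  have "Lp_norm (ereal p) f < \<infinity>" using f by (simp add: Lp_space_def)
  then have F0: "F > 0" using assms(3) by (simp add: F_def enn2real_positive_iff)
  let ?\<mu> = "stieltjes_measure U"
  note \<mu> = stieltjes_measure_facts[OF assms(5,6)]
  note [measurable_cong] = \<mu>(3)
  interpret pair_sigma_finite "lborel :: (real ^ 'n) measure" ?\<mu>
    by (intro pair_sigma_finite.intro sigma_finite_lborel \<mu>(1))
  have "f \<in> borel_measurable lebesgue" using f by (simp add: Lp_space_iff)
  then obtain g where g [measurable]: "g \<in> borel_measurable lborel" and fg: "AE x in lborel. f x = g x"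
    using completion_ex_borel_measurable_real by blast
  have to_g: "(\<integral>\<^sup>+ x. \<phi> (f x) \<partial>lebesgue) = (\<integral>\<^sup>+ x. \<phi> (g x) \<partial>lborel)" for \<phi> :: "real \<Rightarrow> ennreal"
    unfolding nn_integral_completion using fg by (intro nn_integral_cong_AE) auto
  define T where "T = (\<lambda>t. \<integral>\<^sup>+ x. (if t * F \<le> \<bar>g x\<bar> then ennreal (\<bar>g x\<bar> powr p) else 0) \<partial>lborel)"
  have [measurable]: "T \<in> borel_measurable ?\<mu>"
    unfolding T_def by measurable
  have T: "T t \<le> ennreal K * ennreal (sigma_p p f (t powr (- p / real CARD('n))) powr p)" if "t > 0" for t
  proof -
    have "T t = (\<integral>\<^sup>+ x. ennreal (\<bar>f x\<bar> powr p) * indicator {x. t * F \<le> \<bar>f x\<bar>} x \<partial>lebesgue)"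
      unfolding T_def to_g[of "\<lambda>y. if t * F \<le> \<bar>y\<bar> then ennreal (\<bar>y\<bar> powr p) else 0", symmetric]
      by (intro nn_integral_cong) simp
    then show ?thesis using K(2)[OF that] by (simp add: F_def)
  qed
  \<comment> \<open>The integrand with \<open>\<sigma>\<^sub>p\<close> is not known to be measurable, so the constant is moved to the side of \<open>T\<close>.\<close>
  have Tfin: "(\<integral>\<^sup>+ t. T t * indicator {N..} t \<partial>?\<mu>) < \<infinity>"
  proof -
    have "(\<integral>\<^sup>+ t. ennreal (1 / K) * (T t * indicator {N..} t) \<partial>?\<mu>)
        \<le> (\<integral>\<^sup>+ t\<in>{N..}. ennreal (sigma_p p f (t powr (- p / real CARD('n))) powr p) \<partial>?\<mu>)"
    proof (rule nn_integral_mono)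
      fix t
      show "ennreal (1 / K) * (T t * indicator {N..} t)
          \<le> ennreal (sigma_p p f (t powr (- p / real CARD('n))) powr p) * indicator {N..} t"
      proof (cases "t \<ge> N")
        case True
        then have "ennreal (1 / K) * T t
            \<le> ennreal (1 / K) * (ennreal K * ennreal (sigma_p p f (t powr (- p / real CARD('n))) powr p))"
          using N by (intro mult_left_mono T) auto
        also have "\<dots> = ennreal (sigma_p p f (t powr (- p / real CARD('n))) powr p)"
          using K(1) by (simp flip: ennreal_mult)
        finally show ?thesis using True by simp
      qed simp
    qed
    also have "\<dots> < \<infinity>" by (rule assms(8))
    finally have "ennreal (1 / K) * (\<integral>\<^sup>+ t. T t * indicator {N..} t \<partial>?\<mu>) < \<infinity>"
      by (subst (asm) nn_integral_cmult) auto
    then show ?thesis using K(1) by (auto simp: ennreal_mult_less_top)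
  qed
  \<comment> \<open>\<open>U\<close> at a point beyond \<open>N\<close> is \<open>U N\<close> plus the measure of the interval in between.\<close>
  have layer: "ennreal (\<bar>y\<bar> powr p * U (\<bar>y\<bar> / F)) \<le> ennreal (U N) * ennreal (\<bar>y\<bar> powr p)
      + (\<integral>\<^sup>+ t. (if t * F \<le> \<bar>y\<bar> then ennreal (\<bar>y\<bar> powr p) else 0) * indicator {N..} t \<partial>?\<mu>)" for y
  proof -
    let ?s = "\<bar>y\<bar> / F"
    have s: "?s \<ge> 0" using F0 by simp
    have "ennreal (U ?s) \<le> ennreal (U N) + emeasure ?\<mu> {N..?s}"
    proof (cases "N \<le> ?s")
      case True
      have "U N \<le> U ?s" using True N assms(5) by (auto simp: mono_on_def)
      then show ?thesis
        using True N U0[of N] U0[OF s] by (simp add: \<mu>(2) flip: ennreal_plus)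
    next
      case False
      then have "U ?s \<le> U N" using s N assms(5) by (auto simp: mono_on_def)
      then show ?thesis by (simp add: add_increasing2 ennreal_leI)
    qed
    then have "ennreal (\<bar>y\<bar> powr p) * ennreal (U ?s)
        \<le> ennreal (\<bar>y\<bar> powr p) * (ennreal (U N) + emeasure ?\<mu> {N..?s})"
      by (intro mult_left_mono) auto
    also have "\<dots> = ennreal (U N) * ennreal (\<bar>y\<bar> powr p)
        + ennreal (\<bar>y\<bar> powr p) * emeasure ?\<mu> {N..?s}"
      by (simp add: distrib_left mult.commute)
    also have "ennreal (\<bar>y\<bar> powr p) * emeasure ?\<mu> {N..?s}
        = (\<integral>\<^sup>+ t. ennreal (\<bar>y\<bar> powr p) * indicator {N..?s} t \<partial>?\<mu>)"
      by (rule nn_integral_cmult_indicator[symmetric]) (simp add: \<mu>(3))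
    also have "\<dots> = (\<integral>\<^sup>+ t. (if t * F \<le> \<bar>y\<bar> then ennreal (\<bar>y\<bar> powr p) else 0) * indicator {N..} t \<partial>?\<mu>)"
      using F0 by (intro nn_integral_cong) (auto simp: indicator_def field_simps)
    finally show ?thesis using U0[OF s] by (simp add: ennreal_mult)
  qed
  have "(\<integral>\<^sup>+ x. ennreal (\<bar>f x\<bar> powr p * U (\<bar>f x\<bar> / F)) \<partial>lebesgue)
      = (\<integral>\<^sup>+ x. ennreal (\<bar>g x\<bar> powr p * U (\<bar>g x\<bar> / F)) \<partial>lborel)"
    by (rule to_g)
  also have "\<dots> \<le> (\<integral>\<^sup>+ x. ennreal (U N) * ennreal (\<bar>g x\<bar> powr p)
      + (\<integral>\<^sup>+ t. (if t * F \<le> \<bar>g x\<bar> then ennreal (\<bar>g x\<bar> powr p) else 0) * indicator {N..} t \<partial>?\<mu>) \<partial>lborel)"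
    by (intro nn_integral_mono layer)
  also have "\<dots> = (\<integral>\<^sup>+ x. ennreal (U N) * ennreal (\<bar>g x\<bar> powr p) \<partial>lborel)
      + (\<integral>\<^sup>+ x. (\<integral>\<^sup>+ t. (if t * F \<le> \<bar>g x\<bar> then ennreal (\<bar>g x\<bar> powr p) else 0) * indicator {N..} t \<partial>?\<mu>) \<partial>lborel)"
    by (rule nn_integral_add) measurable
  also have "(\<integral>\<^sup>+ x. (\<integral>\<^sup>+ t. (if t * F \<le> \<bar>g x\<bar> then ennreal (\<bar>g x\<bar> powr p) else 0) * indicator {N..} t \<partial>?\<mu>) \<partial>lborel)
      = (\<integral>\<^sup>+ t. (\<integral>\<^sup>+ x. (if t * F \<le> \<bar>g x\<bar> then ennreal (\<bar>g x\<bar> powr p) else 0) * indicator {N..} t \<partial>lborel) \<partial>?\<mu>)"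
    by (rule Fubini'[symmetric]) measurable
  also have "\<dots> = (\<integral>\<^sup>+ t. T t * indicator {N..} t \<partial>?\<mu>)"
    unfolding T_def by (intro nn_integral_cong nn_integral_multc) measurable
  also have "(\<integral>\<^sup>+ x. ennreal (U N) * ennreal (\<bar>g x\<bar> powr p) \<partial>lborel)
      = ennreal (U N) * (\<integral>\<^sup>+ x. ennreal (\<bar>f x\<bar> powr p) \<partial>lebesgue)"
    unfolding to_g[of "\<lambda>y. ennreal (\<bar>y\<bar> powr p)"] by (rule nn_integral_cmult) measurable
  also have "ennreal (U N) * (\<integral>\<^sup>+ x. ennreal (\<bar>f x\<bar> powr p) \<partial>lebesgue)
      + (\<integral>\<^sup>+ t. T t * indicator {N..} t \<partial>?\<mu>) < \<infinity>"
    using f Tfin by (simp add: Lp_space_iff ennreal_mult_less_top)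
  finally show ?thesis by (simp add: F_def)
qed

end
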